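(* Let $q\in\mathbb{C}$ with $|q|=1$ and $q$ not a root of unity, and let $\mathcal{A}_q=\mathcal{O}(U_q(2))$, $c=-\bar qDb^*$, $d=Da^*$. (i) For $l\in\frac12\mathbb{N}$, let $t^l_{ij}$, $i,j\in I_l=\{-l,-l+1,\dots,l\}$, be the matrix coefficients of the corepresentation $T_l^R$ with respect to the basis $\{f^l_j:j\in I_l\}$. Then $$t^l_{ij}=\sum_{\substack{m+n=l-i\\0\le m\le l-j\\0\le n\le l+j}}q^{n(l-j-m)}\,\frac{\binom{2l}{l+j}^{1/2}}{\binom{2l}{l+i}^{1/2}}\binom{l-j}{m}\binom{l+j}{n}\,a^mc^{\,l-j-m}b^nd^{\,l+j-n}.$$ (ii) For all $l,l'\in\frac12\mathbb{N}$, $i,j\in I_l$, $i',j'\in I_{l'}$, $m,m'\in\mathbb{Z}$, $$\langle t^l_{ij}D^m,\,t^{l'}_{i'j'}D^{m'}\rangle=(2l+1)^{-1}\delta_{ll'}\delta_{ii'}\delta_{jj'}\delta_{mm'}.$$ (iii) The set $\{\sqrt{2l+1}\,t^l_{ij}D^m:l\in\frac12\mathbb{N},\ i,j\in I_l,\ m\in\mathbb{Z}\}$ is an orthonormal basis of $L^2(h)$.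
   Context: $\mathbb{N}=\{0,1,2,\dots\}$. For $q\in\mathbb{C}\setminus\{0\}$, $C(U_q(2))$ is the universal unital $C^*$-algebra generated by $a,b,D$ subject to $$ba=qab,\quad a^*b=qba^*,\quad bb^*=b^*b,\quad aa^*+bb^*=1,\quad aD=Da,\quad bD=q^2|q|^{-2}Db,\quad DD^*=D^*D=1,\quad a^*a+|q|^2b^*b=1,$$ with comultiplication $\Delta(a)=a\otimes a-\bar q\,b\otimes Db^*$, $\Delta(b)=a\otimes b+b\otimes Da^*$, $\Delta(D)=D\otimes D$. $\mathcal{A}_q=\mathcal{O}(U_q(2))$ is the $*$-subalgebra generated by $a,b,D$. $h$ is the Haar state of $C(U_q(2))$ (the unique state that is left and right invariant under $\Delta$), $\langle x,y\rangle=h(x^*y)$, and $L^2(h)$ is the completion of $\mathcal{A}_q$ for this inner product. Binomial coefficients are the ordinary ones. For $l\in\frac12\mathbb{N}$ and $j\in I_l$ let $f^l_j=\binom{2l}{l+j}^{1/2}a^{l-j}b^{l+j}$ and $V_l^R=\bigoplus_{j\in I_l}\mathbb{C}f^l_j\subset\mathcal{A}_q$. The comultiplication restricts to a right corepresentation $T_l^R=\Delta|_{V_l^R}:V_l^R\to V_l^R\otimes\mathcal{A}_q$, with matrix coefficients $t^l_{ij}\in\mathcal{A}_q$ defined by $\Delta(f^l_j)=\sum_{i\in I_l}f^l_i\otimes t^l_{ij}$. *)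

theory Defs
  imports
    "HOL-Analysis.Analysis"
    "HOL-Library.Poly_Mapping"
    "HOL-Library.Nonpos_Ints"
begin

section \<open>Complex normed spaces, Hilbert spaces and unital C*-algebras\<close>

class scaleC =
  fixes scaleC :: "complex \<Rightarrow> 'a \<Rightarrow> 'a"  (infixr \<open>*\<^sub>C\<close> 75)

class complex_normed_space = real_normed_vector + scaleC +
  assumes scaleC_add_right: "c *\<^sub>C (x + y) = c *\<^sub>C x + c *\<^sub>C y"
    and scaleC_add_left: "(c + d) *\<^sub>C x = c *\<^sub>C x + d *\<^sub>C x"
    and scaleC_scaleC: "c *\<^sub>C d *\<^sub>C x = (c * d) *\<^sub>C x"
    and scaleC_of_real: "complex_of_real r *\<^sub>C x = r *\<^sub>R x"
    and norm_scaleC: "norm (c *\<^sub>C x) = cmod c * norm x"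

global_interpretation complex_vector:
  vector_space "scaleC :: complex \<Rightarrow> 'a \<Rightarrow> 'a::complex_normed_space"
proof
  fix x :: 'a
  show "1 *\<^sub>C x = x"
    using scaleC_of_real[of 1 x] by simp
qed (simp_all add: scaleC_add_right scaleC_add_left scaleC_scaleC)

(* The inner product is conjugate linear in the first argument. *)
class complex_hilbert_space = complex_normed_space + complete_space +
  fixes cinner :: "'a \<Rightarrow> 'a \<Rightarrow> complex"
  assumes cinner_add_right: "cinner x (y + z) = cinner x y + cinner x z"
    and cinner_scaleC_right: "cinner x (c *\<^sub>C y) = c * cinner x y"
    and cinner_commute: "cinner x y = cnj (cinner y x)"
    and cinner_same: "cinner x x = complex_of_real ((norm x)\<^sup>2)"

class unital_cstar_algebra = complex_normed_space + real_normed_algebra_1 + complete_space +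
  fixes star :: "'a \<Rightarrow> 'a"
  assumes mult_scaleC_left: "(c *\<^sub>C x) * y = c *\<^sub>C (x * y)"
    and mult_scaleC_right: "x * (c *\<^sub>C y) = c *\<^sub>C (x * y)"
    and star_add: "star (x + y) = star x + star y"
    and star_scaleC: "star (c *\<^sub>C x) = cnj c *\<^sub>C star x"
    and star_mult: "star (x * y) = star y * star x"
    and star_star: "star (star x) = x"
    and cstar_identity: "norm (star x * x) = (norm x)\<^sup>2"

definition star_hom :: "('a::unital_cstar_algebra \<Rightarrow> 'b::unital_cstar_algebra) \<Rightarrow> bool" where
  "star_hom \<phi> \<longleftrightarrow>
     (\<forall>x y. \<phi> (x + y) = \<phi> x + \<phi> y) \<and> (\<forall>c x. \<phi> (c *\<^sub>C x) = c *\<^sub>C \<phi> x) \<and>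
     (\<forall>x y. \<phi> (x * y) = \<phi> x * \<phi> y) \<and> (\<forall>x. \<phi> (star x) = star (\<phi> x)) \<and> \<phi> 1 = 1"

definition is_state :: "('a::unital_cstar_algebra \<Rightarrow> complex) \<Rightarrow> bool" where
  "is_state h \<longleftrightarrow>
     (\<forall>x y. h (x + y) = h x + h y) \<and> (\<forall>c x. h (c *\<^sub>C x) = c * h x) \<and>
     (\<forall>x. h (star x * x) \<in> \<real>\<^sub>\<ge>\<^sub>0) \<and> h 1 = 1"

(* S is a *-closed subalgebra; scalar multiplication sc and involution st are arguments,
   so that the notion applies to free *-algebras, which carry no norm. *)
definition cstar_seminorm_on ::
    "'x::ring set \<Rightarrow> (complex \<Rightarrow> 'x \<Rightarrow> 'x) \<Rightarrow> ('x \<Rightarrow> 'x) \<Rightarrow> ('x \<Rightarrow> real) \<Rightarrow> bool" where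
  "cstar_seminorm_on S sc st p \<longleftrightarrow>
     (\<forall>x\<in>S. 0 \<le> p x) \<and>
     (\<forall>x\<in>S. \<forall>y\<in>S. p (x + y) \<le> p x + p y) \<and>
     (\<forall>c. \<forall>x\<in>S. p (sc c x) = cmod c * p x) \<and>
     (\<forall>x\<in>S. \<forall>y\<in>S. p (x * y) \<le> p x * p y) \<and>
     (\<forall>x\<in>S. p (st x * x) = (p x)\<^sup>2)"


section \<open>Universal unital C*-algebras given by generators and relations\<close>

(* Words in the letters g and g*, for g a generator; the Boolean marks a starred letter. *)
datatype 'g word = Word "('g \<times> bool) list"

instantiation word :: (type) monoid_add
begin

definition zero_word :: "'a word" where
  "zero_word = Word []"

fun plus_word :: "'a word \<Rightarrow> 'a word \<Rightarrow> 'a word" where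
  "plus_word (Word u) (Word v) = Word (u @ v)"

instance
proof
  fix u v w :: "'a word"
  show "u + v + w = u + (v + w)"
    by (cases u; cases v; cases w) simp
  show "0 + u = u"
    by (cases u) (simp add: zero_word_def)
  show "u + 0 = u"
    by (cases u) (simp add: zero_word_def)
qed

end

(* The free unital *-algebra: the monoid algebra of words under concatenation, which is
   written additively as required by the convolution product of Poly_Mapping. *)
type_synonym 'g free_star_algebra = "'g word \<Rightarrow>\<^sub>0 complex"

definition free_gen :: "'g \<Rightarrow> 'g free_star_algebra" where
  "free_gen g = Poly_Mapping.single (Word [(g, False)]) 1"

definition free_scale :: "complex \<Rightarrow> 'g free_star_algebra \<Rightarrow> 'g free_star_algebra" where
  "free_scale c p = Poly_Mapping.single 0 c * p"

fun word_star :: "'g word \<Rightarrow> 'g word" where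
  "word_star (Word u) = Word (rev (map (\<lambda>(g, s). (g, \<not> s)) u))"

definition free_star :: "'g free_star_algebra \<Rightarrow> 'g free_star_algebra" where
  "free_star p =
     (\<Sum>w\<in>Poly_Mapping.keys p. Poly_Mapping.single (word_star w) (cnj (Poly_Mapping.lookup p w)))"

fun word_eval :: "('g \<Rightarrow> 'a::unital_cstar_algebra) \<Rightarrow> 'g word \<Rightarrow> 'a" where
  "word_eval x (Word u) = prod_list (map (\<lambda>(g, s). if s then star (x g) else x g) u)"

definition free_eval ::
    "('g \<Rightarrow> 'a::unital_cstar_algebra) \<Rightarrow> 'g free_star_algebra \<Rightarrow> 'a" where
  "free_eval x p = (\<Sum>w\<in>Poly_Mapping.keys p. Poly_Mapping.lookup p w *\<^sub>C word_eval x w)"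

(* The ambient algebra, with the elements x g, is the universal unital C*-algebra on the
   generators subject to the relations r = 0 (r in R): it is the completion of the free
   *-algebra with respect to the largest C*-seminorm that kills R.  That the seminorm
   f |-> norm (free_eval x f) is itself a C*-seminorm killing R is the first conjunct; the last
   one says that it dominates every other, in particular every seminorm f |-> norm (free_eval y f)
   coming from elements y g of some C*-algebra that satisfy the relations, which is how
   x g |-> y g extends to a unital *-homomorphism. *)
definition universal_cstar_algebra ::
    "('g \<Rightarrow> 'a::unital_cstar_algebra) \<Rightarrow> 'g free_star_algebra set \<Rightarrow> bool" where
  "universal_cstar_algebra x R \<longleftrightarrow>
     (\<forall>r\<in>R. free_eval x r = 0) \<and>
     closure (range (free_eval x)) = UNIV \<and>
     (\<forall>p. cstar_seminorm_on UNIV free_scale free_star p \<and> (\<forall>r\<in>R. p r = 0) \<longrightarrow>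
          (\<forall>f. p f \<le> norm (free_eval x f)))"


section \<open>Minimal tensor products\<close>

(* The fourth conjunct says that the algebraic tensor product embeds, as the span of the
   elementary tensors; the last one that its norm is the least C*-norm. *)
definition minimal_tensor_product ::
    "('a::unital_cstar_algebra \<Rightarrow> 'b::unital_cstar_algebra \<Rightarrow> 't::unital_cstar_algebra) \<Rightarrow> bool" where
  "minimal_tensor_product tens \<longleftrightarrow>
     (\<forall>x x' y. tens (x + x') y = tens x y + tens x' y) \<and>
     (\<forall>x y y'. tens x (y + y') = tens x y + tens x y') \<and>
     (\<forall>c x y. tens (c *\<^sub>C x) y = c *\<^sub>C tens x y \<and> tens x (c *\<^sub>C y) = c *\<^sub>C tens x y) \<and>
     (\<forall>X y. finite X \<and> complex_vector.independent X \<and> (\<Sum>x\<in>X. tens x (y x)) = 0 \<longrightarrow>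
            (\<forall>x\<in>X. y x = 0)) \<and>
     (\<forall>x x' y y'. tens x y * tens x' y' = tens (x * x') (y * y')) \<and>
     (\<forall>x y. star (tens x y) = tens (star x) (star y)) \<and>
     tens 1 1 = 1 \<and>
     (let T = complex_vector.span (range (\<lambda>(x, y). tens x y)) in
        closure T = UNIV \<and>
        (\<forall>p. cstar_seminorm_on T scaleC star p \<and> (\<forall>z\<in>T. p z = 0 \<longrightarrow> z = 0) \<longrightarrow>
             (\<forall>z\<in>T. norm z \<le> p z)))"


section \<open>The quantum group $U_q(2)$\<close>

datatype uq2_gen = Gen_a | Gen_b | Gen_D

definition uq2_relations :: "complex \<Rightarrow> uq2_gen free_star_algebra set" where
  "uq2_relations q =
     (let a = free_gen Gen_a; b = free_gen Gen_b; D = free_gen Gen_D;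
          a' = free_star a; b' = free_star b; D' = free_star D
      in {b * a - free_scale q (a * b),
          a' * b - free_scale q (b * a'),
          b * b' - b' * b,
          a * a' + b * b' - 1,
          a * D - D * a,
          b * D - free_scale (q\<^sup>2 / complex_of_real ((cmod q)\<^sup>2)) (D * b),
          D * D' - 1,
          D' * D - 1,
          a' * a + free_scale (complex_of_real ((cmod q)\<^sup>2)) (b' * b) - 1})"

fun uq2_gens :: "'a \<Rightarrow> 'a \<Rightarrow> 'a \<Rightarrow> uq2_gen \<Rightarrow> 'a" where
  "uq2_gens a b D Gen_a = a"
| "uq2_gens a b D Gen_b = b"
| "uq2_gens a b D Gen_D = D"

definition is_CUq2 :: "complex \<Rightarrow> 'a::unital_cstar_algebra \<Rightarrow> 'a \<Rightarrow> 'a \<Rightarrow> bool" where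
  "is_CUq2 q a b D \<longleftrightarrow> universal_cstar_algebra (uq2_gens a b D) (uq2_relations q)"

(* The *-subalgebra generated by a, b, D consists of the values of *-polynomials. *)
definition OUq2 :: "'a::unital_cstar_algebra \<Rightarrow> 'a \<Rightarrow> 'a \<Rightarrow> 'a set" where
  "OUq2 a b D = range (free_eval (uq2_gens a b D))"

definition uq2_comultiplication ::
    "complex \<Rightarrow> 'a::unital_cstar_algebra \<Rightarrow> 'a \<Rightarrow> 'a \<Rightarrow>
     ('a \<Rightarrow> 'a \<Rightarrow> 't::unital_cstar_algebra) \<Rightarrow> ('a \<Rightarrow> 't) \<Rightarrow> bool" where
  "uq2_comultiplication q a b D tens \<Delta> \<longleftrightarrow>
     star_hom \<Delta> \<and>
     \<Delta> a = tens a a - cnj q *\<^sub>C tens b (D * star b) \<and>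
     \<Delta> b = tens a b + tens b (D * star a) \<and>
     \<Delta> D = tens D D"

(* R and L are the slice maps id (x) h and h (x) id, which are determined by the stated
   properties because the elementary tensors span a dense subspace. *)
definition haar_state ::
    "('a::unital_cstar_algebra \<Rightarrow> 'a \<Rightarrow> 't::unital_cstar_algebra) \<Rightarrow> ('a \<Rightarrow> 't) \<Rightarrow>
     ('a \<Rightarrow> complex) \<Rightarrow> bool" where
  "haar_state tens \<Delta> h \<longleftrightarrow>
     is_state h \<and>
     (\<exists>R. bounded_linear R \<and> (\<forall>x y. R (tens x y) = h y *\<^sub>C x) \<and> (\<forall>x. R (\<Delta> x) = h x *\<^sub>C 1)) \<and>
     (\<exists>L. bounded_linear L \<and> (\<forall>x y. L (tens x y) = h x *\<^sub>C y) \<and> (\<forall>x. L (\<Delta> x) = h x *\<^sub>C 1))"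

definition state_inner ::
    "('a::unital_cstar_algebra \<Rightarrow> complex) \<Rightarrow> 'a \<Rightarrow> 'a \<Rightarrow> complex" where
  "state_inner h x y = h (star x * y)"

(* The Hilbert space 'h, with the canonical map \<Lambda>, is the completion of the subspace A
   for the (possibly degenerate) inner product ip. *)
definition hilbert_completion ::
    "'a::complex_normed_space set \<Rightarrow> ('a \<Rightarrow> 'a \<Rightarrow> complex) \<Rightarrow>
     ('a \<Rightarrow> 'h::complex_hilbert_space) \<Rightarrow> bool" where
  "hilbert_completion A ip \<Lambda> \<longleftrightarrow>
     (\<forall>x\<in>A. \<forall>y\<in>A. \<Lambda> (x + y) = \<Lambda> x + \<Lambda> y) \<and>
     (\<forall>c. \<forall>x\<in>A. \<Lambda> (c *\<^sub>C x) = c *\<^sub>C \<Lambda> x) \<and>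
     (\<forall>x\<in>A. \<forall>y\<in>A. cinner (\<Lambda> x) (\<Lambda> y) = ip x y) \<and>
     closure (\<Lambda> ` A) = UNIV"

definition orthonormal_basis :: "'h::complex_hilbert_space set \<Rightarrow> bool" where
  "orthonormal_basis B \<longleftrightarrow>
     (\<forall>x\<in>B. \<forall>y\<in>B. cinner x y = (if x = y then 1 else 0)) \<and>
     closure (complex_vector.span B) = UNIV"


section \<open>The corepresentations $T_l^R$ and their matrix coefficients\<close>

definition half_nats :: "real set" where
  "half_nats = {real n / 2 | n. True}"

definition I_set :: "real \<Rightarrow> real set" where
  "I_set l = {- l + real k | k. real k \<le> 2 * l}"

(* nat_of is only applied to real numbers that are natural numbers, such as l + j
   for j in I_set l. *)
definition nat_of :: "real \<Rightarrow> nat" where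
  "nat_of x = nat \<lfloor>x\<rfloor>"

definition binom :: "real \<Rightarrow> real \<Rightarrow> real" where
  "binom x y = real (nat_of x choose nat_of y)"

definition uq2_basis :: "'a::unital_cstar_algebra \<Rightarrow> 'a \<Rightarrow> real \<Rightarrow> real \<Rightarrow> 'a" where
  "uq2_basis a b l j =
     complex_of_real (sqrt (binom (2 * l) (l + j))) *\<^sub>C (a ^ nat_of (l - j) * b ^ nat_of (l + j))"

(* The coefficients are extended by 0 to indices outside I_set l, so that the
   description is definite. *)
definition uq2_coeff ::
    "'a::unital_cstar_algebra \<Rightarrow> 'a \<Rightarrow> 'a \<Rightarrow> ('a \<Rightarrow> 'a \<Rightarrow> 't::unital_cstar_algebra) \<Rightarrow>
     ('a \<Rightarrow> 't) \<Rightarrow> real \<Rightarrow> real \<Rightarrow> real \<Rightarrow> 'a" where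
  "uq2_coeff a b D tens \<Delta> l =
     (THE t. (\<forall>i\<in>I_set l. \<forall>j\<in>I_set l. t i j \<in> OUq2 a b D) \<and>
             (\<forall>j\<in>I_set l. \<Delta> (uq2_basis a b l j) = (\<Sum>i\<in>I_set l. tens (uq2_basis a b l i) (t i j))) \<and>
             (\<forall>i j. i \<notin> I_set l \<or> j \<notin> I_set l \<longrightarrow> t i j = 0))"

definition unitary_power :: "'a::unital_cstar_algebra \<Rightarrow> int \<Rightarrow> 'a" where
  "unitary_power u m = (if 0 \<le> m then u ^ nat m else star u ^ nat (- m))"

end

theory Submission
  imports Defs
begin

text \<open>
  Put \<open>n = 2l\<close>, index rows and columns from 0 by adding \<open>l\<close>, and let \<open>u n k j\<close> be the matrix
  coefficients with respect to the unnormalised basis \<open>a^(n-k) b^k\<close>. Both summands of \<open>\<Delta> a\<close> commute, as do those of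
  \<open>\<Delta> b\<close>, so the binomial theorem gives the explicit formula. Multiplying \<open>a^(n-j) b^j\<close> by \<open>a\<close> or
  \<open>b\<close> gives two recursions from \<open>u n\<close> to \<open>u (n+1)\<close>; unitarity of the matrix \<open>(a b; c d)\<close> then
  propagates through Pascal's rule to the weighted unitarity of all \<open>u n\<close>.

  Linear independence needs the universal property. The algebra is represented by weighted
  shifts on finitely supported functions on \<open>Z^3\<close>, with \<open>a\<close> of size \<open>cos \<theta>\<close> and \<open>b\<close> of size
  \<open>sin \<theta>\<close>; the operator norm is a C*-seminorm killing the relations, so the representation descends.
  The coefficient \<open>u n k j D^z\<close> moves the delta function at 0 to a multiple of the one at
  \<open>(n-j-k, j-k, k+z)\<close>, and the factor, a polynomial in \<open>tan \<theta>\<close> with nonzero coefficients times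
  \<open>cos^n \<theta>\<close>, does not vanish identically. Invariance of \<open>h\<close> and Schur's lemma now give the
  orthogonality relations. Finally the span of the \<open>u n k j D^z\<close> is all of \<open>O(U_q(2))\<close> because the
  recursions express \<open>u n k j x\<close>, for \<open>x\<close> among \<open>a, b, c, d\<close>, through \<open>u (n+1)\<close> and \<open>u (n-1) D\<close>.
\<close>

subsection \<open>Linear extensions and free star-algebras\<close>

text \<open>Three obstacles shape the proof. The universal property quantifies over seminorms, so
  bounded operators with explicit adjoints on an incomplete inner product space are enough, and no
  C*-algebra of operators has to be built. A single \<theta> would not do: the polynomial attached
  to a coefficient may vanish there, so all \<theta> are kept and one is chosen per coefficient.
  Moreover the degree in Z^3 does not separate all coefficients: (n, z, k, j) and (n+2, z-1, k+1,
  j+1) share theirs. It does so for fixed (n, z), and Schur's lemma only compares one row with one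
  column, so for different (n, z) an extreme row or column can be picked. The constant 1/(2l+1)
  comes from the diagonal of an intertwiner: its n+1 weighted entries are equal, and their sum is
  known because the entrywise adjoint of (a b; c d) is unitary too; this uses |q| = 1 and leaves no
  modular weights. For spanning, the two recursions only express sums of two products; a third
  relation, where the determinant ad - qcb = D lowers n, is needed to isolate each product.\<close>

definition lin_ext :: "('w \<Rightarrow> 'v::complex_normed_space) \<Rightarrow> ('w \<Rightarrow>\<^sub>0 complex) \<Rightarrow> 'v" where
  "lin_ext \<psi> f = (\<Sum>w\<in>Poly_Mapping.keys f. Poly_Mapping.lookup f w *\<^sub>C \<psi> w)"

lemma lin_ext_superset:
  assumes "finite S" "Poly_Mapping.keys f \<subseteq> S"
  shows "lin_ext \<psi> f = (\<Sum>w\<in>S. Poly_Mapping.lookup f w *\<^sub>C \<psi> w)"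
  unfolding lin_ext_def
  by (rule sum.mono_neutral_left) (use assms in \<open>auto simp: in_keys_iff\<close>)

lemma lin_ext_zero [simp]: "lin_ext \<psi> 0 = 0"
  by (simp add: lin_ext_def)

lemma lin_ext_single [simp]: "lin_ext \<psi> (Poly_Mapping.single w c) = c *\<^sub>C \<psi> w"
  by (simp add: lin_ext_def)

lemma lin_ext_add: "lin_ext \<psi> (f + g) = lin_ext \<psi> f + lin_ext \<psi> g"
proof -
  let ?S = "Poly_Mapping.keys f \<union> Poly_Mapping.keys g"
  show ?thesis
    using Poly_Mapping.keys_add[of f g]
    by (simp add: lin_ext_superset[of ?S] lookup_add scaleC_add_left sum.distrib)
qed

lemma lin_ext_sum: "lin_ext \<psi> (sum f S) = (\<Sum>x\<in>S. lin_ext \<psi> (f x))"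
  by (induction S rule: infinite_finite_induct) (simp_all add: lin_ext_add)

lemma poly_mapping_single_induct [case_names zero single add]:
  fixes f :: "'w \<Rightarrow>\<^sub>0 'c::comm_monoid_add"
  assumes "P 0" "\<And>w c. P (Poly_Mapping.single w c)" "\<And>f g. P f \<Longrightarrow> P g \<Longrightarrow> P (f + g)"
  shows "P f"
proof -
  have eq: "f = (\<Sum>w\<in>Poly_Mapping.keys f. Poly_Mapping.single w (Poly_Mapping.lookup f w))"
    by (rule poly_mapping_eqI)
      (auto simp: lookup_sum lookup_single when_def in_keys_iff sum.delta' if_distrib cong: if_cong)
  have "P (\<Sum>w\<in>S. Poly_Mapping.single w (Poly_Mapping.lookup f w))" for S
    by (induction S rule: infinite_finite_induct) (auto intro: assms)
  then show ?thesis
    using eq by metis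
qed

lemma lin_ext_linear:
  assumes "\<And>x y. T (x + y) = T x + T y" "\<And>c x. T (c *\<^sub>C x) = c *\<^sub>C T x"
  shows "T (lin_ext \<psi> f) = lin_ext (\<lambda>w. T (\<psi> w)) f"
proof (induction f rule: poly_mapping_single_induct)
  case zero
  have "T 0 = 0"
    using assms(2)[of 0 0] by simp
  then show ?case by simp
qed (simp_all add: lin_ext_add assms)

lemma lin_ext_add_fun: "lin_ext (\<lambda>w. \<psi> w + \<phi> w) f = lin_ext \<psi> f + lin_ext \<phi> f"
  by (simp add: lin_ext_def scaleC_add_right sum.distrib)

lemma lin_ext_scaleC_fun: "lin_ext (\<lambda>w. c *\<^sub>C \<psi> w) f = c *\<^sub>C lin_ext \<psi> f"
  by (rule lin_ext_linear[symmetric]) (simp_all add: scaleC_add_right scaleC_scaleC mult.commute)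

lemma lin_ext_mult:
  "lin_ext \<phi> (f * g) = lin_ext (\<lambda>u. lin_ext (\<lambda>v. \<phi> (u + v)) g) f"
proof (induction f rule: poly_mapping_single_induct)
  case (single u c)
  show ?case
    by (induction g rule: poly_mapping_single_induct)
      (simp_all add: mult_single lin_ext_add scaleC_scaleC distrib_left scaleC_add_right)
qed (simp_all add: lin_ext_add distrib_right)

lemma lin_ext_free_scale: "lin_ext \<psi> (free_scale c f) = c *\<^sub>C lin_ext \<psi> f"
  by (simp add: free_scale_def lin_ext_mult)

lemma lin_ext_free_star:
  "lin_ext \<psi> (free_star f) =
    (\<Sum>w\<in>Poly_Mapping.keys f. cnj (Poly_Mapping.lookup f w) *\<^sub>C \<psi> (word_star w))"
  by (simp add: free_star_def lin_ext_sum)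

lemma free_eval_eq_lin_ext: "free_eval x f = lin_ext (word_eval x) f"
  by (simp add: free_eval_def lin_ext_def)

lemma word_eval_plus: "word_eval x (u + v) = word_eval x u * word_eval x v"
  by (cases u; cases v) simp

lemma word_eval_zero: "word_eval x 0 = 1"
  by (simp add: zero_word_def)

lemma star_zero [simp]: "star (0::'a::unital_cstar_algebra) = 0"
  using star_scaleC[of 0 0] by simp

lemma star_one [simp]: "star (1::'a::unital_cstar_algebra) = 1"
  by (metis mult_1 mult.right_neutral star_mult star_star)

lemma star_minus: "star (- x::'a::unital_cstar_algebra) = - star x"
  by (metis add_eq_0_iff star_add star_zero)

lemma star_sum: "star (sum f S) = (\<Sum>x\<in>S. star (f x::'a::unital_cstar_algebra))"
  by (induction S rule: infinite_finite_induct) (simp_all add: star_add)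

lemma star_power: "star (x ^ n) = star (x::'a::unital_cstar_algebra) ^ n"
  by (induction n) (simp_all add: star_mult power_commutes)

lemma word_eval_star: "word_eval x (word_star w) = star (word_eval x w)"
proof (cases w)
  case (Word u)
  have "word_eval x (word_star (Word u)) = star (word_eval x (Word u))"
    by (induction u) (auto simp: star_mult star_star)
  then show ?thesis using Word by simp
qed

lemma free_eval_mult: "free_eval x (f * g) = free_eval x f * free_eval x g"
proof -
  have "lin_ext (\<lambda>v. word_eval x (u + v)) g = word_eval x u * lin_ext (word_eval x) g" for u
    unfolding word_eval_plus
    by (rule lin_ext_linear[symmetric]) (simp_all add: distrib_left mult_scaleC_right)
  moreover have "lin_ext (\<lambda>u. word_eval x u * z) f = lin_ext (word_eval x) f * z" for z
    by (rule lin_ext_linear[symmetric]) (simp_all add: distrib_right mult_scaleC_left)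
  ultimately show ?thesis
    by (simp add: free_eval_eq_lin_ext lin_ext_mult)
qed

lemma free_eval_star: "free_eval x (free_star f) = star (free_eval x f)"
  by (simp add: free_eval_eq_lin_ext lin_ext_free_star word_eval_star)
    (simp add: lin_ext_def star_sum star_scaleC)

lemma free_eval_gen: "free_eval x (free_gen g) = x g"
  by (simp add: free_eval_eq_lin_ext free_gen_def complex_vector.scale_one)

lemma free_eval_one: "free_eval x 1 = 1"
  by (simp add: free_eval_eq_lin_ext word_eval_zero flip: single_one)

lemma free_star_gen: "free_star (free_gen g) = Poly_Mapping.single (Word [(g, True)]) 1"
  by (simp add: free_star_def free_gen_def)

lemma free_eval_gen_star: "free_eval x (free_star (free_gen g)) = star (x g)"
  by (simp add: free_eval_star free_eval_gen)

lemma free_eval_add: "free_eval x (f + g) = free_eval x f + free_eval x g"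
  by (simp add: free_eval_eq_lin_ext lin_ext_add)

lemma free_eval_diff: "free_eval x (f - g) = free_eval x f - free_eval x g"
  by (metis add_diff_cancel_right' diff_add_cancel free_eval_add)

lemma free_eval_scale: "free_eval x (free_scale c f) = c *\<^sub>C free_eval x f"
  by (simp add: free_eval_eq_lin_ext lin_ext_free_scale)

subsection \<open>Finitely supported functions as a pre-Hilbert space\<close>

instantiation poly_mapping :: (type, real_vector) real_vector
begin

lift_definition scaleR_poly_mapping :: "real \<Rightarrow> ('a \<Rightarrow>\<^sub>0 'b) \<Rightarrow> 'a \<Rightarrow>\<^sub>0 'b"
  is "\<lambda>r f k. r *\<^sub>R f k"
  by (auto elim!: rev_finite_subset)

instance
  by standard (transfer; simp add: fun_eq_iff algebra_simps)+

end

text \<open>For complex values this is the real part of the l2 inner product. The real structure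
  suffices for operator norms and adjoints; compatibility with complex scalars is added by
  \<open>inner_scaleC_left\<close>.\<close>

instantiation poly_mapping :: (type, real_inner) real_inner
begin

definition inner_poly_mapping :: "('a \<Rightarrow>\<^sub>0 'b) \<Rightarrow> ('a \<Rightarrow>\<^sub>0 'b) \<Rightarrow> real" where
  "inner_poly_mapping f g =
    (\<Sum>k\<in>Poly_Mapping.keys f \<union> Poly_Mapping.keys g. Poly_Mapping.lookup f k \<bullet> Poly_Mapping.lookup g k)"

definition norm_poly_mapping :: "('a \<Rightarrow>\<^sub>0 'b) \<Rightarrow> real" where
  "norm_poly_mapping f = sqrt (f \<bullet> f)"

definition sgn_poly_mapping :: "('a \<Rightarrow>\<^sub>0 'b) \<Rightarrow> ('a \<Rightarrow>\<^sub>0 'b)" where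
  "sgn_poly_mapping f = f /\<^sub>R norm f"

definition dist_poly_mapping :: "('a \<Rightarrow>\<^sub>0 'b) \<Rightarrow> ('a \<Rightarrow>\<^sub>0 'b) \<Rightarrow> real" where
  "dist_poly_mapping f g = norm (f - g)"

definition uniformity_poly_mapping :: "(('a \<Rightarrow>\<^sub>0 'b) \<times> ('a \<Rightarrow>\<^sub>0 'b)) filter" where
  "uniformity_poly_mapping = (INF e\<in>{0<..}. principal {(x, y). dist x y < e})"

definition open_poly_mapping :: "('a \<Rightarrow>\<^sub>0 'b) set \<Rightarrow> bool" where
  "open_poly_mapping U = (\<forall>x\<in>U. eventually (\<lambda>(x', y). x' = x \<longrightarrow> y \<in> U) uniformity)"

lemma inner_poly_mapping_superset:
  assumes "finite S" "Poly_Mapping.keys f \<inter> Poly_Mapping.keys g \<subseteq> S"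
  shows "f \<bullet> g = (\<Sum>k\<in>S. Poly_Mapping.lookup f k \<bullet> Poly_Mapping.lookup g k)"
proof -
  have "f \<bullet> g = (\<Sum>k\<in>Poly_Mapping.keys f \<inter> Poly_Mapping.keys g.
                    Poly_Mapping.lookup f k \<bullet> Poly_Mapping.lookup g k)"
    unfolding inner_poly_mapping_def
    by (rule sum.mono_neutral_right) (auto simp: in_keys_iff)
  also have "\<dots> = (\<Sum>k\<in>S. Poly_Mapping.lookup f k \<bullet> Poly_Mapping.lookup g k)"
    by (rule sum.mono_neutral_left) (use assms in \<open>auto simp: in_keys_iff\<close>)
  finally show ?thesis .
qed

instance
proof
  fix x y z :: "'a \<Rightarrow>\<^sub>0 'b" and r :: real
  show "x \<bullet> y = y \<bullet> x"
    by (simp add: inner_poly_mapping_def inner_commute Un_commute)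
  show "(x + y) \<bullet> z = x \<bullet> z + y \<bullet> z"
    by (simp add: inner_poly_mapping_superset[of "Poly_Mapping.keys z"] lookup_add
        inner_add_left sum.distrib)
  show "(r *\<^sub>R x) \<bullet> y = r * (x \<bullet> y)"
    by (simp add: inner_poly_mapping_superset[of "Poly_Mapping.keys y"] scaleR_poly_mapping.rep_eq
        sum_distrib_left)
  show "0 \<le> x \<bullet> x"
    by (simp add: inner_poly_mapping_def sum_nonneg)
  show "x \<bullet> x = 0 \<longleftrightarrow> x = 0"
    by (auto simp: inner_poly_mapping_def sum_nonneg_eq_0_iff in_keys_iff
        intro!: poly_mapping_eqI)
qed (auto simp: norm_poly_mapping_def sgn_poly_mapping_def dist_poly_mapping_def
    uniformity_poly_mapping_def open_poly_mapping_def)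

end

instantiation complex :: complex_normed_space
begin

definition scaleC_complex :: "complex \<Rightarrow> complex \<Rightarrow> complex" where
  "scaleC_complex = (*)"

instance
  by standard (simp_all add: scaleC_complex_def algebra_simps norm_mult scaleR_conv_of_real)

end

instantiation poly_mapping :: (type, "{real_inner, complex_normed_space}") complex_normed_space
begin

lift_definition scaleC_poly_mapping :: "complex \<Rightarrow> ('a \<Rightarrow>\<^sub>0 'b) \<Rightarrow> 'a \<Rightarrow>\<^sub>0 'b"
  is "\<lambda>c f k. c *\<^sub>C f k"
  by (auto elim!: rev_finite_subset)

instance
proof
  fix c d :: complex and x y :: "'a \<Rightarrow>\<^sub>0 'b" and r :: real
  show "c *\<^sub>C (x + y) = c *\<^sub>C x + c *\<^sub>C y"
    by transfer (simp add: fun_eq_iff scaleC_add_right)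
  show "(c + d) *\<^sub>C x = c *\<^sub>C x + d *\<^sub>C x"
    by transfer (simp add: fun_eq_iff scaleC_add_left)
  show "c *\<^sub>C d *\<^sub>C x = (c * d) *\<^sub>C x"
    by transfer (simp add: fun_eq_iff scaleC_scaleC)
  show "complex_of_real r *\<^sub>C x = r *\<^sub>R x"
    by transfer (simp add: fun_eq_iff scaleC_of_real)
  have "(c *\<^sub>C x) \<bullet> (c *\<^sub>C x) =
      (\<Sum>k\<in>Poly_Mapping.keys x. (c *\<^sub>C Poly_Mapping.lookup x k) \<bullet> (c *\<^sub>C Poly_Mapping.lookup x k))"
    by (subst inner_poly_mapping_superset[of "Poly_Mapping.keys x"])
      (auto simp: scaleC_poly_mapping.rep_eq in_keys_iff)
  also have "\<dots> = (cmod c)\<^sup>2 * (\<Sum>k\<in>Poly_Mapping.keys x. Poly_Mapping.lookup x k \<bullet> Poly_Mapping.lookup x k)"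
    by (simp add: sum_distrib_left dot_square_norm norm_scaleC power_mult_distrib)
  also have "\<dots> = (cmod c)\<^sup>2 * (x \<bullet> x)"
    by (subst inner_poly_mapping_superset[of "Poly_Mapping.keys x" x x]) auto
  finally have "(c *\<^sub>C x) \<bullet> (c *\<^sub>C x) = (cmod c)\<^sup>2 * (x \<bullet> x)" .
  then show "norm (c *\<^sub>C x) = cmod c * norm x"
    by (simp add: norm_poly_mapping_def real_sqrt_mult)
qed

end

lemma lookup_scaleC: "Poly_Mapping.lookup (c *\<^sub>C x) k = c *\<^sub>C Poly_Mapping.lookup x k"
  by (simp add: scaleC_poly_mapping.rep_eq)

text \<open>The weight is read at the arrival point \<open>e\<close>, not at the starting point
  \<open>e - d\<close>; hence the argument \<open>e + d\<close> in the weight of the adjoint in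
  \<open>inner_shift_left\<close>.\<close>

lift_definition shift ::
    "'i::group_add \<Rightarrow> ('i \<Rightarrow> complex) \<Rightarrow> ('i \<Rightarrow>\<^sub>0 complex) \<Rightarrow> 'i \<Rightarrow>\<^sub>0 complex"
  is "\<lambda>d \<kappa> \<xi> e. \<kappa> e * \<xi> (e - d)"
proof -
  fix d :: 'i and \<kappa> \<xi> :: "'i \<Rightarrow> complex"
  assume "finite {e. \<xi> e \<noteq> 0}"
  moreover have "{e. \<kappa> e * \<xi> (e - d) \<noteq> 0} \<subseteq> (\<lambda>e. e + d) ` {e. \<xi> e \<noteq> 0}"
    by (auto simp: image_iff intro!: exI[of _ "_ - d"])
  ultimately show "finite {e. \<kappa> e * \<xi> (e - d) \<noteq> 0}"
    using finite_surj by blast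
qed

lemma shift_single: "shift d \<kappa> (Poly_Mapping.single e c) = Poly_Mapping.single (e + d) (\<kappa> (e + d) * c)"
  by (rule poly_mapping_eqI) (auto simp: shift.rep_eq lookup_single when_def)

lemma shift_add: "shift d \<kappa> (x + y) = shift d \<kappa> x + shift d \<kappa> y"
  by transfer (simp add: fun_eq_iff algebra_simps)

lemma shift_scaleC: "shift d \<kappa> (c *\<^sub>C x) = c *\<^sub>C shift d \<kappa> x"
  by transfer (simp add: fun_eq_iff scaleC_complex_def)

lemma inner_scaleC_left:
  "(c *\<^sub>C x) \<bullet> y = x \<bullet> (cnj c *\<^sub>C (y :: 'i \<Rightarrow>\<^sub>0 complex))"
proof -
  have "Poly_Mapping.keys (c *\<^sub>C x) \<subseteq> Poly_Mapping.keys x" for c and x :: "'i \<Rightarrow>\<^sub>0 complex"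
    by (auto simp: in_keys_iff lookup_scaleC scaleC_complex_def)
  then show ?thesis
    by (subst (1 2) inner_poly_mapping_superset[of "Poly_Mapping.keys x \<union> Poly_Mapping.keys y"])
      (auto simp: lookup_scaleC scaleC_complex_def inner_complex_def algebra_simps intro!: sum.cong)
qed

lemma inner_shift_left:
  "shift d \<kappa> x \<bullet> y = x \<bullet> shift (- d) (\<lambda>e. cnj (\<kappa> (e + d))) y"
proof -
  have inj: "inj_on (\<lambda>e. e + d) S" for S
    by (simp add: inj_on_def)
  have "shift d \<kappa> x \<bullet> y = (\<Sum>e\<in>(\<lambda>e. e + d) ` Poly_Mapping.keys x.
      Poly_Mapping.lookup (shift d \<kappa> x) e \<bullet> Poly_Mapping.lookup y e)"
    by (rule inner_poly_mapping_superset)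
      (auto simp: in_keys_iff shift.rep_eq image_iff intro!: bexI[of _ "_ - d"])
  also have "\<dots> = (\<Sum>e\<in>Poly_Mapping.keys x. Poly_Mapping.lookup x e \<bullet>
      Poly_Mapping.lookup (shift (- d) (\<lambda>e. cnj (\<kappa> (e + d))) y) e)"
    by (subst sum.reindex[OF inj])
      (simp add: shift.rep_eq inner_complex_def algebra_simps)
  also have "\<dots> = x \<bullet> shift (- d) (\<lambda>e. cnj (\<kappa> (e + d))) y"
    by (rule inner_poly_mapping_superset[symmetric]) auto
  finally show ?thesis .
qed

lemma norm_shift_le:
  assumes "\<And>e. cmod (\<kappa> e) \<le> 1"
  shows "norm (shift d \<kappa> x) \<le> norm x"
proof -
  have inj: "inj_on (\<lambda>e. e + d) S" for S
    by (simp add: inj_on_def)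
  have "shift d \<kappa> x \<bullet> shift d \<kappa> x = (\<Sum>e\<in>(\<lambda>e. e + d) ` Poly_Mapping.keys x.
      Poly_Mapping.lookup (shift d \<kappa> x) e \<bullet> Poly_Mapping.lookup (shift d \<kappa> x) e)"
    by (rule inner_poly_mapping_superset)
      (auto simp: in_keys_iff shift.rep_eq image_iff intro!: bexI[of _ "_ - d"])
  also have "\<dots> = (\<Sum>e\<in>Poly_Mapping.keys x. (cmod (\<kappa> (e + d)))\<^sup>2 * (cmod (Poly_Mapping.lookup x e))\<^sup>2)"
    by (subst sum.reindex[OF inj])
      (simp add: shift.rep_eq dot_square_norm norm_mult power_mult_distrib)
  also have "\<dots> \<le> (\<Sum>e\<in>Poly_Mapping.keys x. 1 * (cmod (Poly_Mapping.lookup x e))\<^sup>2)"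
    by (intro sum_mono mult_right_mono) (auto simp: assms power_le_one)
  also have "\<dots> = x \<bullet> x"
    by (subst inner_poly_mapping_superset[of "Poly_Mapping.keys x" x x]) (auto simp: dot_square_norm)
  finally show ?thesis
    by (simp add: norm_eq_sqrt_inner)
qed


subsection \<open>Seminorms from star-representations on pre-Hilbert spaces\<close>

lemma norm_power2_le_onorm_adjoint_comp:
  fixes T :: "'v::real_inner \<Rightarrow> 'v"
  assumes "bounded_linear T" "bounded_linear T'" "\<And>x y. T x \<bullet> y = x \<bullet> T' y"
  shows "(norm (T x))\<^sup>2 \<le> onorm (\<lambda>x. T' (T x)) * (norm x)\<^sup>2"
proof -
  have "bounded_linear (\<lambda>x. T' (T x))"
    by (rule bounded_linear_compose) fact+
  then have "norm (T' (T x)) \<le> onorm (\<lambda>x. T' (T x)) * norm x"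
    by (rule onorm)
  then have "norm (T' (T x)) * norm x \<le> onorm (\<lambda>x. T' (T x)) * norm x * norm x"
    by (rule mult_right_mono) simp
  moreover have "(norm (T x))\<^sup>2 \<le> norm (T' (T x)) * norm x"
    using Cauchy_Schwarz_ineq2[of x "T' (T x)"] assms(3)[of x "T x"]
    by (simp add: power2_norm_eq_inner mult.commute)
  ultimately show ?thesis
    by (simp add: power2_eq_square mult.assoc)
qed

text \<open>The square of \<open>norm (T' x)\<close> equals \<open>T (T' x) \<bullet> x\<close>, and
  one factor \<open>norm (T' x)\<close> cancels. The adjoint is given as data, so completeness never
  enters.\<close>

lemma onorm_adjoint_le:
  fixes T :: "'v::real_inner \<Rightarrow> 'v"
  assumes "bounded_linear T" "bounded_linear T'" "\<And>x y. T x \<bullet> y = x \<bullet> T' y"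
  shows "onorm T' \<le> onorm T"
proof (rule onorm_bound)
  show "0 \<le> onorm T"
    by (rule onorm_pos_le) fact
  fix x
  have "(norm (T' x))\<^sup>2 = T (T' x) \<bullet> x"
    by (simp add: assms(3) power2_norm_eq_inner)
  also have "\<dots> \<le> norm (T (T' x)) * norm x"
    by (rule norm_cauchy_schwarz)
  also have "\<dots> \<le> onorm T * norm (T' x) * norm x"
    by (intro mult_right_mono onorm assms) simp
  finally have *: "norm (T' x) * norm (T' x) \<le> norm (T' x) * (onorm T * norm x)"
    by (simp add: power2_eq_square algebra_simps)
  show "norm (T' x) \<le> onorm T * norm x"
  proof (cases "norm (T' x) = 0")
    case True
    then show ?thesis using \<open>0 \<le> onorm T\<close> by simp
  next
    case False
    then show ?thesis using * by (simp add: mult_le_cancel_left)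
  qed
qed

text \<open>This is the C*-identity of the operator norm, the one seminorm axiom that is not
  formal.\<close>

lemma onorm_adjoint_comp:
  fixes T :: "'v::real_inner \<Rightarrow> 'v"
  assumes "bounded_linear T" "bounded_linear T'" "\<And>x y. T x \<bullet> y = x \<bullet> T' y"
  shows "onorm (\<lambda>x. T' (T x)) = (onorm T)\<^sup>2"
proof (rule antisym)
  have "onorm (\<lambda>x. T' (T x)) \<le> onorm T' * onorm T"
    using onorm_compose[OF assms(2,1)] by (simp add: o_def)
  also have "\<dots> \<le> onorm T * onorm T"
    by (intro mult_right_mono onorm_adjoint_le onorm_pos_le assms)
  finally show "onorm (\<lambda>x. T' (T x)) \<le> (onorm T)\<^sup>2"
    by (simp add: power2_eq_square)
  have pos: "0 \<le> onorm (\<lambda>x. T' (T x))"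
    by (intro onorm_pos_le bounded_linear_compose[OF assms(2,1)])
  have "onorm T \<le> sqrt (onorm (\<lambda>x. T' (T x)))"
  proof (rule onorm_bound)
    fix x
    have "norm (T x) \<le> sqrt (onorm (\<lambda>x. T' (T x)) * (norm x)\<^sup>2)"
      by (rule real_le_rsqrt) (rule norm_power2_le_onorm_adjoint_comp[OF assms])
    then show "norm (T x) \<le> sqrt (onorm (\<lambda>x. T' (T x))) * norm x"
      by (simp add: real_sqrt_mult)
  qed (simp add: pos)
  then have "(onorm T)\<^sup>2 \<le> (sqrt (onorm (\<lambda>x. T' (T x))))\<^sup>2"
    by (intro power_mono onorm_pos_le assms)
  then show "(onorm T)\<^sup>2 \<le> onorm (\<lambda>x. T' (T x))"
    using pos by simp
qed

text \<open>The Boolean marks a starred letter, as in \<open>word\<close>. Contractivity of the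
  letters bounds every word by 1 and hence every polynomial by the sum of the moduli of its
  coefficients.\<close>

locale star_rep =
  fixes T :: "'g \<Rightarrow> bool \<Rightarrow> 'v::{real_inner, complex_normed_space} \<Rightarrow> 'v"
  assumes T_add: "T g s (x + y) = T g s x + T g s y"
    and T_scaleC: "T g s (c *\<^sub>C x) = c *\<^sub>C T g s x"
    and T_bound: "norm (T g s x) \<le> norm x"
    and T_adjoint: "T g s x \<bullet> y = x \<bullet> T g (\<not> s) y"
    and scaleC_adjoint: "(c *\<^sub>C x) \<bullet> (y::'v) = x \<bullet> (cnj c *\<^sub>C y)"
begin

fun word_op :: "'g word \<Rightarrow> 'v \<Rightarrow> 'v" where
  "word_op (Word u) = foldr (\<lambda>(g, s). T g s) u"

lemma word_op_plus: "word_op (u + v) \<xi> = word_op u (word_op v \<xi>)"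
  by (cases u; cases v) simp

lemma word_op_zero: "word_op 0 \<xi> = \<xi>"
  by (simp add: zero_word_def)

lemma word_op_add: "word_op w (x + y) = word_op w x + word_op w y"
proof (cases w)
  case (Word u)
  have "word_op (Word u) (x + y) = word_op (Word u) x + word_op (Word u) y"
    by (induction u) (auto simp: T_add)
  then show ?thesis using Word by simp
qed

lemma word_op_scaleC: "word_op w (c *\<^sub>C x) = c *\<^sub>C word_op w x"
proof (cases w)
  case (Word u)
  have "word_op (Word u) (c *\<^sub>C x) = c *\<^sub>C word_op (Word u) x"
    by (induction u) (auto simp: T_scaleC)
  then show ?thesis using Word by simp
qed

lemma word_op_bound: "norm (word_op w x) \<le> norm x"
proof (cases w)
  case (Word u)
  have "norm (word_op (Word u) x) \<le> norm x"
    by (induction u) (auto intro: order_trans[OF T_bound])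
  then show ?thesis using Word by simp
qed

lemma word_op_adjoint: "word_op w x \<bullet> y = x \<bullet> word_op (word_star w) y"
proof (cases w)
  case (Word u)
  have "word_op (Word u) x \<bullet> y = x \<bullet> word_op (word_star (Word u)) y"
    by (induction u arbitrary: y) (auto simp: T_adjoint)
  then show ?thesis using Word by simp
qed

definition rep :: "'g free_star_algebra \<Rightarrow> 'v \<Rightarrow> 'v" where
  "rep f \<xi> = lin_ext (\<lambda>w. word_op w \<xi>) f"

lemma rep_vec_add: "rep f (x + y) = rep f x + rep f y"
  by (simp add: rep_def word_op_add lin_ext_add_fun)

lemma rep_vec_scaleC: "rep f (c *\<^sub>C x) = c *\<^sub>C rep f x"
  by (simp add: rep_def word_op_scaleC lin_ext_scaleC_fun)

lemma rep_add: "rep (f + g) \<xi> = rep f \<xi> + rep g \<xi>"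
  by (simp add: rep_def lin_ext_add)

lemma rep_diff: "rep (f - g) \<xi> = rep f \<xi> - rep g \<xi>"
  by (metis add_diff_cancel_right' diff_add_cancel rep_add)

lemma rep_scale: "rep (free_scale c f) \<xi> = c *\<^sub>C rep f \<xi>"
  by (simp add: rep_def lin_ext_free_scale)

lemma rep_mult: "rep (f * g) \<xi> = rep f (rep g \<xi>)"
  unfolding rep_def lin_ext_mult word_op_plus
  by (simp add: lin_ext_linear[of "word_op _"] word_op_add word_op_scaleC)

lemma rep_one: "rep 1 \<xi> = \<xi>"
  by (simp add: rep_def word_op_zero complex_vector.scale_one flip: single_one)

lemma rep_gen: "rep (free_gen g) \<xi> = T g False \<xi>"
  by (simp add: rep_def free_gen_def complex_vector.scale_one)

lemma rep_gen_star: "rep (free_star (free_gen g)) \<xi> = T g True \<xi>"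
  by (simp add: rep_def free_star_gen complex_vector.scale_one)

lemma rep_adjoint: "rep f x \<bullet> y = x \<bullet> rep (free_star f) y"
  by (simp add: rep_def lin_ext_free_star)
    (simp add: lin_ext_def inner_sum_left inner_sum_right scaleC_adjoint word_op_adjoint flip: word_op_scaleC)

lemma bounded_linear_rep: "bounded_linear (rep f)"
proof (rule bounded_linear_intro)
  show "rep f (r *\<^sub>R x) = r *\<^sub>R rep f x" for r x
    by (simp add: rep_vec_scaleC flip: scaleC_of_real)
  fix x
  have "norm (rep f x) \<le> (\<Sum>w\<in>Poly_Mapping.keys f. norm (Poly_Mapping.lookup f w *\<^sub>C word_op w x))"
    unfolding rep_def lin_ext_def by (rule norm_sum)
  also have "\<dots> \<le> (\<Sum>w\<in>Poly_Mapping.keys f. cmod (Poly_Mapping.lookup f w) * norm x)"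
    by (intro sum_mono) (simp add: norm_scaleC mult_left_mono word_op_bound)
  finally show "norm (rep f x) \<le> norm x * (\<Sum>w\<in>Poly_Mapping.keys f. cmod (Poly_Mapping.lookup f w))"
    by (simp add: sum_distrib_left mult.commute)
qed (rule rep_vec_add)

lemma cstar_seminorm_onorm_rep:
  "cstar_seminorm_on UNIV free_scale free_star (\<lambda>f. onorm (rep f))"
  unfolding cstar_seminorm_on_def
proof (intro conjI ballI allI)
  fix f g :: "'g free_star_algebra" and c :: complex
  show "0 \<le> onorm (rep f)"
    by (intro onorm_pos_le bounded_linear_rep)
  show "onorm (rep (f + g)) \<le> onorm (rep f) + onorm (rep g)"
    using onorm_triangle[OF bounded_linear_rep[of f] bounded_linear_rep[of g]]
    by (simp add: rep_add[abs_def])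
  have "onorm (rep (free_scale c f)) = onorm (\<lambda>x. cmod c *\<^sub>R rep f x)"
    by (simp add: onorm_def rep_scale norm_scaleC)
  then show "onorm (rep (free_scale c f)) = cmod c * onorm (rep f)"
    by (simp add: onorm_scaleR bounded_linear_rep)
  show "onorm (rep (f * g)) \<le> onorm (rep f) * onorm (rep g)"
    using onorm_compose[OF bounded_linear_rep[of f] bounded_linear_rep[of g]]
    by (simp add: rep_mult[abs_def] o_def)
  show "onorm (rep (free_star f * f)) = (onorm (rep f))\<^sup>2"
    using onorm_adjoint_comp[OF bounded_linear_rep[of f] bounded_linear_rep[of "free_star f"]]
    by (simp add: rep_mult[abs_def] rep_adjoint)
qed

text \<open>The operator seminorm kills the relations, so it is dominated by the norm of the
  universal algebra. This is what makes a representation of the free algebra descend.\<close>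

lemma universal_cstar_algebra_rep_eq_0:
  assumes "universal_cstar_algebra x R"
    and "\<And>r \<xi>. r \<in> R \<Longrightarrow> rep r \<xi> = 0"
    and "free_eval x f = 0"
  shows "rep f \<xi> = 0"
proof -
  have "onorm (rep r) = 0" if "r \<in> R" for r
    using assms(2)[OF that] by (simp add: onorm_eq_0 bounded_linear_rep)
  then have "onorm (rep f) \<le> norm (free_eval x f)"
    using assms(1) cstar_seminorm_onorm_rep unfolding universal_cstar_algebra_def by blast
  then have "onorm (rep f) = 0"
    using assms(3) onorm_pos_le[OF bounded_linear_rep[of f]] by simp
  then show ?thesis
    by (simp add: onorm_eq_0 bounded_linear_rep)
qed

end

subsection \<open>Relations in $U_q(2)$\<close>

lemma cnj_eq_inverse_of_norm_1:
  assumes "cmod z = 1"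
  shows "cnj z = inverse z"
proof -
  have "z * cnj z = 1"
    using assms complex_norm_square[of z] by simp
  then show ?thesis
    by (metis inverse_unique)
qed

locale uq2_rels =
  fixes q :: complex and a b D :: "'a::unital_cstar_algebra"
  assumes norm_q: "cmod q = 1"
    and rel_eq_0: "r \<in> uq2_relations q \<Longrightarrow> free_eval (uq2_gens a b D) r = 0"
begin

definition c where "c = - (cnj q *\<^sub>C (D * star b))"
definition d where "d = D * star a"

lemma q_nonzero [simp]: "q \<noteq> 0"
  using norm_q by auto

lemma cnj_q: "cnj q = inverse q"
  using norm_q by (rule cnj_eq_inverse_of_norm_1)

lemma D_unitary: "D * star D = 1" "star D * D = 1"
  using rel_eq_0[of "free_gen Gen_D * free_star (free_gen Gen_D) - 1"]
    rel_eq_0[of "free_star (free_gen Gen_D) * free_gen Gen_D - 1"]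
  by (simp_all add: uq2_relations_def Let_def free_eval_diff free_eval_mult free_eval_star
      free_eval_gen free_eval_one)

lemma gen_rels:
  "b * a = q *\<^sub>C (a * b)" "star a * b = q *\<^sub>C (b * star a)" "b * star b = star b * b"
  "a * star a + b * star b = 1" "a * D = D * a" "b * D = q\<^sup>2 *\<^sub>C (D * b)"
  "star a * a + star b * b = 1"
proof -
  let ?a = "free_gen Gen_a" and ?b = "free_gen Gen_b" and ?D = "free_gen Gen_D"
  note simps = uq2_relations_def Let_def free_eval_diff free_eval_add free_eval_mult free_eval_star
      free_eval_gen free_eval_one free_eval_scale norm_q complex_vector.scale_one
  show "b * a = q *\<^sub>C (a * b)"
    using rel_eq_0[of "?b * ?a - free_scale q (?a * ?b)"] by (simp add: simps)
  show "star a * b = q *\<^sub>C (b * star a)"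
    using rel_eq_0[of "free_star ?a * ?b - free_scale q (?b * free_star ?a)"] by (simp add: simps)
  show "b * star b = star b * b"
    using rel_eq_0[of "?b * free_star ?b - free_star ?b * ?b"] by (simp add: simps)
  show "a * star a + b * star b = 1"
    using rel_eq_0[of "?a * free_star ?a + ?b * free_star ?b - 1"] by (simp add: simps)
  show "a * D = D * a"
    using rel_eq_0[of "?a * ?D - ?D * ?a"] by (simp add: simps)
  show "b * D = q\<^sup>2 *\<^sub>C (D * b)"
    using rel_eq_0[of "?b * ?D - free_scale (q\<^sup>2 / complex_of_real ((cmod q)\<^sup>2)) (?D * ?b)"]
    by (simp add: simps)
  show "star a * a + star b * b = 1"
    using rel_eq_0[of "free_star ?a * ?a + free_scale (complex_of_real ((cmod q)\<^sup>2)) (free_star ?b * ?b) - 1"]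
    by (simp add: simps)
qed

lemma unitary_commute:
  assumes "x * D = s *\<^sub>C (D * x)"
  shows "star D * x = s *\<^sub>C (x * star D)" and "star x * D = cnj s *\<^sub>C (D * star x)"
proof -
  have "star D * (x * D) * star D = star D * (s *\<^sub>C (D * x)) * star D"
    using assms by simp
  moreover have "star D * (x * D) * star D = star D * x"
    by (simp add: mult.assoc D_unitary)
  moreover have "star D * (s *\<^sub>C (D * x)) * star D = s *\<^sub>C (x * star D)"
    by (simp add: mult_scaleC_left mult_scaleC_right D_unitary flip: mult.assoc)
  ultimately show *: "star D * x = s *\<^sub>C (x * star D)"
    by simp
  have "star (star D * x) = star (s *\<^sub>C (x * star D))"
    using * by simp
  then show "star x * D = cnj s *\<^sub>C (D * star x)"
    by (simp add: star_mult star_star star_scaleC)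
qed

text \<open>Oriented as rewrite rules: letters are sorted in the order \<open>a\<close>,
  \<open>star a\<close>, \<open>b\<close>, \<open>star b\<close>, \<open>D\<close>,
  \<open>star D\<close>, and the products of \<open>b\<close> with \<open>star b\<close> are
  eliminated through \<open>a * star a\<close>. Identities between words in the generators then
  follow by normalisation.\<close>

lemma reorder:
  "b * a = q *\<^sub>C (a * b)"
  "star b * a = inverse q *\<^sub>C (a * star b)"
  "b * star a = inverse q *\<^sub>C (star a * b)"
  "star b * star a = q *\<^sub>C (star a * star b)"
  "D * a = a * D" "D * star a = star a * D"
  "D * b = inverse (q\<^sup>2) *\<^sub>C (b * D)" "D * star b = q\<^sup>2 *\<^sub>C (star b * D)"
  "star D * a = a * star D" "star D * star a = star a * star D"
  "star D * b = q\<^sup>2 *\<^sub>C (b * star D)" "star D * star b = inverse (q\<^sup>2) *\<^sub>C (star b * star D)"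
  "D * star D = 1" "star D * D = 1"
  "star a * a = a * star a" "star b * b = 1 - a * star a" "b * star b = 1 - a * star a"
proof -
  have aD: "a * D = 1 *\<^sub>C (D * a)" and bD: "b * D = q\<^sup>2 *\<^sub>C (D * b)"
    by (simp_all add: gen_rels complex_vector.scale_one)
  have saD: "star a * D = 1 *\<^sub>C (D * star a)" and sbD: "star b * D = inverse (q\<^sup>2) *\<^sub>C (D * star b)"
    using unitary_commute(2)[OF aD] unitary_commute(2)[OF bD] by (simp_all add: cnj_q power_inverse)
  show "b * a = q *\<^sub>C (a * b)" by (rule gen_rels)
  have *: "star b * a = inverse q *\<^sub>C (a * star b)"
    using arg_cong[OF gen_rels(2), of star] by (simp add: star_mult star_star star_scaleC cnj_q)
  show "star b * a = inverse q *\<^sub>C (a * star b)" by (rule *)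
  show "b * star a = inverse q *\<^sub>C (star a * b)"
    by (simp add: gen_rels scaleC_scaleC complex_vector.scale_one)
  have "star a * star b = inverse q *\<^sub>C (star b * star a)"
    using arg_cong[OF gen_rels(1), of star] by (simp add: star_mult star_star star_scaleC cnj_q)
  then show "star b * star a = q *\<^sub>C (star a * star b)"
    by (simp add: scaleC_scaleC complex_vector.scale_one)
  show "D * a = a * D" "D * star a = star a * D" "D * b = inverse (q\<^sup>2) *\<^sub>C (b * D)"
    "D * star b = q\<^sup>2 *\<^sub>C (star b * D)"
    using aD bD saD sbD by (simp_all add: scaleC_scaleC complex_vector.scale_one)
  show "star D * a = a * star D" "star D * star a = star a * star D"
    "star D * b = q\<^sup>2 *\<^sub>C (b * star D)" "star D * star b = inverse (q\<^sup>2) *\<^sub>C (star b * star D)"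
    using unitary_commute(1)[OF aD] unitary_commute(1)[OF bD] unitary_commute(1)[OF saD]
      unitary_commute(1)[OF sbD] by (simp_all add: complex_vector.scale_one)
  show "star b * b = 1 - a * star a" "b * star b = 1 - a * star a"
    using gen_rels(3,4) by (metis add_diff_cancel_left')+
  then show "star a * a = a * star a"
    using gen_rels(7) by (simp add: eq_diff_eq[symmetric])
qed (rule D_unitary)+

text \<open>Supplies the variants of the rules that fire inside a product bracketed to the
  right.\<close>

lemma reorder_assoc:
  assumes "x * y = s *\<^sub>C (z :: 'a)"
  shows "x * (y * w) = s *\<^sub>C (z * w)"
  using assms by (metis mult.assoc mult_scaleC_left)

lemmas reorder' = reorder(1-4,7,8,11,12)[THEN reorder_assoc]

lemma reorder_assoc1:
  assumes "x * y = (z :: 'a)"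
  shows "x * (y * w) = z * w"
  using assms by (metis mult.assoc)

lemmas reorder'' = reorder(5,6,9,10,13-17)[THEN reorder_assoc1]

lemmas scaleC_simps = mult_scaleC_left mult_scaleC_right scaleC_scaleC complex_vector.scale_one
  scaleC_add_right complex_vector.scale_right_diff_distrib complex_vector.scale_minus_right

lemma q_cancel: "q * (inverse q * x) = x" "q * inverse q = 1"
  by simp_all

lemmas normal_simps = q_cancel reorder reorder' reorder'' scaleC_simps mult.assoc c_def d_def cnj_q
  star_mult star_star star_scaleC star_minus star_add algebra_simps

text \<open>The sixth identity says that \<open>D\<close> is the quantum determinant of the matrix
  (a b; c d); it later links level n+1 to level n-1.\<close>

lemma cd_rels:
  "c * a = inverse q *\<^sub>C (a * c)" "d * b = inverse q *\<^sub>C (b * d)" "d * a = a * d"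
  "b * c = q\<^sup>2 *\<^sub>C (c * b)" "d * c = q *\<^sub>C (c * d)" "a * d - q *\<^sub>C (c * b) = D"
  "D * d = d * D" "c * D = inverse (q\<^sup>2) *\<^sub>C (D * c)"
  by (simp_all add: normal_simps power2_eq_square)

lemma T_unitary:
  "a * star a + b * star b = 1" "a * star c + b * star d = 0"
  "c * star a + d * star b = 0" "c * star c + d * star d = 1"
  by (simp_all add: normal_simps power2_eq_square)

text \<open>Unitarity of the matrix of entrywise adjoints, which is not a formal consequence of
  \<open>T_unitary\<close>. Its first entry is the last defining relation, with |q| = 1.\<close>

lemma T_conj_unitary:
  "star a * a + star b * b = 1" "star a * c + star b * d = 0"
  "star c * a + star d * b = 0" "star c * c + star d * d = 1"
  by (simp_all add: normal_simps power2_eq_square)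

lemma star_a_eq: "star a = star D * d"
  by (simp add: d_def D_unitary flip: mult.assoc)

lemma star_b_eq: "star b = (- q) *\<^sub>C (star D * c)"
  by (simp add: c_def normal_simps power2_eq_square)

subsection \<open>The algebra of polynomials in the generators\<close>

abbreviation A where "A \<equiv> OUq2 a b D"

lemma A_add: "x \<in> A \<Longrightarrow> y \<in> A \<Longrightarrow> x + y \<in> A"
  by (auto simp: OUq2_def simp flip: free_eval_add)

lemma A_mult: "x \<in> A \<Longrightarrow> y \<in> A \<Longrightarrow> x * y \<in> A"
  by (auto simp: OUq2_def simp flip: free_eval_mult)

lemma A_scaleC: "x \<in> A \<Longrightarrow> s *\<^sub>C x \<in> A"
  by (auto simp: OUq2_def simp flip: free_eval_scale)

lemma A_star: "x \<in> A \<Longrightarrow> star x \<in> A"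
  by (auto simp: OUq2_def simp flip: free_eval_star)

lemma A_one: "1 \<in> A"
  unfolding OUq2_def by (rule range_eqI[of _ _ 1]) (simp add: free_eval_one)

lemma A_gens: "a \<in> A" "b \<in> A" "D \<in> A"
  unfolding OUq2_def
  using free_eval_gen[of "uq2_gens a b D"] uq2_gens.simps by (metis rangeI)+

lemma A_zero: "0 \<in> A"
  using A_scaleC[OF A_one, of 0] by simp

lemma A_minus: "x \<in> A \<Longrightarrow> - x \<in> A"
  using A_scaleC[of x "-1"] by simp

lemma A_sum: "(\<And>i. i \<in> S \<Longrightarrow> f i \<in> A) \<Longrightarrow> sum f S \<in> A"
  by (induction S rule: infinite_finite_induct) (auto intro: A_zero A_add)

lemma A_power: "x \<in> A \<Longrightarrow> x ^ n \<in> A"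
  by (induction n) (auto intro: A_one A_mult)

lemma A_cd: "c \<in> A" "d \<in> A"
  unfolding c_def d_def by (intro A_minus A_scaleC A_mult A_star A_gens)+

lemma A_unitary_power: "unitary_power D z \<in> A"
  by (simp add: unitary_power_def A_power A_star A_gens)

lemmas A_intros = A_add A_mult A_scaleC A_star A_one A_gens A_zero A_minus A_sum A_power A_cd
  A_unitary_power

end


subsection \<open>Representations by weighted shifts\<close>

text \<open>The phases are those of reordering: they make \<open>a^i b^j D^k\<close>, for \<open>i, j, k\<close> at least 0, map the delta
  function at 0 to \<open>(cos \<theta>)^i (sin \<theta>)^j\<close> times the one at \<open>(i, j, k)\<close>.\<close>

fun uq2_shift :: "complex \<Rightarrow> real \<Rightarrow> uq2_gen \<Rightarrow> bool \<Rightarrow>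
    (int \<times> int \<times> int \<Rightarrow>\<^sub>0 complex) \<Rightarrow> (int \<times> int \<times> int \<Rightarrow>\<^sub>0 complex)" where
  "uq2_shift q \<theta> Gen_a False = shift (1, 0, 0) (\<lambda>_. complex_of_real (cos \<theta>))"
| "uq2_shift q \<theta> Gen_a True = shift (-1, 0, 0) (\<lambda>_. complex_of_real (cos \<theta>))"
| "uq2_shift q \<theta> Gen_b False = shift (0, 1, 0) (\<lambda>(i, j, k). complex_of_real (sin \<theta>) * q powi i)"
| "uq2_shift q \<theta> Gen_b True = shift (0, -1, 0) (\<lambda>(i, j, k). complex_of_real (sin \<theta>) * q powi (- i))"
| "uq2_shift q \<theta> Gen_D False = shift (0, 0, 1) (\<lambda>(i, j, k). q powi (- 2 * j))"
| "uq2_shift q \<theta> Gen_D True = shift (0, 0, -1) (\<lambda>(i, j, k). q powi (2 * j))"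

lemma star_rep_uq2_shift:
  assumes "cmod q = 1"
  shows "star_rep (uq2_shift q \<theta>)"
proof
  have q0: "q \<noteq> 0" using assms by auto
  have cnj: "cnj q = inverse q"
    using assms by (rule cnj_eq_inverse_of_norm_1)
  fix g s x y and k :: complex
  show "uq2_shift q \<theta> g s (x + y) = uq2_shift q \<theta> g s x + uq2_shift q \<theta> g s y"
    by (cases g; cases s) (simp_all add: shift_add)
  show "uq2_shift q \<theta> g s (k *\<^sub>C x) = k *\<^sub>C uq2_shift q \<theta> g s x"
    by (cases g; cases s) (simp_all add: shift_scaleC)
  show "norm (uq2_shift q \<theta> g s x) \<le> norm x"
    by (cases g; cases s) (auto intro!: norm_shift_le simp: norm_mult norm_power_int assms)
  show "uq2_shift q \<theta> g s x \<bullet> y = x \<bullet> uq2_shift q \<theta> g (\<not> s) y"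
    by (cases g; cases s)
      (simp_all add: inner_shift_left split_def cnj power_int_minus power_int_inverse)
  show "k *\<^sub>C x \<bullet> y = x \<bullet> cnj k *\<^sub>C y"
    by (rule inner_scaleC_left)
qed

lemma uq2_shift_relations:
  assumes "cmod q = 1" "r \<in> uq2_relations q"
  shows "star_rep.rep (uq2_shift q \<theta>) r \<xi> = 0"
proof -
  interpret star_rep "uq2_shift q \<theta>"
    by (rule star_rep_uq2_shift) fact
  have q0: "q \<noteq> 0" using assms by auto
  have sc_mult: "complex_of_real (cos \<theta>) * (complex_of_real (cos \<theta>) * x)
      + complex_of_real (sin \<theta>) * (complex_of_real (sin \<theta>) * x) = x" for x
    using sin_cos_squared_add3[of "complex_of_real \<theta>"]
    by (simp add: sin_of_real cos_of_real flip: mult.assoc distrib_right of_real_mult of_real_add)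
  consider "r = free_gen Gen_b * free_gen Gen_a - free_scale q (free_gen Gen_a * free_gen Gen_b)"
    | "r = free_star (free_gen Gen_a) * free_gen Gen_b - free_scale q (free_gen Gen_b * free_star (free_gen Gen_a))"
    | "r = free_gen Gen_b * free_star (free_gen Gen_b) - free_star (free_gen Gen_b) * free_gen Gen_b"
    | "r = free_gen Gen_a * free_star (free_gen Gen_a) + free_gen Gen_b * free_star (free_gen Gen_b) - 1"
    | "r = free_gen Gen_a * free_gen Gen_D - free_gen Gen_D * free_gen Gen_a"
    | "r = free_gen Gen_b * free_gen Gen_D - free_scale (q\<^sup>2 / complex_of_real ((cmod q)\<^sup>2)) (free_gen Gen_D * free_gen Gen_b)"
    | "r = free_gen Gen_D * free_star (free_gen Gen_D) - 1"
    | "r = free_star (free_gen Gen_D) * free_gen Gen_D - 1"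
    | "r = free_star (free_gen Gen_a) * free_gen Gen_a
          + free_scale (complex_of_real ((cmod q)\<^sup>2)) (free_star (free_gen Gen_b) * free_gen Gen_b) - 1"
    using assms(2) unfolding uq2_relations_def Let_def by blast
  then have "Poly_Mapping.lookup (rep r \<xi>) (i, j, k) = 0" for i j k
    by cases
      (simp_all add: rep_diff rep_add rep_mult rep_gen rep_gen_star rep_scale rep_one assms(1)
        lookup_minus lookup_add lookup_scaleC shift.rep_eq scaleC_complex_def power_int_diff
        power_int_add power_int_minus q0 sc_mult power_int_mult power2_eq_square divide_simps flip: distrib_left distrib_right)
  then show ?thesis
    by (intro poly_mapping_eqI) auto
qed

section \<open>Descent of the shift representations, and homogeneous elements\<close>

locale uq2_universal = uq2_rels +
  assumes universal: "is_CUq2 q a b D"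
begin

interpretation S: star_rep "uq2_shift q \<theta>" for \<theta>
  by (rule star_rep_uq2_shift) (rule norm_q)

text \<open>Meaningful only on \<open>A\<close>, where some preimage exists; independence of the
  chosen preimage is \<open>rho_free_eval\<close>.\<close>

definition rho :: "real \<Rightarrow> 'a \<Rightarrow> (int \<times> int \<times> int \<Rightarrow>\<^sub>0 complex) \<Rightarrow> (int \<times> int \<times> int \<Rightarrow>\<^sub>0 complex)" where
  "rho \<theta> x = S.rep \<theta> (SOME f. free_eval (uq2_gens a b D) f = x)"

lemma rho_free_eval: "rho \<theta> (free_eval (uq2_gens a b D) f) \<xi> = S.rep \<theta> f \<xi>"
proof -
  define g where "g = (SOME g. free_eval (uq2_gens a b D) g = free_eval (uq2_gens a b D) f)"
  have "free_eval (uq2_gens a b D) g = free_eval (uq2_gens a b D) f"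
    unfolding g_def by (rule someI) (rule refl)
  then have "free_eval (uq2_gens a b D) (g - f) = 0"
    by (simp add: free_eval_diff)
  then have "S.rep \<theta> (g - f) \<xi> = 0"
    using S.universal_cstar_algebra_rep_eq_0[OF universal[unfolded is_CUq2_def], of \<theta> "g - f" \<xi>]
      uq2_shift_relations[OF norm_q] by blast
  then show ?thesis
    by (simp add: rho_def g_def S.rep_diff)
qed

lemma rho_add: "x \<in> A \<Longrightarrow> y \<in> A \<Longrightarrow> rho \<theta> (x + y) \<xi> = rho \<theta> x \<xi> + rho \<theta> y \<xi>"
  by (auto simp: OUq2_def rho_free_eval S.rep_add simp flip: free_eval_add)

lemma rho_mult: "x \<in> A \<Longrightarrow> y \<in> A \<Longrightarrow> rho \<theta> (x * y) \<xi> = rho \<theta> x (rho \<theta> y \<xi>)"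
  by (auto simp: OUq2_def rho_free_eval S.rep_mult simp flip: free_eval_mult)

lemma rho_scaleC: "x \<in> A \<Longrightarrow> rho \<theta> (s *\<^sub>C x) \<xi> = s *\<^sub>C rho \<theta> x \<xi>"
  by (auto simp: OUq2_def rho_free_eval S.rep_scale simp flip: free_eval_scale)

lemma rho_one: "rho \<theta> 1 \<xi> = \<xi>"
  using rho_free_eval[of \<theta> 1 \<xi>] by (simp add: free_eval_one S.rep_one)

lemma rho_gens:
  "rho \<theta> a \<xi> = uq2_shift q \<theta> Gen_a False \<xi>" "rho \<theta> (star a) \<xi> = uq2_shift q \<theta> Gen_a True \<xi>"
  "rho \<theta> b \<xi> = uq2_shift q \<theta> Gen_b False \<xi>" "rho \<theta> (star b) \<xi> = uq2_shift q \<theta> Gen_b True \<xi>"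
  "rho \<theta> D \<xi> = uq2_shift q \<theta> Gen_D False \<xi>" "rho \<theta> (star D) \<xi> = uq2_shift q \<theta> Gen_D True \<xi>"
  using rho_free_eval[of \<theta> "free_gen Gen_a" \<xi>] rho_free_eval[of \<theta> "free_star (free_gen Gen_a)" \<xi>]
    rho_free_eval[of \<theta> "free_gen Gen_b" \<xi>] rho_free_eval[of \<theta> "free_star (free_gen Gen_b)" \<xi>]
    rho_free_eval[of \<theta> "free_gen Gen_D" \<xi>] rho_free_eval[of \<theta> "free_star (free_gen Gen_D)" \<xi>]
  unfolding free_eval_gen free_eval_gen_star S.rep_gen S.rep_gen_star uq2_gens.simps by simp_all

lemma rho_sum:
  assumes "\<And>i. i \<in> I \<Longrightarrow> f i \<in> A"
  shows "rho \<theta> (sum f I) \<xi> = (\<Sum>i\<in>I. rho \<theta> (f i) \<xi>)"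
proof -
  have "rho \<theta> 0 \<xi> = 0"
    using rho_scaleC[OF A_one, of \<theta> 0 \<xi>] by simp
  then show ?thesis
    using assms
    by (induction I rule: infinite_finite_induct) (simp_all add: rho_add A_sum)
qed

text \<open>The point is that \<open>\<kappa>\<close> does not depend on \<open>\<theta>\<close>.\<close>

definition monomial :: "'a \<Rightarrow> nat \<Rightarrow> nat \<Rightarrow> int \<times> int \<times> int \<Rightarrow> bool" where
  "monomial x m n e \<longleftrightarrow> x \<in> A \<and> (\<forall>e'. \<exists>\<kappa>. \<kappa> \<noteq> 0 \<and> (\<forall>\<theta> v. rho \<theta> x (Poly_Mapping.single e' v) =
     Poly_Mapping.single (e' + e) (\<kappa> * complex_of_real (cos \<theta> ^ m * sin \<theta> ^ n) * v)))"

lemma monomialI: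
  assumes "x \<in> A" "\<And>i j k. \<kappa> i j k \<noteq> 0"
    "\<And>i j k \<theta> v. rho \<theta> x (Poly_Mapping.single (i, j, k) v) =
      Poly_Mapping.single ((i, j, k) + e) (\<kappa> i j k * complex_of_real (cos \<theta> ^ m * sin \<theta> ^ n) * v)"
  shows "monomial x m n e"
  unfolding monomial_def using assms by (metis prod_cases3)

lemma monomial_in_A: "monomial x m n e \<Longrightarrow> x \<in> A"
  by (simp add: monomial_def)

lemma monomial_one: "monomial 1 0 0 0"
  unfolding monomial_def by (auto simp: A_one rho_one intro!: exI[of _ 1])

lemma monomial_mult:
  assumes "monomial x m n e" "monomial y m' n' e'"
  shows "monomial (x * y) (m + m') (n + n') (e + e')"
  unfolding monomial_def
proof (intro conjI allI)
  fix e0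
  obtain \<kappa> where \<kappa>: "\<kappa> \<noteq> 0" "\<And>\<theta> v. rho \<theta> y (Poly_Mapping.single e0 v) =
     Poly_Mapping.single (e0 + e') (\<kappa> * complex_of_real (cos \<theta> ^ m' * sin \<theta> ^ n') * v)"
    using assms(2) unfolding monomial_def by blast
  obtain \<mu> where \<mu>: "\<mu> \<noteq> 0" "\<And>\<theta> v. rho \<theta> x (Poly_Mapping.single (e0 + e') v) =
     Poly_Mapping.single (e0 + e' + e) (\<mu> * complex_of_real (cos \<theta> ^ m * sin \<theta> ^ n) * v)"
    using assms(1) unfolding monomial_def by blast
  show "\<exists>\<kappa>. \<kappa> \<noteq> 0 \<and> (\<forall>\<theta> v. rho \<theta> (x * y) (Poly_Mapping.single e0 v) =
     Poly_Mapping.single (e0 + (e + e')) (\<kappa> * complex_of_real (cos \<theta> ^ (m + m') * sin \<theta> ^ (n + n')) * v))"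
  proof (intro exI[of _ "\<mu> * \<kappa>"] conjI allI)
    fix \<theta> v
    have "e0 + (e + e') = e0 + e' + e"
      by (simp add: ac_simps)
    moreover have "\<mu> * \<kappa> * complex_of_real (cos \<theta> ^ (m + m') * sin \<theta> ^ (n + n')) * v =
        \<mu> * complex_of_real (cos \<theta> ^ m * sin \<theta> ^ n) * (\<kappa> * complex_of_real (cos \<theta> ^ m' * sin \<theta> ^ n') * v)"
      by (simp add: power_add)
    moreover have "rho \<theta> (x * y) (Poly_Mapping.single e0 v) = rho \<theta> x (rho \<theta> y (Poly_Mapping.single e0 v))"
      by (intro rho_mult monomial_in_A[OF assms(1)] monomial_in_A[OF assms(2)])
    ultimately show "rho \<theta> (x * y) (Poly_Mapping.single e0 v) =
     Poly_Mapping.single (e0 + (e + e')) (\<mu> * \<kappa> * complex_of_real (cos \<theta> ^ (m + m') * sin \<theta> ^ (n + n')) * v)"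
      by (simp only: \<kappa> \<mu>)
  qed (use \<kappa> \<mu> in simp)
qed (use assms in \<open>auto intro: A_mult monomial_in_A\<close>)

lemma monomial_scaleC:
  assumes "monomial x m n e" "s \<noteq> 0"
  shows "monomial (s *\<^sub>C x) m n e"
  unfolding monomial_def
proof (intro conjI allI)
  fix e0
  obtain \<kappa> where \<kappa>: "\<kappa> \<noteq> 0" "\<And>\<theta> v. rho \<theta> x (Poly_Mapping.single e0 v) =
     Poly_Mapping.single (e0 + e) (\<kappa> * complex_of_real (cos \<theta> ^ m * sin \<theta> ^ n) * v)"
    using assms(1) unfolding monomial_def by blast
  have "s *\<^sub>C Poly_Mapping.single e v = Poly_Mapping.single e (s * v)" for e :: "int \<times> int \<times> int" and v
    by (rule poly_mapping_eqI) (simp add: lookup_scaleC scaleC_complex_def lookup_single when_def)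
  then show "\<exists>\<kappa>. \<kappa> \<noteq> 0 \<and> (\<forall>\<theta> v. rho \<theta> (s *\<^sub>C x) (Poly_Mapping.single e0 v) =
     Poly_Mapping.single (e0 + e) (\<kappa> * complex_of_real (cos \<theta> ^ m * sin \<theta> ^ n) * v))"
    using assms by (intro exI[of _ "s * \<kappa>"]) (simp add: \<kappa> rho_scaleC monomial_in_A mult.assoc)
qed (use assms in \<open>auto intro: A_scaleC monomial_in_A\<close>)

lemma monomial_power:
  assumes "monomial x m n (i, j, k)"
  shows "monomial (x ^ r) (r * m) (r * n) (int r * i, int r * j, int r * k)"
proof (induction r)
  case 0
  show ?case using monomial_one by (simp add: zero_prod_def)
next
  case (Suc r)
  show ?case
    using monomial_mult[OF assms Suc] by (simp add: algebra_simps)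
qed

lemma monomial_gens:
  "monomial a 1 0 (1, 0, 0)" "monomial (star a) 1 0 (-1, 0, 0)"
  "monomial b 0 1 (0, 1, 0)" "monomial (star b) 0 1 (0, -1, 0)"
  "monomial D 0 0 (0, 0, 1)" "monomial (star D) 0 0 (0, 0, -1)"
proof -
  show "monomial a 1 0 (1, 0, 0)"
    by (rule monomialI[where \<kappa> = "\<lambda>i j k. 1"]) (simp_all add: A_intros rho_gens shift_single mult.commute mult.left_commute)
  show "monomial (star a) 1 0 (-1, 0, 0)"
    by (rule monomialI[where \<kappa> = "\<lambda>i j k. 1"]) (simp_all add: A_intros rho_gens shift_single mult.commute mult.left_commute)
  show "monomial b 0 1 (0, 1, 0)"
    by (rule monomialI[where \<kappa> = "\<lambda>i j k. q powi i"]) (simp_all add: A_intros rho_gens shift_single mult.commute mult.left_commute)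
  show "monomial (star b) 0 1 (0, -1, 0)"
    by (rule monomialI[where \<kappa> = "\<lambda>i j k. q powi (- i)"]) (simp_all add: A_intros rho_gens shift_single mult.commute mult.left_commute)
  show "monomial D 0 0 (0, 0, 1)"
    by (rule monomialI[where \<kappa> = "\<lambda>i j k. q powi (- 2 * j)"]) (simp_all add: A_intros rho_gens shift_single mult.commute mult.left_commute)
  show "monomial (star D) 0 0 (0, 0, -1)"
    by (rule monomialI[where \<kappa> = "\<lambda>i j k. q powi (2 * j)"]) (simp_all add: A_intros rho_gens shift_single mult.commute mult.left_commute)
qed

lemma monomial_cd: "monomial c 0 1 (0, -1, 1)" "monomial d 1 0 (-1, 0, 1)"
proof -
  have "monomial ((- cnj q) *\<^sub>C (D * star b)) 0 1 (0, -1, 1)"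
    using monomial_scaleC[OF monomial_mult[OF monomial_gens(5,4)], of "- cnj q"] by simp
  then show "monomial c 0 1 (0, -1, 1)"
    by (simp add: c_def)
  show "monomial d 1 0 (-1, 0, 1)"
    using monomial_mult[OF monomial_gens(5,2)] by (simp add: d_def)
qed

lemma monomial_unitary_power: "monomial (unitary_power D z) 0 0 (0, 0, z)"
  using monomial_power[OF monomial_gens(5), of "nat z"] monomial_power[OF monomial_gens(6), of "nat (- z)"]
  by (auto simp: unitary_power_def)

lemma monomial_word:
  "monomial (a ^ m * c ^ p * b ^ r * d ^ s) (m + s) (p + r)
    (int m - int s, int r - int p, int p + int s)"
  using monomial_mult[OF monomial_mult[OF monomial_mult[OF monomial_power[OF monomial_gens(1), of m]
        monomial_power[OF monomial_cd(1), of p]] monomial_power[OF monomial_gens(3), of r]]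
        monomial_power[OF monomial_cd(2), of s]]
  by simp

text \<open>The factor only has to be nonzero for some \<theta>, which may depend on the element:
  sums such as the matrix coefficients can vanish at particular angles.\<close>

definition homogeneous :: "'a \<Rightarrow> int \<times> int \<times> int \<Rightarrow> bool" where
  "homogeneous x g \<longleftrightarrow> x \<in> A \<and> (\<exists>v. (\<exists>\<theta>. v \<theta> \<noteq> 0) \<and>
     (\<forall>\<theta>. rho \<theta> x (Poly_Mapping.single 0 1) = Poly_Mapping.single g (v \<theta>)))"

lemma homogeneous_in_A: "homogeneous x g \<Longrightarrow> x \<in> A"
  by (simp add: homogeneous_def)

lemma homogeneous_monomial:
  assumes "monomial x m n g"
  shows "homogeneous x g"
proof -
  obtain \<kappa> where \<kappa>: "\<kappa> \<noteq> 0" "\<And>\<theta> v. rho \<theta> x (Poly_Mapping.single 0 v) =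
     Poly_Mapping.single (0 + g) (\<kappa> * complex_of_real (cos \<theta> ^ m * sin \<theta> ^ n) * v)"
    using assms unfolding monomial_def by blast
  \<comment> \<open>At this angle neither the cosine nor the sine vanishes.\<close>
  have "\<kappa> * complex_of_real (cos (pi / 4) ^ m * sin (pi / 4) ^ n) \<noteq> 0"
    using \<kappa>(1) by (simp add: cos_45 sin_45)
  then show ?thesis
    using \<kappa>(2)[of _ 1] monomial_in_A[OF assms]
    by (auto simp: homogeneous_def simp del: single_one
        intro!: exI[of _ "\<lambda>\<theta>. \<kappa> * complex_of_real (cos \<theta> ^ m * sin \<theta> ^ n)"])
qed

text \<open>Apply the relation to the delta function at 0 and read the result at the point
  \<open>g i\<close>. Only the term \<open>i\<close> contributes there, so \<theta> may be chosen
  for that term alone.\<close>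

lemma homogeneous_independent:
  assumes "finite I" "\<And>i. i \<in> I \<Longrightarrow> homogeneous (x i) (g i)" "inj_on g I"
    and sum_0: "(\<Sum>i\<in>I. y i *\<^sub>C x i) = 0" and i: "i \<in> I"
  shows "y i = 0"
proof -
  have "\<exists>v. (\<exists>\<theta>. v \<theta> \<noteq> 0) \<and>
     (\<forall>\<theta>. rho \<theta> (x i) (Poly_Mapping.single 0 1) = Poly_Mapping.single (g i) (v \<theta>))" if "i \<in> I" for i
    using assms(2)[OF that] unfolding homogeneous_def by blast
  then obtain v where v: "\<And>i. i \<in> I \<Longrightarrow> \<exists>\<theta>. v i \<theta> \<noteq> 0"
    "\<And>i \<theta>. i \<in> I \<Longrightarrow> rho \<theta> (x i) (Poly_Mapping.single 0 1) = Poly_Mapping.single (g i) (v i \<theta>)"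
    by metis
  obtain \<theta> where \<theta>: "v i \<theta> \<noteq> 0"
    using v(1)[OF i] by blast
  have in_A: "x l \<in> A" if "l \<in> I" for l
    using assms(2)[OF that] by (rule homogeneous_in_A)
  have "rho \<theta> (\<Sum>l\<in>I. y l *\<^sub>C x l) (Poly_Mapping.single 0 1)
      = (\<Sum>l\<in>I. y l *\<^sub>C Poly_Mapping.single (g l) (v l \<theta>))"
    by (subst rho_sum) (auto simp: rho_scaleC A_scaleC in_A v simp del: single_one)
  moreover have "rho \<theta> 0 (Poly_Mapping.single 0 1) = 0"
    using rho_sum[of "{}"] by simp
  ultimately have "0 = Poly_Mapping.lookup (\<Sum>l\<in>I. y l *\<^sub>C Poly_Mapping.single (g l) (v l \<theta>)) (g i)"
    using sum_0 by simp
  also have "\<dots> = (\<Sum>l\<in>I. if l = i then y i * v i \<theta> else 0)"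
    unfolding lookup_sum using inj_onD[OF assms(3) _ _ i]
    by (intro sum.cong) (auto simp: lookup_scaleC scaleC_complex_def lookup_single when_def)
  also have "\<dots> = y i * v i \<theta>"
    using i assms(1) by simp
  finally show ?thesis
    using \<theta> by simp
qed

lemma sum_basis_eq_0D:
  assumes "(\<Sum>k\<le>n. y k *\<^sub>C (a ^ (n - k) * b ^ k)) = 0" "k \<le> n"
  shows "y k = 0"
proof (rule homogeneous_independent[OF _ _ _ assms(1)])
  show "homogeneous (a ^ (n - k) * b ^ k) (int (n - k), int k, 0)" for k
    using monomial_word[of "n - k" 0 k 0] by (intro homogeneous_monomial) simp
qed (use assms(2) in \<open>auto simp: inj_on_def\<close>)

end

subsection \<open>The matrix coefficients\<close>

lemma of_nat_mult_eq_scaleC: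
  "of_nat n * (x :: 'a::unital_cstar_algebra) = complex_of_real (real n) *\<^sub>C x"
  by (induction n) (simp_all add: algebra_simps scaleC_add_left complex_vector.scale_one)

lemma binomial_commuting:
  fixes x y :: "'a::ring_1"
  assumes "y * x = x * y"
  shows "(x + y) ^ n = (\<Sum>i\<le>n. of_nat (n choose i) * (x ^ (n - i) * y ^ i))"
proof (induction n)
  case (Suc n)
  have yx: "y ^ i * x = x * y ^ i" for i
    by (rule power_commuting_commutes) (use assms in simp)
  have "(x + y) ^ Suc n = (\<Sum>i\<le>n. of_nat (n choose i) * (x ^ (n - i) * y ^ i)) * x
      + (\<Sum>i\<le>n. of_nat (n choose i) * (x ^ (n - i) * y ^ i)) * y"
    unfolding power_Suc2 Suc by (simp add: distrib_left)
  also have "(\<Sum>i\<le>n. of_nat (n choose i) * (x ^ (n - i) * y ^ i)) * x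
      = (\<Sum>i\<le>Suc n. of_nat (n choose i) * (x ^ (Suc n - i) * y ^ i))"
    by (auto simp: sum_distrib_right mult.assoc yx Suc_diff_le power_Suc2 binomial_eq_0 simp del: power_Suc
        intro!: sum.cong)
  also have "(\<Sum>i\<le>n. of_nat (n choose i) * (x ^ (n - i) * y ^ i)) * y
      = (\<Sum>i\<le>n. of_nat (n choose i) * (x ^ (n - i) * y ^ Suc i))"
    by (simp add: sum_distrib_right mult.assoc power_Suc2 del: power_Suc)
  also have "(\<Sum>i\<le>Suc n. of_nat (n choose i) * (x ^ (Suc n - i) * y ^ i)) + \<dots>
      = (\<Sum>i\<le>Suc n. of_nat (Suc n choose i) * (x ^ (Suc n - i) * y ^ i))"
    unfolding sum.atMost_Suc_shift[of _ n] by (simp add: sum.distrib algebra_simps)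
  finally show ?case .
qed simp

lemma power_scaleC_commute:
  fixes x y :: "'a::unital_cstar_algebra"
  assumes "y * x = s *\<^sub>C (x * y)"
  shows "y ^ m * x ^ n = s ^ (m * n) *\<^sub>C (x ^ n * y ^ m)"
proof -
  have *: "y * x ^ n = s ^ n *\<^sub>C (x ^ n * y)"
  proof (induction n)
    case (Suc n)
    have "y * x ^ Suc n = s *\<^sub>C (x * (y * x ^ n))"
      using assms by (simp add: mult_scaleC_left flip: mult.assoc)
    then show ?case
      unfolding Suc by (simp add: mult_scaleC_right scaleC_scaleC mult.assoc)
  qed (simp add: complex_vector.scale_one)
  show ?thesis
  proof (induction m)
    case (Suc m)
    have "y ^ Suc m * x ^ n = y * (y ^ m * x ^ n)"
      by (simp add: mult.assoc)
    also have "\<dots> = s ^ (m * n) *\<^sub>C (y * x ^ n * y ^ m)"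
      unfolding Suc by (simp add: mult_scaleC_right mult.assoc)
    finally show ?case
      unfolding * by (simp add: mult_scaleC_left scaleC_scaleC mult.assoc power_add mult.commute)
  qed (simp add: complex_vector.scale_one)
qed

text \<open>Pascal's rule, arranged so that column \<open>j\<close> of level n is paired with
  columns \<open>j\<close> and \<open>Suc j\<close> of level n+1, the two that the recursions
  produce from it.\<close>

lemma sum_binomial_Suc:
  fixes F :: "nat \<Rightarrow> 'v::complex_normed_space"
  shows "(\<Sum>j\<le>Suc n. of_nat (Suc n choose j) *\<^sub>C F j) = (\<Sum>j\<le>n. of_nat (n choose j) *\<^sub>C (F j + F (Suc j)))"
proof -
  have "(\<Sum>j\<le>n. of_nat (n choose j) *\<^sub>C F j) = (\<Sum>j\<le>Suc n. of_nat (n choose j) *\<^sub>C F j)"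
    by simp
  also have "\<dots> = F 0 + (\<Sum>j\<le>n. of_nat (n choose Suc j) *\<^sub>C F (Suc j))"
    by (subst sum.atMost_Suc_shift) (simp add: complex_vector.scale_one)
  finally show ?thesis
    by (subst sum.atMost_Suc_shift)
      (simp add: scaleC_add_right scaleC_add_left sum.distrib complex_vector.scale_one algebra_simps)
qed

lemma star_diff: "star (x - y) = star x - star (y :: 'a::unital_cstar_algebra)"
  using star_add[of x "- y"] by (simp add: star_minus)

context uq2_rels
begin

text \<open>Here \<open>p\<close> is the exponent of \<open>c\<close>; terms with an exponent truncated at 0 have binomial coefficient 0.\<close>

definition u :: "nat \<Rightarrow> nat \<Rightarrow> nat \<Rightarrow> 'a" where
  "u n k j = (\<Sum>p\<le>k. (q ^ ((j - (k - p)) * p) * of_nat ((n - j choose p) * (j choose (k - p)))) *\<^sub>C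
     (a ^ (n - j - p) * c ^ p * b ^ (j - (k - p)) * d ^ (k - p)))"

text \<open>The row above row \<open>k\<close>, with 0 above the top row, so that the recursions
  need no case distinction.\<close>

definition u_pred :: "nat \<Rightarrow> nat \<Rightarrow> nat \<Rightarrow> 'a" where
  "u_pred n k j = (case k of 0 \<Rightarrow> 0 | Suc k' \<Rightarrow> u n k' j)"

lemma u_pred_simps [simp]: "u_pred n 0 j = 0" "u_pred n (Suc k) j = u n k j"
  by (simp_all add: u_pred_def)

lemma u_eq_0:
  assumes "j \<le> n" "n < k"
  shows "u n k j = 0"
proof -
  have "(n - j choose p) * (j choose (k - p)) = 0" if "p \<le> k" for p
    using assms that by (cases "p \<le> n - j") (auto simp: binomial_eq_0)
  then show ?thesis
    unfolding u_def by (intro sum.neutral) auto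
qed

lemma u_0_0_0: "u 0 0 0 = 1"
  by (simp add: u_def complex_vector.scale_one)

lemma u_in_A: "u n k j \<in> A"
  unfolding u_def by (intro A_intros)

end

section \<open>The coproduct on the monomials and the two recursions\<close>

locale uq2_coproduct = uq2_universal +
  fixes tens :: "'a \<Rightarrow> 'a \<Rightarrow> 't::unital_cstar_algebra" and \<Delta> :: "'a \<Rightarrow> 't"
  assumes min_tens: "minimal_tensor_product tens"
    and comult: "uq2_comultiplication q a b D tens \<Delta>"
begin

lemma tens_simps:
  "tens (x + x') y = tens x y + tens x' y" "tens x (y + y') = tens x y + tens x y'"
  "tens (s *\<^sub>C x) y = s *\<^sub>C tens x y" "tens x (s *\<^sub>C y) = s *\<^sub>C tens x y"
  "tens x y * tens x' y' = tens (x * x') (y * y')" "star (tens x y) = tens (star x) (star y)"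
  "tens 1 1 = 1"
proof -
  note mt = min_tens[unfolded minimal_tensor_product_def]
  show "tens (x + x') y = tens x y + tens x' y"
    using mt by (elim conjE) simp
  show "tens x (y + y') = tens x y + tens x y'"
    using mt by (elim conjE) simp
  show "tens (s *\<^sub>C x) y = s *\<^sub>C tens x y" "tens x (s *\<^sub>C y) = s *\<^sub>C tens x y"
    using mt by (elim conjE, simp)+
  show "tens x y * tens x' y' = tens (x * x') (y * y')"
    using mt by (elim conjE) simp
  show "star (tens x y) = tens (star x) (star y)"
    using mt by (elim conjE) simp
  show "tens 1 1 = 1"
    using mt by (elim conjE) simp
qed

lemma tens_zero: "tens x 0 = 0" "tens 0 y = 0"
  using tens_simps(4)[of x 0 0] tens_simps(3)[of 0 0 y] by simp_all

lemma tens_minus: "tens (- x) y = - tens x y" "tens x (- y) = - tens x y"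
  by (metis add_eq_0_iff tens_simps(1) tens_zero(2) add.right_inverse)
    (metis add_eq_0_iff tens_simps(2) tens_zero(1) add.right_inverse)

lemma tens_sum: "tens (sum f I) y = (\<Sum>i\<in>I. tens (f i) y)" "tens x (sum g I) = (\<Sum>i\<in>I. tens x (g i))"
  by (induction I rule: infinite_finite_induct) (simp_all add: tens_zero tens_simps)

lemma tens_power: "tens x y ^ n = tens (x ^ n) (y ^ n)"
  by (induction n) (simp_all add: tens_simps)

lemma tens_independent:
  assumes "finite X" "complex_vector.independent X" "(\<Sum>x\<in>X. tens x (y x)) = 0" "x \<in> X"
  shows "y x = 0"
proof -
  have "\<forall>X y. finite X \<and> complex_vector.independent X \<and> (\<Sum>x\<in>X. tens x (y x)) = 0 \<longrightarrow> (\<forall>x\<in>X. y x = 0)"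
    using min_tens unfolding minimal_tensor_product_def by (elim conjE)
  with assms show ?thesis
    by blast
qed

lemma Delta_simps:
  "\<Delta> (x + y) = \<Delta> x + \<Delta> y" "\<Delta> (s *\<^sub>C x) = s *\<^sub>C \<Delta> x" "\<Delta> (x * y) = \<Delta> x * \<Delta> y"
  "\<Delta> (star x) = star (\<Delta> x)" "\<Delta> 1 = 1"
  using comult unfolding uq2_comultiplication_def star_hom_def by (elim conjE, simp)+

lemma Delta_zero: "\<Delta> 0 = 0"
  using Delta_simps(2)[of 0 0] by simp

lemma Delta_minus: "\<Delta> (- x) = - \<Delta> x"
  by (metis add_eq_0_iff Delta_simps(1) Delta_zero add.right_inverse)

lemma Delta_power: "\<Delta> (x ^ n) = \<Delta> x ^ n"
  by (induction n) (simp_all add: Delta_simps)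

lemma Delta_gens:
  "\<Delta> a = tens a a + tens b c" "\<Delta> b = tens a b + tens b d"
  "\<Delta> c = tens c a + tens d c" "\<Delta> d = tens c b + tens d d" "\<Delta> D = tens D D"
proof -
  show a: "\<Delta> a = tens a a + tens b c" and b: "\<Delta> b = tens a b + tens b d" and D: "\<Delta> D = tens D D"
    using comult unfolding uq2_comultiplication_def
    by (simp_all add: c_def d_def tens_simps tens_minus)
  have "\<Delta> c = - (cnj q *\<^sub>C (\<Delta> D * star (\<Delta> b)))"
    by (simp add: c_def Delta_minus Delta_simps)
  then show "\<Delta> c = tens c a + tens d c"
    unfolding D b by (simp add: star_add tens_simps tens_minus algebra_simps normal_simps)
  have "\<Delta> d = \<Delta> D * star (\<Delta> a)"
    by (simp add: d_def Delta_simps)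
  then show "\<Delta> d = tens c b + tens d d"
    unfolding D a by (simp add: star_add star_diff distrib_left right_diff_distrib tens_simps tens_minus normal_simps power2_eq_square)
qed

definition e :: "nat \<Rightarrow> nat \<Rightarrow> 'a" where
  "e n k = a ^ (n - k) * b ^ k"

text \<open>Injectivity on the tensor product is assumed for independent sets, so the family must be
  identified with its image.\<close>

lemma inj_on_e: "inj_on (e n) {..n}"
proof (rule inj_onI)
  fix k l
  assume kl: "k \<in> {..n}" "l \<in> {..n}" "e n k = e n l"
  show "k = l"
  proof (rule ccontr)
    assume "k \<noteq> l"
    have "(\<Sum>i\<le>n. (if i = k then 1 else if i = l then -1 else 0) *\<^sub>C (a ^ (n - i) * b ^ i))
        = (\<Sum>i\<le>n. (if i = k then e n k else 0) - (if i = l then e n l else 0))"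
      using \<open>k \<noteq> l\<close> by (intro sum.cong) (auto simp: e_def complex_vector.scale_one)
    also have "\<dots> = 0"
      using kl by (simp add: sum_subtractf)
    finally show False
      using sum_basis_eq_0D[of "\<lambda>i. if i = k then 1 else if i = l then -1 else 0" n k] kl by simp
  qed
qed

lemma independent_e: "complex_vector.independent (e n ` {..n})"
proof
  assume "complex_vector.dependent (e n ` {..n})"
  then obtain w where w: "\<exists>v\<in>e n ` {..n}. w v \<noteq> 0" "(\<Sum>v\<in>e n ` {..n}. w v *\<^sub>C v) = 0"
    by (auto simp: complex_vector.dependent_finite)
  have "(\<Sum>k\<le>n. w (e n k) *\<^sub>C (a ^ (n - k) * b ^ k)) = 0"
    using w(2) by (simp add: sum.reindex[OF inj_on_e] flip: e_def)
  then show False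
    using sum_basis_eq_0D[of "\<lambda>k. w (e n k)" n] w(1) by auto
qed

text \<open>Comparison of coefficients in the first leg. It makes the matrix coefficients unique and
  lets identities between them be read off from \<Delta> instead of from the explicit sum.\<close>

lemma tens_e_eqD:
  assumes "(\<Sum>k\<le>n. tens (e n k) (y k)) = (\<Sum>k\<le>n. tens (e n k) (z k))" "k \<le> n"
  shows "y k = z k"
proof -
  let ?inv = "the_inv_into {..n} (e n)"
  have inv: "?inv (e n k) = k" if "k \<le> n" for k
    using that by (simp add: the_inv_into_f_f[OF inj_on_e])
  have "(\<Sum>x\<in>e n ` {..n}. tens x (y (?inv x) - z (?inv x))) = (\<Sum>k\<le>n. tens (e n k) (y k - z k))"
    by (simp add: sum.reindex[OF inj_on_e] inv)
  also have "\<dots> = (\<Sum>k\<le>n. tens (e n k) (y k)) - (\<Sum>k\<le>n. tens (e n k) (z k))"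
    unfolding sum_subtractf[symmetric]
    by (rule sum.cong) (metis add_diff_cancel_right' diff_add_cancel tens_simps(2))+
  finally have "y (?inv (e n k)) - z (?inv (e n k)) = 0"
    using assms by (intro tens_independent[OF _ independent_e, where y = "\<lambda>x. y (?inv x) - z (?inv x)"]) auto
  then show ?thesis
    using inv[OF assms(2)] by simp
qed

lemma Delta_e:
  assumes "j \<le> n"
  shows "\<Delta> (e n j) = (\<Sum>k\<le>n. tens (e n k) (u n k j))"
proof -
  let ?F = "\<lambda>p s. (q ^ ((j - s) * p) * of_nat ((n - j choose p) * (j choose s))) *\<^sub>C
      tens (e n (p + s)) (a ^ (n - j - p) * c ^ p * b ^ (j - s) * d ^ s)"
  have comm: "tens b c * tens a a = tens a a * tens b c" "tens b d * tens a b = tens a b * tens b d"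
    by (simp_all add: tens_simps cd_rels reorder scaleC_scaleC complex_vector.scale_one)
  have "\<Delta> (e n j) = (tens a a + tens b c) ^ (n - j) * (tens a b + tens b d) ^ j"
    by (simp add: e_def Delta_simps Delta_power Delta_gens)
  also have "\<dots> = (\<Sum>p\<le>n - j. \<Sum>s\<le>j. (of_nat ((n - j choose p) * (j choose s))) *\<^sub>C
      (tens (a ^ (n - j - p) * b ^ p) (a ^ (n - j - p) * c ^ p) * tens (a ^ (j - s) * b ^ s) (b ^ (j - s) * d ^ s)))"
    unfolding binomial_commuting[OF comm(1)] binomial_commuting[OF comm(2)]
    by (simp add: sum_product of_nat_mult_eq_scaleC tens_simps tens_power mult_scaleC_left
        mult_scaleC_right scaleC_scaleC mult.commute)
  also have "\<dots> = (\<Sum>p\<le>n - j. \<Sum>s\<le>j. ?F p s)"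
  proof (intro sum.cong refl)
    fix p s assume ps: "p \<in> {..n - j}" "s \<in> {..j}"
    have "a ^ (n - j - p) * b ^ p * (a ^ (j - s) * b ^ s) = a ^ (n - j - p) * (b ^ p * a ^ (j - s)) * b ^ s"
      by (simp add: mult.assoc)
    \<comment> \<open>The only phase in the formula arises here, when \<open>b ^ p\<close> from the
      first factor moves past \<open>a ^ (j - s)\<close> from the second.\<close>
    also have "\<dots> = q ^ (p * (j - s)) *\<^sub>C (a ^ (n - j - p) * a ^ (j - s) * (b ^ p * b ^ s))"
      unfolding power_scaleC_commute[OF reorder(1)]
      by (simp add: mult_scaleC_left mult_scaleC_right mult.assoc)
    also have "\<dots> = q ^ (p * (j - s)) *\<^sub>C e n (p + s)"
    proof -
      have "n - j - p + (j - s) = n - (p + s)"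
        using ps assms by auto
      then show ?thesis
        by (simp add: e_def flip: power_add)
    qed
    finally show "(of_nat ((n - j choose p) * (j choose s))) *\<^sub>C
      (tens (a ^ (n - j - p) * b ^ p) (a ^ (n - j - p) * c ^ p) * tens (a ^ (j - s) * b ^ s) (b ^ (j - s) * d ^ s))
      = ?F p s"
      by (simp add: tens_simps scaleC_scaleC mult.assoc) (simp add: ac_simps)
  qed
  also have "\<dots> = (\<Sum>(p, s)\<in>{..n - j} \<times> {..j}. ?F p s)"
    by (simp add: sum.cartesian_product)
  \<comment> \<open>The added pairs have a vanishing binomial coefficient; the triangle can then be
    summed along \<open>k = p + s\<close>.\<close>
  also have "\<dots> = (\<Sum>(p, s)\<in>{(p, s). p + s \<le> n}. ?F p s)"
  proof (rule sum.mono_neutral_left)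
    have "{(p, s). p + s \<le> n} \<subseteq> {..n} \<times> {..n}"
      by auto
    then show "finite {(p, s). p + s \<le> n}"
      by (rule finite_subset) simp
  qed (use assms in \<open>auto simp: not_le binomial_eq_0\<close>)
  also have "\<dots> = (\<Sum>k\<le>n. \<Sum>p\<le>k. ?F p (k - p))"
    by (rule sum.triangle_reindex_eq)
  also have "\<dots> = (\<Sum>k\<le>n. tens (e n k) (u n k j))"
    by (simp add: u_def tens_sum tens_simps)
  finally show ?thesis .
qed

lemma e_mult: "j \<le> n \<Longrightarrow> e n j * a = q ^ j *\<^sub>C e (Suc n) j" "e n j * b = e (Suc n) (Suc j)"
proof -
  show "e n j * a = q ^ j *\<^sub>C e (Suc n) j" if "j \<le> n"
    using power_scaleC_commute[OF reorder(1), of j 1] that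
    by (simp add: e_def mult.assoc mult_scaleC_right Suc_diff_le power_commutes)
      (simp add: power_commutes flip: mult.assoc)
  show "e n j * b = e (Suc n) (Suc j)"
    by (simp add: e_def mult.assoc power_commutes)
qed

text \<open>The second legs \<open>z\<close>, \<open>w\<close> stay arbitrary because they are
  \<open>a\<close>, \<open>c\<close> in \<Delta> a and \<open>b\<close>, \<open>d\<close> in
  \<Delta> b.\<close>

lemma sum_tens_e_shift:
  assumes "j \<le> n"
  shows "(\<Sum>k\<le>n. tens (e n k) (u n k j)) * (tens a z + tens b w) =
    (\<Sum>k\<le>Suc n. tens (e (Suc n) k) (q ^ k *\<^sub>C (u n k j * z) + u_pred n k j * w))"
proof -
  have "(\<Sum>k\<le>n. tens (e n k) (u n k j)) * tens a z = (\<Sum>k\<le>n. tens (e (Suc n) k) (q ^ k *\<^sub>C (u n k j * z)))"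
    by (simp add: sum_distrib_right tens_simps e_mult)
  also have "\<dots> = (\<Sum>k\<le>Suc n. tens (e (Suc n) k) (q ^ k *\<^sub>C (u n k j * z)))"
    using u_eq_0[OF assms] by (simp add: tens_zero)
  finally have 1: "(\<Sum>k\<le>n. tens (e n k) (u n k j)) * tens a z = \<dots>" .
  have 2: "(\<Sum>k\<le>n. tens (e n k) (u n k j)) * tens b w = (\<Sum>k\<le>Suc n. tens (e (Suc n) k) (u_pred n k j * w))"
    by (subst sum.atMost_Suc_shift) (simp add: sum_distrib_right tens_simps e_mult tens_zero)
  show ?thesis
    by (simp add: distrib_left 1 2 tens_simps(2) sum.distrib)
qed

text \<open>Apply \<Delta> to \<open>e n j * a\<close> and compare coefficients;
  \<open>q ^ j\<close> on the left comes from moving \<open>a\<close> past \<open>b ^ j\<close>.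
  Rows beyond n+1 are included, where both sides vanish, so that later inductions need no bound on
  \<open>k\<close>.\<close>

lemma u_Suc_a:
  assumes "j \<le> n"
  shows "q ^ j *\<^sub>C u (Suc n) k j = q ^ k *\<^sub>C (u n k j * a) + u_pred n k j * c"
proof (cases "k \<le> Suc n")
  case True
  have "(\<Sum>k\<le>Suc n. tens (e (Suc n) k) (q ^ j *\<^sub>C u (Suc n) k j)) = q ^ j *\<^sub>C \<Delta> (e (Suc n) j)"
    using assms by (subst Delta_e) (simp_all add: tens_simps complex_vector.scale_sum_right scaleC_add_right del: sum.atMost_Suc)
  also have "\<dots> = \<Delta> (e n j) * \<Delta> a"
    using assms by (simp add: e_mult flip: Delta_simps)
  also have "\<dots> = (\<Sum>k\<le>Suc n. tens (e (Suc n) k) (q ^ k *\<^sub>C (u n k j * a) + u_pred n k j * c))"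
    unfolding Delta_e[OF assms] Delta_gens by (rule sum_tens_e_shift) fact
  finally show ?thesis
    by (rule tens_e_eqD) fact
next
  case False
  then show ?thesis
    using assms u_eq_0[of j n k] u_eq_0[of j "Suc n" k] u_eq_0[of j n "k - 1"]
    by (cases k) auto
qed

lemma u_Suc_b:
  assumes "j \<le> n"
  shows "u (Suc n) k (Suc j) = q ^ k *\<^sub>C (u n k j * b) + u_pred n k j * d"
proof (cases "k \<le> Suc n")
  case True
  have "(\<Sum>k\<le>Suc n. tens (e (Suc n) k) (u (Suc n) k (Suc j))) = \<Delta> (e (Suc n) (Suc j))"
    using assms by (subst Delta_e) simp_all
  also have "\<dots> = \<Delta> (e n j) * \<Delta> b"
    by (simp add: e_mult flip: Delta_simps)
  also have "\<dots> = (\<Sum>k\<le>Suc n. tens (e (Suc n) k) (q ^ k *\<^sub>C (u n k j * b) + u_pred n k j * d))"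
    unfolding Delta_e[OF assms] Delta_gens by (rule sum_tens_e_shift) fact
  finally show ?thesis
    by (rule tens_e_eqD) fact
next
  case False
  then show ?thesis
    using assms u_eq_0[of j n k] u_eq_0[of "Suc j" "Suc n" k] u_eq_0[of j n "k - 1"]
    by (cases k) auto
qed

end

section \<open>Weighted unitarity and the coproduct of the matrix coefficients\<close>

context uq2_rels
begin

lemma phase_cancel:
  assumes "cmod s = 1"
  shows "(s *\<^sub>C x) * star (s *\<^sub>C y) = x * star (y :: 'a)" "star (s *\<^sub>C x) * (s *\<^sub>C y) = star x * y"
proof -
  have "s * cnj s = 1"
    using assms complex_norm_square[of s] by simp
  then show "(s *\<^sub>C x) * star (s *\<^sub>C y) = x * star y" "star (s *\<^sub>C x) * (s *\<^sub>C y) = star x * y"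
    by (simp_all add: star_scaleC mult_scaleC_left mult_scaleC_right scaleC_scaleC
        complex_vector.scale_one mult.commute)
qed

text \<open>The generators meet in the middle of each product, where unitarity of (a b; c d) removes
  them before any summation over columns.\<close>

lemma T_row_product:
  "(s *\<^sub>C (U * a) + V * c) * star (s' *\<^sub>C (U' * a) + V' * c)
   + (s *\<^sub>C (U * b) + V * d) * star (s' *\<^sub>C (U' * b) + V' * d)
   = (s * cnj s') *\<^sub>C (U * star U') + V * star V'"
proof -
  have "(s *\<^sub>C (U * a) + V * c) * star (s' *\<^sub>C (U' * a) + V' * c)
     + (s *\<^sub>C (U * b) + V * d) * star (s' *\<^sub>C (U' * b) + V' * d)
     = (s * cnj s') *\<^sub>C (U * (a * star a + b * star b) * star U')
       + s *\<^sub>C (U * (a * star c + b * star d) * star V')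
       + cnj s' *\<^sub>C (V * (c * star a + d * star b) * star U')
       + V * (c * star c + d * star d) * star V'"
    by (simp add: star_add star_scaleC star_mult distrib_left distrib_right scaleC_simps mult.assoc
        add_ac mult.commute[of "cnj s'" s])
  then show ?thesis
    by (simp add: T_unitary)
qed

text \<open>Here the generators stand outside and do not meet. The inner products must first be
  summed over the columns, via \<open>sum_sandwich\<close>, to become scalars.\<close>

lemma T_column_product:
  "star (s *\<^sub>C (U * a) + V * c) * (s' *\<^sub>C (U' * a) + V' * c)
   + star (s *\<^sub>C (U * b) + V * d) * (s' *\<^sub>C (U' * b) + V' * d)
   = (cnj s * s') *\<^sub>C (star a * (star U * U') * a + star b * (star U * U') * b)
     + cnj s *\<^sub>C (star a * (star U * V') * c + star b * (star U * V') * d)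
     + s' *\<^sub>C (star c * (star V * U') * a + star d * (star V * U') * b)
     + (star c * (star V * V') * c + star d * (star V * V') * d)"
  by (simp add: star_add star_scaleC star_mult distrib_left distrib_right scaleC_simps mult.assoc
      add_ac mult.commute[of s' "cnj s"])

lemma T_conj_unitary_scaled:
  "star a * (s *\<^sub>C 1) * a + star b * (s *\<^sub>C 1) * b = s *\<^sub>C 1"
  "star a * (s *\<^sub>C 1) * c + star b * (s *\<^sub>C 1) * d = 0"
  "star c * (s *\<^sub>C 1) * a + star d * (s *\<^sub>C 1) * b = 0"
  "star c * (s *\<^sub>C 1) * c + star d * (s *\<^sub>C 1) * d = s *\<^sub>C 1"
  using T_conj_unitary by (simp_all add: mult_scaleC_left mult_scaleC_right flip: scaleC_add_right)

lemma sum_sandwich: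
  "(\<Sum>j\<in>I. w j *\<^sub>C (x * f j * y)) = x * (\<Sum>j\<in>I. w j *\<^sub>C f j) * (y :: 'a)"
  by (simp add: sum_distrib_left sum_distrib_right mult_scaleC_left mult_scaleC_right)

end

context uq2_coproduct
begin

lemma u_0: "u 0 k 0 = (if k = 0 then 1 else 0)"
  using u_0_0_0 u_eq_0[of 0 0 k] by auto

text \<open>The binomial weights compensate for the unnormalised basis. In the induction Pascal's
  rule groups the columns in pairs, and \<open>T_row_product\<close> reduces each pair to level
  n.\<close>

lemma u_unitary:
  "(\<Sum>j\<le>n. of_nat (n choose j) *\<^sub>C (u n i j * star (u n i' j))) =
    (if i = i' then of_nat (n choose i) else 0) *\<^sub>C 1"
proof (induction n arbitrary: i i')
  case 0
  show ?case
    by (auto simp: u_0 complex_vector.scale_one)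
next
  case (Suc n)
  have "(\<Sum>j\<le>Suc n. of_nat (Suc n choose j) *\<^sub>C (u (Suc n) i j * star (u (Suc n) i' j)))
    = (\<Sum>j\<le>n. of_nat (n choose j) *\<^sub>C
        ((q ^ i * cnj (q ^ i')) *\<^sub>C (u n i j * star (u n i' j)) + u_pred n i j * star (u_pred n i' j)))"
    unfolding sum_binomial_Suc
  proof (intro sum.cong refl arg_cong2[of _ _ _ _ scaleC])
    fix j assume "j \<in> {..n}"
    then have j: "j \<le> n" by simp
    \<comment> \<open>Both factors get the same phase \<open>q ^ j\<close>, which cancels since |q|
      = 1, so that \<open>u_Suc_a\<close> applies.\<close>
    have "u (Suc n) i j * star (u (Suc n) i' j) = (q ^ j *\<^sub>C u (Suc n) i j) * star (q ^ j *\<^sub>C u (Suc n) i' j)"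
      by (rule phase_cancel(1)[symmetric]) (simp add: norm_power norm_q)
    then show "u (Suc n) i j * star (u (Suc n) i' j) + u (Suc n) i (Suc j) * star (u (Suc n) i' (Suc j)) =
      (q ^ i * cnj (q ^ i')) *\<^sub>C (u n i j * star (u n i' j)) + u_pred n i j * star (u_pred n i' j)"
      unfolding u_Suc_a[OF j] u_Suc_b[OF j] by (simp only: T_row_product)
  qed
  also have "\<dots> = (q ^ i * cnj (q ^ i')) *\<^sub>C (\<Sum>j\<le>n. of_nat (n choose j) *\<^sub>C (u n i j * star (u n i' j)))
      + (\<Sum>j\<le>n. of_nat (n choose j) *\<^sub>C (u_pred n i j * star (u_pred n i' j)))"
    by (simp add: scaleC_add_right sum.distrib complex_vector.scale_sum_right scaleC_scaleC mult.commute)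
  also have "\<dots> = (if i = i' then of_nat (Suc n choose i) else 0) *\<^sub>C 1"
  proof -
    have "q ^ i * cnj (q ^ i) = 1"
      by (simp add: cnj_q power_inverse)
    then show ?thesis
      by (cases i; cases i') (auto simp: Suc scaleC_scaleC complex_vector.scale_one scaleC_add_left add_ac)
  qed
  finally show ?case .
qed

text \<open>Unitarity of the entrywise adjoint matrix, without any deformation weights. It fixes the
  constant in the orthogonality relations, whereas \<open>u_unitary\<close> produces the
  intertwiner.\<close>

lemma u_conj_unitary:
  "(\<Sum>j\<le>n. of_nat (n choose j) *\<^sub>C (star (u n i j) * u n i' j)) =
    (if i = i' then of_nat (n choose i) else 0) *\<^sub>C 1"
proof (induction n arbitrary: i i')
  case 0
  show ?case
    by (auto simp: u_0 complex_vector.scale_one)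
next
  case (Suc n)
  define M where "M f g = (\<Sum>j\<le>n. of_nat (n choose j) *\<^sub>C (star (f j) * g j))" for f g :: "nat \<Rightarrow> 'a"
  let ?s = "q ^ i" and ?s' = "q ^ i'" and ?U = "u n i" and ?V = "u_pred n i" and ?U' = "u n i'" and ?V' = "u_pred n i'"
  have "(\<Sum>j\<le>Suc n. of_nat (Suc n choose j) *\<^sub>C (star (u (Suc n) i j) * u (Suc n) i' j))
    = (\<Sum>j\<le>n. of_nat (n choose j) *\<^sub>C
        (star (?s *\<^sub>C (?U j * a) + ?V j * c) * (?s' *\<^sub>C (?U' j * a) + ?V' j * c)
         + star (?s *\<^sub>C (?U j * b) + ?V j * d) * (?s' *\<^sub>C (?U' j * b) + ?V' j * d)))"
    unfolding sum_binomial_Suc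
  proof (intro sum.cong refl arg_cong2[of _ _ _ _ scaleC])
    fix j assume "j \<in> {..n}"
    then have j: "j \<le> n" by simp
    have "star (u (Suc n) i j) * u (Suc n) i' j = star (q ^ j *\<^sub>C u (Suc n) i j) * (q ^ j *\<^sub>C u (Suc n) i' j)"
      by (rule phase_cancel(2)[symmetric]) (simp add: norm_power norm_q)
    then show "star (u (Suc n) i j) * u (Suc n) i' j + star (u (Suc n) i (Suc j)) * u (Suc n) i' (Suc j) =
      star (?s *\<^sub>C (?U j * a) + ?V j * c) * (?s' *\<^sub>C (?U' j * a) + ?V' j * c)
         + star (?s *\<^sub>C (?U j * b) + ?V j * d) * (?s' *\<^sub>C (?U' j * b) + ?V' j * d)"
      unfolding u_Suc_a[OF j] u_Suc_b[OF j] by simp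
  qed
  also have "\<dots> = (\<Sum>j\<le>n. of_nat (n choose j) *\<^sub>C
     ((cnj ?s * ?s') *\<^sub>C (star a * (star (?U j) * ?U' j) * a + star b * (star (?U j) * ?U' j) * b)
     + cnj ?s *\<^sub>C (star a * (star (?U j) * ?V' j) * c + star b * (star (?U j) * ?V' j) * d)
     + ?s' *\<^sub>C (star c * (star (?V j) * ?U' j) * a + star d * (star (?V j) * ?U' j) * b)
     + (star c * (star (?V j) * ?V' j) * c + star d * (star (?V j) * ?V' j) * d)))"
    by (simp only: T_column_product)
  also have "\<dots> = (cnj ?s * ?s') *\<^sub>C (star a * M ?U ?U' * a + star b * M ?U ?U' * b)
     + cnj ?s *\<^sub>C (star a * M ?U ?V' * c + star b * M ?U ?V' * d)
     + ?s' *\<^sub>C (star c * M ?V ?U' * a + star d * M ?V ?U' * b)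
     + (star c * M ?V ?V' * c + star d * M ?V ?V' * d)"
    unfolding M_def sum_sandwich[symmetric]
    by (simp add: scaleC_add_right sum.distrib complex_vector.scale_sum_right scaleC_scaleC mult.commute
        mult.left_commute)
  also have "\<dots> = (if i = i' then of_nat (Suc n choose i) else 0) *\<^sub>C 1"
  proof -
    have 1: "M (u n i) (u n i') = (if i = i' then of_nat (n choose i) else 0) *\<^sub>C 1" for i i'
      unfolding M_def by (rule Suc.IH)
    have 2: "M (\<lambda>_. 0) f = 0 *\<^sub>C 1" "M f (\<lambda>_. 0) = 0 *\<^sub>C 1" for f
      by (simp_all add: M_def)
    have 3: "u_pred n 0 = (\<lambda>_. 0)" "u_pred n (Suc k) = u n k" for k
      by (simp_all add: fun_eq_iff)
    have "cnj (q ^ i) * q ^ i = 1"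
      by (simp add: cnj_q power_inverse)
    then show ?thesis
      by (cases i; cases i')
        (auto simp only: 1 2 3 T_conj_unitary_scaled scaleC_scaleC complex_vector.scale_one,
          auto simp: scaleC_add_left complex_vector.scale_one scaleC_scaleC add_ac)
  qed
  finally show ?case .
qed

text \<open>Derived from the recursions by induction, so that no triple tensor product and no
  coassociativity enter.\<close>

lemma Delta_u:
  assumes "j \<le> n"
  shows "\<Delta> (u n k j) = (\<Sum>r\<le>n. tens (u n k r) (u n r j))"
  using assms
proof (induction n arbitrary: k j)
  case 0
  then show ?case
    by (simp add: u_0 Delta_simps Delta_zero tens_simps tens_zero)
next
  case (Suc n)
  \<comment> \<open>With \<open>z\<close>, \<open>w\<close> equal to \<open>a\<close>,
    \<open>c\<close> or to \<open>b\<close>, \<open>d\<close>, the two tensors become the coproducts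
    of \<open>a\<close> and \<open>c\<close>, or of \<open>b\<close> and \<open>d\<close>.\<close>
  have step: "q ^ k *\<^sub>C (\<Delta> (u n k j) * (tens a z + tens b w)) + \<Delta> (u_pred n k j) * (tens c z + tens d w)
    = (\<Sum>r\<le>Suc n. tens (u (Suc n) k r) (q ^ r *\<^sub>C (u n r j * z) + u_pred n r j * w))"
    if j: "j \<le> n" for j z w
  proof -
    have pred: "\<Delta> (u_pred n k j) = (\<Sum>r\<le>n. tens (u_pred n k r) (u n r j))"
      using Suc.IH[OF j] by (cases k) (simp_all add: Delta_zero tens_zero)
    have "q ^ k *\<^sub>C (\<Delta> (u n k j) * (tens a z + tens b w)) + \<Delta> (u_pred n k j) * (tens c z + tens d w)
      = (\<Sum>r\<le>n. tens (q ^ k *\<^sub>C (u n k r * a) + u_pred n k r * c) (u n r j * z))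
        + (\<Sum>r\<le>n. tens (q ^ k *\<^sub>C (u n k r * b) + u_pred n k r * d) (u n r j * w))"
      unfolding pred Suc.IH[OF j]
      by (simp add: sum_distrib_right tens_simps distrib_left complex_vector.scale_sum_right
          scaleC_add_right sum.distrib add_ac)
    also have "(\<Sum>r\<le>n. tens (q ^ k *\<^sub>C (u n k r * a) + u_pred n k r * c) (u n r j * z))
       = (\<Sum>r\<le>n. tens (u (Suc n) k r) (q ^ r *\<^sub>C (u n r j * z)))"
      by (intro sum.cong refl) (simp add: tens_simps(3,4) flip: u_Suc_a)
    also have "\<dots> = (\<Sum>r\<le>Suc n. tens (u (Suc n) k r) (q ^ r *\<^sub>C (u n r j * z)))"
      using u_eq_0[OF j] by (simp add: tens_zero)
    also have "(\<Sum>r\<le>n. tens (q ^ k *\<^sub>C (u n k r * b) + u_pred n k r * d) (u n r j * w))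
       = (\<Sum>r\<le>n. tens (u (Suc n) k (Suc r)) (u n r j * w))"
      by (intro sum.cong refl) (simp add: u_Suc_b)
    also have "\<dots> = (\<Sum>r\<le>Suc n. tens (u (Suc n) k r) (u_pred n r j * w))"
      by (subst sum.atMost_Suc_shift) (simp add: tens_zero)
    finally show ?thesis
      by (simp add: tens_simps(2) sum.distrib)
  qed
  show ?case
  proof (cases "j \<le> n")
    case True
    have "q ^ j *\<^sub>C \<Delta> (u (Suc n) k j) = q ^ k *\<^sub>C (\<Delta> (u n k j) * \<Delta> a) + \<Delta> (u_pred n k j) * \<Delta> c"
      using arg_cong[OF u_Suc_a[OF True], of \<Delta> k] by (simp add: Delta_simps)
    also have "\<dots> = (\<Sum>r\<le>Suc n. tens (u (Suc n) k r) (q ^ j *\<^sub>C u (Suc n) r j))"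
      unfolding Delta_gens step[OF True] by (simp only: u_Suc_a[OF True])
    also have "\<dots> = q ^ j *\<^sub>C (\<Sum>r\<le>Suc n. tens (u (Suc n) k r) (u (Suc n) r j))"
      by (simp only: tens_simps(4) complex_vector.scale_sum_right)
    finally show ?thesis
      by (simp add: complex_vector.scale_left_imp_eq)
  next
    case False
    then have j: "j = Suc n"
      using Suc.prems by simp
    have "\<Delta> (u (Suc n) k j) = q ^ k *\<^sub>C (\<Delta> (u n k n) * \<Delta> b) + \<Delta> (u_pred n k n) * \<Delta> d"
      by (simp add: j u_Suc_b Delta_simps)
    also have "\<dots> = (\<Sum>r\<le>Suc n. tens (u (Suc n) k r) (u (Suc n) r j))"
      unfolding Delta_gens step[OF order_refl] j by (simp only: u_Suc_b[OF order_refl])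
    finally show ?thesis .
  qed
qed

end

subsection \<open>Homogeneity and linear independence of the matrix coefficients\<close>

context uq2_universal
begin

definition coeff_D :: "nat \<Rightarrow> int \<Rightarrow> nat \<Rightarrow> nat \<Rightarrow> 'a" where
  "coeff_D n z k j = u n k j * unitary_power D z"

text \<open>Its first component plus the second is n - 2k, and minus the second n - 2j. For fixed
  \<open>n\<close> and \<open>z\<close> it determines \<open>k\<close> and \<open>j\<close>, but n+2
  and z-1 with k+1 and j+1 give the same value.\<close>

definition multidegree :: "nat \<Rightarrow> int \<Rightarrow> nat \<Rightarrow> nat \<Rightarrow> int \<times> int \<times> int" where
  "multidegree n z k j = (int n - int j - int k, int j - int k, int k + z)"

lemma trig_polynomial_nonzero:
  fixes \<beta> :: "nat \<Rightarrow> complex"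
  assumes "finite P" "p0 \<in> P" "\<And>p. p \<in> P \<Longrightarrow> \<beta> p \<noteq> 0" "inj_on G P" "\<And>p. p \<in> P \<Longrightarrow> G p \<le> n"
  shows "\<exists>\<theta>. (\<Sum>p\<in>P. \<beta> p * complex_of_real (cos \<theta> ^ (n - G p) * sin \<theta> ^ G p)) \<noteq> 0"
proof (rule ccontr)
  assume "\<not> ?thesis"
  then have zero: "(\<Sum>p\<in>P. \<beta> p * complex_of_real (cos \<theta> ^ (n - G p) * sin \<theta> ^ G p)) = 0" for \<theta>
    by blast
  define Q where "Q = (\<Sum>p\<in>P. monom (\<beta> p) (G p))"
  have "poly Q (complex_of_real x) = 0" for x
  proof -
    \<comment> \<open>As x runs through the reals, dividing by \<open>cos t ^ n\<close> turns the
      sum into the polynomial \<open>Q\<close> at x; a polynomial with infinitely many zeros is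
      0.\<close>
    define t where "t = arctan x"
    have cos: "cos t \<noteq> 0" and sin: "sin t = x * cos t"
      using cos_arctan_not_zero[of x] tan_arctan[of x] by (auto simp: t_def tan_def field_simps)
    have "cos t ^ (n - G p) * sin t ^ G p = cos t ^ n * x ^ G p" if "p \<in> P" for p
    proof -
      have "cos t ^ (n - G p) * cos t ^ G p = cos t ^ n"
        using assms(5)[OF that] by (simp flip: power_add)
      then show ?thesis
        by (simp add: sin power_mult_distrib)
    qed
    then have "complex_of_real (cos t ^ n) * poly Q (complex_of_real x) = 0"
      using zero[of t] by (simp add: Q_def poly_sum poly_monom sum_distrib_left mult.left_commute)
    then show ?thesis
      using cos by simp
  qed
  then have "range complex_of_real \<subseteq> {x. poly Q x = 0}"
    by auto
  moreover have "infinite (range complex_of_real)"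
    using finite_imageD[of complex_of_real UNIV] infinite_UNIV_char_0[where 'a = real]
    by (auto simp: inj_on_def)
  ultimately have "Q = 0"
    using poly_roots_finite finite_subset by blast
  moreover have "coeff Q (G p0) = (\<Sum>p\<in>P. if p = p0 then \<beta> p0 else 0)"
    unfolding Q_def coeff_sum using inj_onD[OF assms(4) _ _ assms(2)] by (intro sum.cong) auto
  ultimately show False
    using assms(1-3) by simp
qed

lemma homogeneous_coeff_D:
  assumes "k \<le> n" "j \<le> n"
  shows "homogeneous (coeff_D n z k j) (multidegree n z k j)"
proof -
  \<comment> \<open>These are the exponents of \<open>c\<close> for which neither binomial
    coefficient vanishes; the truncated difference \<open>k - j\<close> is the least of
    them.\<close>
  define P where "P = {p. p \<le> k \<and> p \<le> n - j \<and> k \<le> p + j}"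
  define s where "s p = q ^ ((j - (k - p)) * p) * of_nat ((n - j choose p) * (j choose (k - p)))" for p
  define w where "w p = a ^ (n - j - p) * c ^ p * b ^ (j - (k - p)) * d ^ (k - p) * unitary_power D z" for p
  \<comment> \<open>The number of letters \<open>b\<close> and \<open>c\<close>, hence the power of
    the sine. On \<open>P\<close> it equals 2p + j - k, so distinct terms have distinct powers and
    cannot cancel.\<close>
  define G where "G p = p + (j - (k - p))" for p
  define g where "g = multidegree n z k j"
  have P: "finite P" "k - j \<in> P"
    using assms by (auto simp: P_def)
  have s: "s p \<noteq> 0" if "p \<in> P" for p
    using that by (auto simp: P_def s_def)
  have "monomial (w p) (n - G p) (G p) g" if "p \<in> P" for p
  proof -
    have *: "(n - j - p) + (k - p) + 0 = n - G p" "p + (j - (k - p)) + 0 = G p"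
      "(int (n - j - p) - int (k - p), int (j - (k - p)) - int p, int p + int (k - p)) + (0, 0, z) = g"
      using that assms by (auto simp: P_def G_def g_def multidegree_def)
    show ?thesis
      unfolding w_def using monomial_mult[OF monomial_word monomial_unitary_power] * by metis
  qed
  then have "\<exists>\<kappa>. \<kappa> \<noteq> 0 \<and> (\<forall>\<theta>. rho \<theta> (w p) (Poly_Mapping.single 0 1) =
     Poly_Mapping.single g (\<kappa> * complex_of_real (cos \<theta> ^ (n - G p) * sin \<theta> ^ G p)))" if "p \<in> P" for p
    using that unfolding monomial_def by (metis add_0 mult.right_neutral)
  then obtain \<kappa> where \<kappa>: "\<And>p. p \<in> P \<Longrightarrow> \<kappa> p \<noteq> 0"
    "\<And>p \<theta>. p \<in> P \<Longrightarrow> rho \<theta> (w p) (Poly_Mapping.single 0 1) =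
     Poly_Mapping.single g (\<kappa> p * complex_of_real (cos \<theta> ^ (n - G p) * sin \<theta> ^ G p))"
    by metis
  have w_in_A: "w p \<in> A" for p
    unfolding w_def by (intro A_intros)
  have "coeff_D n z k j = (\<Sum>p\<le>k. s p *\<^sub>C w p)"
    by (simp add: coeff_D_def u_def s_def w_def sum_distrib_right mult_scaleC_left)
  also have "\<dots> = (\<Sum>p\<in>P. s p *\<^sub>C w p)"
    by (rule sum.mono_neutral_right) (auto simp: P_def s_def not_le binomial_eq_0)
  finally have eq: "coeff_D n z k j = \<dots>" .
  define v where "v \<theta> = (\<Sum>p\<in>P. (s p * \<kappa> p) * complex_of_real (cos \<theta> ^ (n - G p) * sin \<theta> ^ G p))" for \<theta>
  have "rho \<theta> (coeff_D n z k j) (Poly_Mapping.single 0 1) = Poly_Mapping.single g (v \<theta>)" for \<theta>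
  proof -
    have "rho \<theta> (coeff_D n z k j) (Poly_Mapping.single 0 1) = (\<Sum>p\<in>P. s p *\<^sub>C
        Poly_Mapping.single g (\<kappa> p * complex_of_real (cos \<theta> ^ (n - G p) * sin \<theta> ^ G p)))"
      unfolding eq by (subst rho_sum) (auto simp: rho_scaleC A_scaleC w_in_A \<kappa> simp del: single_one)
    also have "\<dots> = Poly_Mapping.single g (v \<theta>)"
      by (rule poly_mapping_eqI)
        (auto simp: v_def lookup_sum lookup_scaleC scaleC_complex_def lookup_single when_def mult.assoc)
    finally show ?thesis .
  qed
  moreover have "\<exists>\<theta>. v \<theta> \<noteq> 0"
    unfolding v_def
    by (rule trig_polynomial_nonzero[OF P])
      (use s \<kappa>(1) assms in \<open>auto simp: inj_on_def G_def P_def\<close>)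
  moreover have "coeff_D n z k j \<in> A"
    unfolding coeff_D_def by (intro A_intros u_in_A)
  ultimately show ?thesis
    unfolding homogeneous_def g_def by blast
qed

end


subsection \<open>Orthogonality relations\<close>

locale uq2_haar = uq2_coproduct +
  fixes h :: "'a \<Rightarrow> complex"
  assumes haar: "haar_state tens \<Delta> h"
begin

lemma h_simps: "h (x + y) = h x + h y" "h (s *\<^sub>C x) = s * h x" "h 1 = 1"
  using haar unfolding haar_state_def is_state_def by blast+

lemma h_zero: "h 0 = 0"
  using h_simps(2)[of 0 0] by simp

lemma h_sum: "h (sum f I) = (\<Sum>i\<in>I. h (f i))"
  by (induction I rule: infinite_finite_induct) (simp_all add: h_zero h_simps)

lemma h_invariant:
  assumes "\<Delta> x = (\<Sum>i\<in>I. tens (f i) (g i))"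
  shows "(\<Sum>i\<in>I. h (f i) *\<^sub>C g i) = h x *\<^sub>C 1"
proof -
  obtain L where L: "bounded_linear L" "\<And>x y. L (tens x y) = h x *\<^sub>C y" "\<And>x. L (\<Delta> x) = h x *\<^sub>C 1"
    using haar unfolding haar_state_def by blast
  interpret bounded_linear L by fact
  show ?thesis
    using L(3)[of x] unfolding assms by (simp add: sum L(2))
qed

lemma unitary_power_unitary:
  "unitary_power D z * star (unitary_power D z) = 1"
  "star (unitary_power D z) * unitary_power D z = 1"
  by (simp_all add: unitary_power_def star_power star_star D_unitary left_right_inverse_power)

lemma Delta_coeff_D:
  assumes "j \<le> n"
  shows "\<Delta> (coeff_D n z k j) = (\<Sum>r\<le>n. tens (coeff_D n z k r) (coeff_D n z r j))"
proof -
  have "\<Delta> (unitary_power D z) = tens (unitary_power D z) (unitary_power D z)"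
    by (simp add: unitary_power_def Delta_power Delta_simps Delta_gens tens_power tens_simps)
  then show ?thesis
    by (simp add: coeff_D_def Delta_simps Delta_u[OF assms] sum_distrib_right tens_simps)
qed

lemma coeff_D_unitary:
  "(\<Sum>k\<le>n. of_nat (n choose k) *\<^sub>C (coeff_D n z i k * star (coeff_D n z i' k))) =
    (if i = i' then of_nat (n choose i) else 0) *\<^sub>C 1"
proof -
  have "coeff_D n z i k * star (coeff_D n z i' k) = u n i k * star (u n i' k)" for k
  proof -
    have "coeff_D n z i k * star (coeff_D n z i' k) =
        u n i k * (unitary_power D z * star (unitary_power D z)) * star (u n i' k)"
      by (simp add: coeff_D_def star_mult mult.assoc)
    then show ?thesis
      by (simp add: unitary_power_unitary)
  qed
  then show ?thesis
    by (simp add: u_unitary)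
qed

lemma coeff_D_conj_unitary:
  "(\<Sum>k\<le>n. of_nat (n choose k) *\<^sub>C (star (coeff_D n z i k) * coeff_D n z i' k)) =
    (if i = i' then of_nat (n choose i) else 0) *\<^sub>C 1"
proof -
  have "(\<Sum>k\<le>n. of_nat (n choose k) *\<^sub>C (star (coeff_D n z i k) * coeff_D n z i' k)) =
    star (unitary_power D z) * (\<Sum>k\<le>n. of_nat (n choose k) *\<^sub>C (star (u n i k) * u n i' k)) * unitary_power D z"
    unfolding sum_sandwich[symmetric] by (simp add: coeff_D_def star_mult mult.assoc)
  then show ?thesis
    by (simp add: u_conj_unitary mult_scaleC_left mult_scaleC_right unitary_power_unitary)
qed

text \<open>The Gram matrix between row \<open>i\<close> of one corepresentation and row
  \<open>i'\<close> of another. The rows are parameters; the matrix indices are the columns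
  \<open>k\<close> and \<open>j\<close>.\<close>

definition M :: "nat \<Rightarrow> int \<Rightarrow> nat \<Rightarrow> nat \<Rightarrow> int \<Rightarrow> nat \<Rightarrow> nat \<Rightarrow> nat \<Rightarrow> complex" where
  "M n z i n' z' i' k j = h (star (coeff_D n z i k) * coeff_D n' z' i' j)"

text \<open>Invariance of \<open>h\<close> makes \<open>M n z i n' z' i'\<close> an intertwiner between the two corepresentations.\<close>

lemma M_intertwiner:
  assumes "s \<le> n" "j \<le> n'"
  shows "(\<Sum>k\<le>n. (of_nat (n choose k) * M n z i n' z' i' k j) *\<^sub>C coeff_D n z s k) =
    (\<Sum>r\<le>n'. (of_nat (n choose s) * M n z i n' z' i' s r) *\<^sub>C coeff_D n' z' r j)"
proof -
  let ?T = "coeff_D n z" and ?T' = "coeff_D n' z'" and ?M = "M n z i n' z' i'"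
  \<comment> \<open>Left invariance of \<open>h\<close> on a product of two coefficients.
    Multiplying by row \<open>s\<close> and summing with weights then removes the adjoint through
    \<open>coeff_D_unitary\<close>.\<close>
  have inv: "?M k j *\<^sub>C 1 = (\<Sum>p\<le>n. \<Sum>r\<le>n'. ?M p r *\<^sub>C (star (?T p k) * ?T' r j))" if "k \<le> n" for k
  proof -
    have "\<Delta> (star (?T i k) * ?T' i' j) =
        (\<Sum>(p, r)\<in>{..n} \<times> {..n'}. tens (star (?T i p) * ?T' i' r) (star (?T p k) * ?T' r j))"
      using that assms(2)
      by (simp add: Delta_simps Delta_coeff_D star_sum sum_product tens_simps sum.cartesian_product)
    then have "(\<Sum>(p, r)\<in>{..n} \<times> {..n'}. h (star (?T i p) * ?T' i' r) *\<^sub>C (star (?T p k) * ?T' r j))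
        = h (star (?T i k) * ?T' i' j) *\<^sub>C 1"
      using h_invariant[where f = "\<lambda>(p, r). star (?T i p) * ?T' i' r"
          and g = "\<lambda>(p, r). star (?T p k) * ?T' r j"]
      by (simp add: case_prod_beta)
    then show ?thesis
      by (simp add: M_def sum.cartesian_product)
  qed
  have "(\<Sum>k\<le>n. (of_nat (n choose k) * ?M k j) *\<^sub>C ?T s k)
      = (\<Sum>k\<le>n. of_nat (n choose k) *\<^sub>C (?T s k * (?M k j *\<^sub>C 1)))"
    by (simp add: mult_scaleC_right scaleC_scaleC)
  also have "\<dots> = (\<Sum>k\<le>n. \<Sum>p\<le>n. \<Sum>r\<le>n'. ?M p r *\<^sub>C (of_nat (n choose k) *\<^sub>C (?T s k * star (?T p k))) * ?T' r j)"
    by (simp add: inv sum_distrib_left mult_scaleC_left mult_scaleC_right scaleC_scaleC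
        complex_vector.scale_sum_right mult.assoc mult.commute[of "of_nat _"])
  also have "\<dots> = (\<Sum>p\<le>n. \<Sum>r\<le>n'. \<Sum>k\<le>n. ?M p r *\<^sub>C (of_nat (n choose k) *\<^sub>C (?T s k * star (?T p k))) * ?T' r j)"
    by (rule trans[OF sum.swap]) (intro sum.cong refl sum.swap)
  also have "\<dots> = (\<Sum>p\<le>n. \<Sum>r\<le>n'. ?M p r *\<^sub>C (\<Sum>k\<le>n. of_nat (n choose k) *\<^sub>C (?T s k * star (?T p k))) * ?T' r j)"
    by (simp add: sum_distrib_right complex_vector.scale_sum_right)
  also have "\<dots> = (\<Sum>p\<le>n. if p = s then \<Sum>r\<le>n'. (of_nat (n choose s) * ?M s r) *\<^sub>C ?T' r j else 0)"
    unfolding coeff_D_unitary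
    by (intro sum.cong refl) (auto simp: mult_scaleC_left scaleC_scaleC mult.commute)
  also have "\<dots> = (\<Sum>r\<le>n'. (of_nat (n choose s) * ?M s r) *\<^sub>C ?T' r j)"
    using assms(1) by simp
  finally show ?thesis .
qed

text \<open>\<open>M_intertwiner\<close> is a linear relation between row \<open>s\<close> of one
  corepresentation and column \<open>j\<close> of the other. If no degree occurs in both, all its
  coefficients vanish.\<close>

lemma M_eq_0:
  assumes "s \<le> n" "j \<le> n'"
    and disj: "\<And>k r. k \<le> n \<Longrightarrow> r \<le> n' \<Longrightarrow> multidegree n z s k \<noteq> multidegree n' z' r j"
  shows "k \<le> n \<Longrightarrow> M n z i n' z' i' k j = 0" "r \<le> n' \<Longrightarrow> M n z i n' z' i' s r = 0"
proof -
  let ?I = "{..n} <+> {..n'}"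
  let ?y = "case_sum (\<lambda>k. of_nat (n choose k) * M n z i n' z' i' k j) (\<lambda>r. - (of_nat (n choose s) * M n z i n' z' i' s r))"
  let ?x = "case_sum (coeff_D n z s) (\<lambda>r. coeff_D n' z' r j)"
  let ?g = "case_sum (multidegree n z s) (\<lambda>r. multidegree n' z' r j)"
  have y: "?y l = 0" if l: "l \<in> ?I" for l
  proof (rule homogeneous_independent[of ?I ?x ?g ?y, OF _ _ _ _ l])
    show "inj_on ?g ?I"
      using disj by (auto simp: inj_on_def multidegree_def) metis+
    show "(\<Sum>l\<in>?I. ?y l *\<^sub>C ?x l) = 0"
      using M_intertwiner[OF assms(1,2), of z i z' i'] by (simp add: sum.Plus sum_negf)
  qed (use assms in \<open>auto intro!: homogeneous_coeff_D\<close>)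
  show "M n z i n' z' i' k j = 0" if "k \<le> n"
    using y[of "Inl k"] that by auto
  show "M n z i n' z' i' s r = 0" if "r \<le> n'"
    using y[of "Inr r"] that assms(1) by auto
qed

lemma M_distinct:
  assumes "(n, z) \<noteq> (n', z')" "k \<le> n" "j \<le> n'"
  shows "M n z i n' z' i' k j = 0"
proof (cases "n < n'")
  case True
  show ?thesis
    \<comment> \<open>First minus second component of the degree is \<open>n'\<close> throughout
      column 0 of the larger corepresentation, but at most \<open>n\<close> in any row of the
      smaller one.\<close>
    by (rule M_eq_0(2)[of k n 0]) (use True assms in \<open>auto simp: multidegree_def\<close>)
next
  case False
  show ?thesis
    \<comment> \<open>First plus second component is \<open>n\<close> throughout row 0 and n' - 2r
      in column \<open>j\<close>. As \<open>n' \<le> n\<close>, a coincidence forces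
      \<open>n = n'\<close> and \<open>r = 0\<close>, and then the third component gives
      \<open>z = z'\<close>.\<close>
    by (rule M_eq_0(1)[of 0 n j]) (use False assms in \<open>auto simp: multidegree_def\<close>)
qed

text \<open>Schur's lemma for one corepresentation: row \<open>s\<close> and column \<open>j\<close>
  share only the coefficient at position (s, j), so the relation kills all other coefficients and
  equates the two weighted diagonal entries.\<close>

lemma M_same:
  assumes "s \<le> n" "j \<le> n"
  shows "k \<le> n \<Longrightarrow> k \<noteq> j \<Longrightarrow> M n z i n z i' k j = 0"
    and "of_nat (n choose j) * M n z i n z i' j j = of_nat (n choose s) * M n z i n z i' s s"
proof -
  let ?M = "M n z i n z i'"
  \<comment> \<open>The shared coefficient is kept in the first family only; its contribution from
    the second is the correction at \<open>k = j\<close> in \<open>?y\<close>.\<close>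
  let ?I = "{..n} <+> ({..n} - {s})"
  let ?y = "case_sum (\<lambda>k. of_nat (n choose k) * ?M k j - (if k = j then of_nat (n choose s) * ?M s s else 0))
      (\<lambda>r. - (of_nat (n choose s) * ?M s r))"
  let ?x = "case_sum (coeff_D n z s) (\<lambda>r. coeff_D n z r j)"
  let ?g = "case_sum (multidegree n z s) (\<lambda>r. multidegree n z r j)"
  have y: "?y l = 0" if l: "l \<in> ?I" for l
  proof (rule homogeneous_independent[of ?I ?x ?g ?y, OF _ _ _ _ l])
    show "inj_on ?g ?I"
      by (auto simp: inj_on_def multidegree_def)
    have "(\<Sum>l\<in>?I. ?y l *\<^sub>C ?x l) = (\<Sum>k\<le>n. (of_nat (n choose k) * ?M k j) *\<^sub>C coeff_D n z s k)
        - (\<Sum>k\<le>n. if k = j then (of_nat (n choose s) * ?M s s) *\<^sub>C coeff_D n z s j else 0)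
        - (\<Sum>r\<in>{..n} - {s}. (of_nat (n choose s) * ?M s r) *\<^sub>C coeff_D n z r j)"
      unfolding sum_subtractf[symmetric]
      by (subst sum.Plus) (auto simp: sum_negf complex_vector.scale_left_diff_distrib intro!: sum.cong)
    also have "\<dots> = (\<Sum>k\<le>n. (of_nat (n choose k) * ?M k j) *\<^sub>C coeff_D n z s k)
        - (\<Sum>r\<le>n. (of_nat (n choose s) * ?M s r) *\<^sub>C coeff_D n z r j)"
      using assms by (simp add: sum.remove[of "{..n}" s])
    also have "\<dots> = 0"
      using M_intertwiner[OF assms, of z i z i'] by simp
    finally show "(\<Sum>l\<in>?I. ?y l *\<^sub>C ?x l) = 0" .
  qed (use assms in \<open>auto intro!: homogeneous_coeff_D\<close>)
  show "?M k j = 0" if "k \<le> n" "k \<noteq> j"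
    using y[of "Inl k"] that by auto
  show "of_nat (n choose j) * ?M j j = of_nat (n choose s) * ?M s s"
    using y[of "Inl j"] assms by auto
qed

text \<open>The n+1 weighted diagonal entries of \<open>M\<close> are equal, and
  \<open>coeff_D_conj_unitary\<close> evaluates their sum; dividing by n+1 gives the
  constant.\<close>

lemma coeff_D_orthogonal:
  assumes "i \<le> n" "k \<le> n" "i' \<le> n'" "j \<le> n'"
  shows "h (star (coeff_D n z i k) * coeff_D n' z' i' j) =
    (if n = n' \<and> z = z' \<and> i = i' \<and> k = j
     then of_nat (n choose i) / (of_nat (n choose k) * (of_nat n + 1)) else 0)"
proof (cases "(n, z) = (n', z') \<and> k = j")
  case True
  have "(of_nat n + 1) * (of_nat (n choose k) * M n z i n z i' k k) =
      (\<Sum>s\<le>n. of_nat (n choose s) * M n z i n z i' s s)"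
  proof -
    have "(\<Sum>s\<le>n. of_nat (n choose s) * M n z i n z i' s s)
        = (\<Sum>s\<le>n. of_nat (n choose k) * M n z i n z i' k k)"
      using M_same(2)[OF _ assms(2), of _ z i i'] by (intro sum.cong) simp_all
    then show ?thesis
      by (simp add: algebra_simps)
  qed
  also have "\<dots> = h (\<Sum>s\<le>n. of_nat (n choose s) *\<^sub>C (star (coeff_D n z i s) * coeff_D n z i' s))"
    by (simp add: h_sum h_simps M_def)
  also have "\<dots> = (if i = i' then of_nat (n choose i) else 0)"
    by (simp add: coeff_D_conj_unitary h_simps)
  finally have *: "M n z i n z i' k k * (of_nat (n choose k) * (of_nat n + 1)) = \<dots>"
    by (simp add: mult_ac)
  have "of_nat (n choose k) * (of_nat n + 1) \<noteq> (0 :: complex)"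
    using assms(2) by (simp flip: of_nat_Suc add: add.commute)
  then have "M n z i n z i' k k = (if i = i' then of_nat (n choose i) else 0) / (of_nat (n choose k) * (of_nat n + 1))"
    using * by (simp only: nonzero_eq_divide_eq not_False_eq_True)
  then show ?thesis
    using True by (auto simp: M_def)
next
  case False
  then have "M n z i n' z' i' k j = 0"
  proof (cases "(n, z) = (n', z')")
    case True
    then show ?thesis
      using False M_same(1)[of n n j k z i i'] assms by simp
  next
    case False
    then show ?thesis
      using M_distinct assms by blast
  qed
  then show ?thesis
    using False by (auto simp: M_def)
qed

end

subsection \<open>Spanning\<close>

text \<open>The entries in the first and in the last column satisfy the recursion assumed here.\<close>

lemma edge_relation:
  fixes v :: "nat \<Rightarrow> nat \<Rightarrow> 'a::unital_cstar_algebra" and q :: complex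
  defines "vp \<equiv> \<lambda>n k. case k of 0 \<Rightarrow> 0 | Suc k' \<Rightarrow> v n k'"
  assumes q: "q \<noteq> 0" and yx: "y * x = inverse q *\<^sub>C (x * y)"
    and v_Suc: "\<And>n k. v (Suc n) k = q ^ k *\<^sub>C (v n k * x) + vp n k * y"
    and v_0: "\<And>k. 0 < k \<Longrightarrow> v 0 k = 0"
  shows "of_nat k *\<^sub>C (v n k * x) = ((of_nat n + 1 - of_nat k) * inverse q ^ k) *\<^sub>C (vp n k * y)"
proof (induction n arbitrary: k)
  case 0
  show ?case
  proof (cases k)
    case (Suc k')
    then show ?thesis
      using v_0 by (cases k') (simp_all add: vp_def)
  qed (simp add: vp_def)
next
  case (Suc n)
  show ?case
  proof (cases k)
    case (Suc l)
    \<comment> \<open>Both sides reduce to (n+1)/q times \<open>?Z\<close>, using the induction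
      hypothesis at \<open>k\<close> on the left and, read backwards, at \<open>l = k - 1\<close> on
      the right.\<close>
    let ?Z = "v n l * (x * y)"
    have vpk: "vp n k = v n l"
      by (simp add: Suc vp_def)
    have yx': "w * y * x = inverse q *\<^sub>C (w * (x * y))" for w
      by (simp add: mult.assoc yx mult_scaleC_right)
    have "of_nat k *\<^sub>C (v (Suc n) k * x)
        = q ^ k *\<^sub>C ((of_nat k *\<^sub>C (v n k * x)) * x) + of_nat k *\<^sub>C (v n l * y * x)"
      unfolding v_Suc vpk by (simp add: distrib_right scaleC_add_right mult_scaleC_left scaleC_scaleC mult.commute)
    also have "\<dots> = (q ^ k * ((of_nat n + 1 - of_nat k) * inverse q ^ k) * inverse q + of_nat k * inverse q) *\<^sub>C ?Z"
      unfolding Suc.IH vpk by (simp add: mult_scaleC_left yx' scaleC_scaleC scaleC_add_left)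
    also have "q ^ k * ((of_nat n + 1 - of_nat k) * inverse q ^ k) * inverse q + of_nat k * inverse q
        = (of_nat n + 1) * inverse q"
      using q by (simp add: field_simps)
    finally have lhs: "of_nat k *\<^sub>C (v (Suc n) k * x) = ((of_nat n + 1) * inverse q) *\<^sub>C ?Z" .
    have co: "of_nat (Suc n) + 1 - of_nat k = (of_nat n + 1 - of_nat l :: complex)"
      by (simp add: Suc)
    have "((of_nat (Suc n) + 1 - of_nat k) * inverse q ^ k) *\<^sub>C (v (Suc n) l * y)
        = ((of_nat n + 1 - of_nat l) * inverse q ^ k * q ^ l) *\<^sub>C ?Z
          + (inverse q) *\<^sub>C ((((of_nat n + 1 - of_nat l) * inverse q ^ l) *\<^sub>C (vp n l * y)) * y)"
      unfolding v_Suc co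
      by (simp add: Suc distrib_right scaleC_add_right mult_scaleC_left scaleC_scaleC mult_ac)
    also have "\<dots> = ((of_nat n + 1 - of_nat l) * inverse q ^ k * q ^ l + inverse q * of_nat l) *\<^sub>C ?Z"
      unfolding Suc.IH[symmetric] by (simp add: mult_scaleC_left scaleC_scaleC scaleC_add_left mult.assoc)
    also have "(of_nat n + 1 - of_nat l) * inverse q ^ k * q ^ l + inverse q * of_nat l = (of_nat n + 1) * inverse q"
      using q by (simp add: Suc field_simps)
    finally show ?thesis
      using lhs by (simp add: Suc vp_def)
  qed (simp add: vp_def)
qed

section \<open>Relations of Clebsch-Gordan type\<close>

context uq2_coproduct
begin

definition u_pred2 :: "nat \<Rightarrow> nat \<Rightarrow> nat \<Rightarrow> 'a" where
  "u_pred2 n k j = (case n of 0 \<Rightarrow> 0 | Suc n' \<Rightarrow> case j of 0 \<Rightarrow> 0 | Suc j' \<Rightarrow> u_pred n' k j')"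

lemma u_pred2_simps [simp]: "u_pred2 n k 0 = 0" "u_pred2 (Suc n) k (Suc j) = u_pred n k j"
  by (simp_all add: u_pred2_def split: nat.split)

lemma u_first_column:
  "of_nat k *\<^sub>C (u n k 0 * a) = ((of_nat n + 1 - of_nat k) * inverse q ^ k) *\<^sub>C (u_pred n k 0 * c)"
  unfolding u_pred_def
  by (rule edge_relation) (use u_Suc_a[of 0] in \<open>simp_all add: cd_rels u_0 complex_vector.scale_one u_pred_def\<close>)

lemma u_last_column:
  "of_nat k *\<^sub>C (u n k n * b) = ((of_nat n + 1 - of_nat k) * inverse q ^ k) *\<^sub>C (u_pred n k n * d)"
  unfolding u_pred_def
  by (rule edge_relation[where v = "\<lambda>n k. u n k n"])
    (simp_all add: cd_rels u_0 u_Suc_b u_pred_def)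

text \<open>Expand both terms by the recursions for column \<open>j\<close>: the parts with
  \<open>a * b\<close> cancel, and \<open>a * d - q *\<^sub>C (c * b)\<close> is the determinant
  \<open>D\<close>.\<close>

lemma u_pred_D:
  assumes "j \<le> n"
  shows "u_pred n k j * D = u (Suc n) k (Suc j) * a - q ^ Suc j *\<^sub>C (u (Suc n) k j * b)"
proof -
  have "q ^ Suc j *\<^sub>C (u (Suc n) k j * b) = q *\<^sub>C ((q ^ j *\<^sub>C u (Suc n) k j) * b)"
    by (simp add: mult_scaleC_left scaleC_scaleC)
  also have "\<dots> = q ^ k *\<^sub>C (u n k j * (q *\<^sub>C (a * b))) + u_pred n k j * (q *\<^sub>C (c * b))"
    unfolding u_Suc_a[OF assms]
    by (simp add: distrib_right scaleC_add_right mult_scaleC_left mult_scaleC_right scaleC_scaleC mult.assoc mult.commute)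
  finally have 1: "q ^ Suc j *\<^sub>C (u (Suc n) k j * b) = \<dots>" .
  have 2: "u (Suc n) k (Suc j) * a = q ^ k *\<^sub>C (u n k j * (q *\<^sub>C (a * b))) + u_pred n k j * (a * d)"
    unfolding u_Suc_b[OF assms] by (simp add: distrib_right mult_scaleC_left mult.assoc cd_rels reorder(1))
  have "u_pred n k j * D = u_pred n k j * (a * d) - u_pred n k j * (q *\<^sub>C (c * b))"
    by (simp add: cd_rels(6) flip: right_diff_distrib)
  then show ?thesis
    unfolding 1 2 by simp
qed

text \<open>Together with \<open>u_Suc_a\<close> this yields the Clebsch-Gordan decomposition of \<open>u n k j * a\<close>.\<close>

lemma u_a_relation:
  assumes "j \<le> n"
  shows "of_nat k *\<^sub>C (u n k j * a) =
    ((of_nat n + 1 - of_nat k) * inverse q ^ k) *\<^sub>C (u_pred n k j * c) + of_nat j *\<^sub>C (u_pred2 n k j * D)"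
  using assms
proof (induction n arbitrary: k j)
  case 0
  then show ?case
    using u_first_column[of k 0] by simp
next
  case (Suc m)
  show ?case
  proof (cases j)
    case 0
    then show ?thesis
      using u_first_column[of k "Suc m"] by simp
  next
    case (Suc i)
    have i: "i \<le> m" using Suc Suc.prems by simp
    show ?thesis
    proof (cases k)
      case 0
      then show ?thesis using Suc by simp
    next
      case k: (Suc l)
      let ?U = "u m l i" and ?V = "u_pred m l i" and ?W = "u_pred2 m k i" and ?W' = "u_pred2 m l i"
      have u_k: "u (Suc m) k j = q ^ k *\<^sub>C (u m k i * b) + ?U * d"
        using u_Suc_b[OF i, of k] by (simp add: Suc k)
      have u_l: "u (Suc m) l j = q ^ l *\<^sub>C (?U * b) + ?V * d"
        using u_Suc_b[OF i, of l] by (simp add: Suc)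
      have IH_k: "of_nat k *\<^sub>C (u m k i * a) = ((of_nat m + 1 - of_nat k) * inverse q ^ k) *\<^sub>C (?U * c) + of_nat i *\<^sub>C (?W * D)"
        using Suc.IH[OF i, of k] by (simp add: k)
      have IH_l: "((of_nat m + 1 - of_nat l) * inverse q ^ l) *\<^sub>C (?V * c) = of_nat l *\<^sub>C (?U * a) - of_nat i *\<^sub>C (?W' * D)"
        using Suc.IH[OF i, of l] by simp
      \<comment> \<open>This is \<open>u_Suc_b\<close> one level down, with \<open>D\<close> moved
        to the left of \<open>b\<close> and \<open>d\<close>. For \<open>i = 0\<close> there is no
        lower level, and the factor \<open>of_nat i\<close> makes both sides 0.\<close>
      have UD: "of_nat i *\<^sub>C (q ^ Suc k *\<^sub>C (?W * (D * b)) + ?W' * (D * d)) = of_nat i *\<^sub>C (?U * D)"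
      proof (cases i)
        case i': (Suc i')
        then obtain m' where m': "m = Suc m'"
          using i by (cases m) auto
        have "?U * D = q ^ l *\<^sub>C (u m' l i' * (b * D)) + u_pred m' l i' * (d * D)"
          using u_Suc_b[of i' m' l] i i' m' by (simp add: distrib_right mult_scaleC_left mult.assoc)
        also have "b * D = q\<^sup>2 *\<^sub>C (D * b)"
          by (rule gen_rels)
        also have "d * D = D * d"
          by (simp add: cd_rels)
        finally show ?thesis
          by (simp add: i' m' k mult_scaleC_right scaleC_scaleC power2_eq_square mult_ac)
      qed simp
      have "of_nat k *\<^sub>C (u (Suc m) k j * a)
          = q ^ Suc k *\<^sub>C ((of_nat k *\<^sub>C (u m k i * a)) * b) + of_nat k *\<^sub>C (?U * (a * d))"
        unfolding u_k
        by (simp add: distrib_right scaleC_add_right mult_scaleC_left mult_scaleC_right scaleC_scaleC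
            mult.assoc reorder(1) cd_rels(3))
      also have "\<dots> = (q ^ Suc k * ((of_nat m + 1 - of_nat k) * inverse q ^ k)) *\<^sub>C (?U * (c * b))
          + of_nat i *\<^sub>C (q ^ Suc k *\<^sub>C (?W * (D * b))) + of_nat k *\<^sub>C (?U * (a * d))"
        unfolding IH_k
        by (simp add: distrib_right scaleC_add_right mult_scaleC_left scaleC_scaleC mult.assoc)
      also have "q ^ Suc k * ((of_nat m + 1 - of_nat k) * inverse q ^ k) = q * (of_nat m + 1 - of_nat k)"
        by (simp add: field_simps)
      finally have lhs: "of_nat k *\<^sub>C (u (Suc m) k j * a) =
          (q * (of_nat m + 1 - of_nat k)) *\<^sub>C (?U * (c * b))
          + of_nat i *\<^sub>C (q ^ Suc k *\<^sub>C (?W * (D * b))) + of_nat k *\<^sub>C (?U * (a * d))" .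
      have co: "of_nat (Suc m) + 1 - of_nat k = (of_nat m + 1 - of_nat l :: complex)"
        by (simp add: k)
      have "((of_nat (Suc m) + 1 - of_nat k) * inverse q ^ k) *\<^sub>C (u (Suc m) l j * c)
          = ((of_nat m + 1 - of_nat l) * inverse q ^ k * q ^ l * q\<^sup>2) *\<^sub>C (?U * (c * b))
            + ((((of_nat m + 1 - of_nat l) * inverse q ^ l) *\<^sub>C (?V * c)) * d)"
        unfolding u_l co
        by (simp add: k distrib_right scaleC_add_right mult_scaleC_left mult_scaleC_right scaleC_scaleC
            mult.assoc cd_rels(4,5))
      also have "\<dots> = (q * (of_nat m + 1 - of_nat l)) *\<^sub>C (?U * (c * b))
            + of_nat l *\<^sub>C (?U * (a * d)) - of_nat i *\<^sub>C (?W' * (D * d))"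
      proof -
        have "(of_nat m + 1 - of_nat l) * inverse q ^ k * q ^ l * q\<^sup>2 = q * (of_nat m + 1 - of_nat l)"
          by (simp add: k field_simps power2_eq_square)
        then show ?thesis
          unfolding IH_l by (simp add: left_diff_distrib mult_scaleC_left mult.assoc)
      qed
      finally have rhs: "((of_nat (Suc m) + 1 - of_nat k) * inverse q ^ k) *\<^sub>C (u (Suc m) l j * c) = \<dots>" .
      have ad: "?U * (a * d) = ?U * D + q *\<^sub>C (?U * (c * b))"
      proof -
        have "a * d = D + q *\<^sub>C (c * b)"
          by (metis cd_rels(6) diff_add_cancel)
        then show ?thesis
          by (simp only: distrib_left mult_scaleC_right)
      qed
      \<comment> \<open>Once \<open>a * d\<close> is replaced, \<open>c * b\<close> carries the
        factor q(m+1) on both sides and cancels, while k - l = 1 leaves one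
        \<open>?U * D\<close>.\<close>
      have "of_nat k *\<^sub>C (u (Suc m) k j * a)
          - ((of_nat (Suc m) + 1 - of_nat k) * inverse q ^ k) *\<^sub>C (u (Suc m) l j * c)
          = ?U * D + of_nat i *\<^sub>C (q ^ Suc k *\<^sub>C (?W * (D * b)) + ?W' * (D * d))"
        unfolding lhs rhs ad
        by (simp add: k scaleC_add_right scaleC_add_left scaleC_scaleC distrib_left right_diff_distrib
            complex_vector.scale_left_diff_distrib complex_vector.scale_one mult_ac)
      also have "\<dots> = of_nat j *\<^sub>C (u_pred2 (Suc m) k j * D)"
        unfolding UD by (simp add: Suc k scaleC_add_left complex_vector.scale_one)
      finally show ?thesis
        by (simp add: k algebra_simps)
    qed
  qed
qed

section \<open>Stability of the span under right multiplication by the generators\<close>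

definition W :: "'a set" where
  "W = complex_vector.span {coeff_D n z k j | n z k j. k \<le> n \<and> j \<le> n}"

lemma W_intros:
  "x \<in> W \<Longrightarrow> y \<in> W \<Longrightarrow> x + y \<in> W" "x \<in> W \<Longrightarrow> y \<in> W \<Longrightarrow> x - y \<in> W" "x \<in> W \<Longrightarrow> s *\<^sub>C x \<in> W"
  unfolding W_def
  by (auto intro: complex_vector.span_add complex_vector.span_diff complex_vector.span_scale)

lemma W_scaleD: "s *\<^sub>C x \<in> W \<Longrightarrow> s \<noteq> 0 \<Longrightarrow> x \<in> W"
  using W_intros(3)[of "s *\<^sub>C x" "inverse s"] by (simp add: scaleC_scaleC complex_vector.scale_one)

lemma W_zero: "0 \<in> W"
  unfolding W_def by (rule complex_vector.span_zero)

lemma coeff_D_in_W: "j \<le> n \<Longrightarrow> coeff_D n z k j \<in> W"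
  by (cases "k \<le> n")
    (auto simp: W_def coeff_D_def u_eq_0 complex_vector.span_zero intro!: complex_vector.span_base)

lemma W_induct:
  assumes "x \<in> W" "\<And>n z k j. k \<le> n \<Longrightarrow> j \<le> n \<Longrightarrow> coeff_D n z k j * g \<in> W"
  shows "x * g \<in> W"
proof -
  have "complex_vector.subspace {x. x * g \<in> W}"
    by (auto simp: complex_vector.subspace_def W_zero distrib_right mult_scaleC_left intro: W_intros)
  then show ?thesis
    using complex_vector.span_induct[of x _ "\<lambda>x. x * g \<in> W"] assms unfolding W_def by blast
qed

lemma W_mult_D: "x \<in> W \<Longrightarrow> x * D \<in> W" "x \<in> W \<Longrightarrow> x * star D \<in> W"
proof -
  have "unitary_power D z * D = unitary_power D (z + 1)" for z
  proof (cases "z \<ge> 0")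
    case False
    then have "nat (- z) = Suc (nat (- (z + 1)))"
      by simp
    then show ?thesis
      using False by (simp add: unitary_power_def power_Suc2 mult.assoc D_unitary del: power_Suc)
  qed (simp add: unitary_power_def nat_add_distrib power_commutes)
  then have "coeff_D n z k j * D = coeff_D n (z + 1) k j" for n z k j
    by (simp add: coeff_D_def mult.assoc)
  then show "x \<in> W \<Longrightarrow> x * D \<in> W"
    by (erule_tac W_induct) (simp add: coeff_D_in_W)
  have "unitary_power D z * star D = unitary_power D (z - 1)" for z
  proof (cases "z > 0")
    case True
    then have "nat z = Suc (nat (z - 1))"
      by simp
    then show ?thesis
      using True by (simp add: unitary_power_def power_Suc2 mult.assoc D_unitary del: power_Suc)
  next
    case False
    then have "nat (- (z - 1)) = Suc (nat (- z))"
      by simp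
    then show ?thesis
      using False by (simp add: unitary_power_def power_Suc2 del: power_Suc)
  qed
  then have "coeff_D n z k j * star D = coeff_D n (z - 1) k j" for n z k j
    by (simp add: coeff_D_def mult.assoc)
  then show "x \<in> W \<Longrightarrow> x * star D \<in> W"
    by (erule_tac W_induct) (simp add: coeff_D_in_W)
qed

lemma W_mult_unitary_power: "x \<in> W \<Longrightarrow> x * unitary_power D z \<in> W"
proof -
  have "x \<in> W \<Longrightarrow> x * g ^ n \<in> W" if "\<And>x. x \<in> W \<Longrightarrow> x * g \<in> W" for g n and x :: 'a
    by (induction n arbitrary: x) (auto simp: that simp flip: mult.assoc)
  then show "x \<in> W \<Longrightarrow> x * unitary_power D z \<in> W"
    using W_mult_D by (auto simp: unitary_power_def)
qed

lemma u_in_W: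
  assumes "j \<le> n"
  shows "u n k j \<in> W" "u_pred n k j * D \<in> W"
proof -
  have u: "u n k j \<in> W" for k
    using coeff_D_in_W[OF assms, of 0 k] by (simp add: coeff_D_def unitary_power_def)
  then show "u n k j \<in> W" .
  show "u_pred n k j * D \<in> W"
    using u by (cases k) (auto intro: W_mult_D W_zero)
qed

text \<open>The order matters: \<open>a\<close> comes from the Clebsch-Gordan relation,
  \<open>c\<close> from the first recursion, \<open>b\<close> from the determinant identity and, in
  the last column, from the edge relation, and \<open>d\<close> from the second recursion.\<close>

lemma u_mult_in_W:
  assumes "j \<le> n"
  shows "u n k j * a \<in> W" "u n k j * b \<in> W" "u n k j * c \<in> W" "u n k j * d \<in> W"
proof -
  have n1: "of_nat n + (1 :: complex) \<noteq> 0"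
    by (simp flip: of_nat_Suc add: add.commute)
  have a: "u n k j * a \<in> W" if assms: "j \<le> n" for k j
  proof -
    \<comment> \<open>The multiple of \<open>u_Suc_a\<close> is chosen to eliminate
      \<open>u_pred n k j * c\<close> against \<open>u_a_relation\<close>; what remains on the left
      has the nonzero factor n+1.\<close>
    have "of_nat k *\<^sub>C (u n k j * a) + ((of_nat n + 1 - of_nat k) * inverse q ^ k) *\<^sub>C (q ^ k *\<^sub>C (u n k j * a))
        = (of_nat n + 1) *\<^sub>C (u n k j * a)"
      by (simp add: scaleC_scaleC flip: scaleC_add_left) (simp add: field_simps)
    then have "(of_nat n + 1) *\<^sub>C (u n k j * a) =
        ((of_nat n + 1 - of_nat k) * inverse q ^ k) *\<^sub>C (q ^ j *\<^sub>C u (Suc n) k j) + of_nat j *\<^sub>C (u_pred2 n k j * D)"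
      unfolding u_a_relation[OF assms] u_Suc_a[OF assms] by (simp add: scaleC_add_right algebra_simps)
    moreover have "u_pred2 n k j * D \<in> W"
      using assms u_in_W(2) by (cases n; cases j) (auto simp: W_zero)
    ultimately have "(of_nat n + 1) *\<^sub>C (u n k j * a) \<in> W"
      using u_in_W(1)[of j "Suc n" k] assms by (auto intro!: W_intros)
    then show ?thesis
      using n1 by (rule W_scaleD)
  qed
  have c: "u n k j * c \<in> W" for k
  proof -
    \<comment> \<open>The recursion is used in row \<open>Suc k\<close>, whose predecessor row is
      \<open>k\<close>; for \<open>k = n\<close> the subtracted term is 0.\<close>
    have "u n k j * c = q ^ j *\<^sub>C u (Suc n) (Suc k) j - q ^ Suc k *\<^sub>C (u n (Suc k) j * a)"
      using u_Suc_a[OF assms, of "Suc k"] by simp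
    then show ?thesis
      using a[OF assms] u_in_W(1)[of j "Suc n" "Suc k"] assms by (auto intro!: W_intros)
  qed
  have b: "u n k j * b \<in> W" for k
  proof (cases "j < n")
    case True
    then obtain m where m: "n = Suc m" "j \<le> m"
      by (cases n) auto
    have "u n k (Suc j) * a \<in> W"
      using True by (intro a) simp
    then have "q ^ Suc j *\<^sub>C (u n k j * b) \<in> W"
      using u_pred_D[OF m(2), of k] m u_in_W(2)[OF m(2), of k] W_intros(2) by (metis add_diff_cancel_left' diff_add_cancel)
    then show ?thesis
      by (rule W_scaleD) simp
  next
    case False
    then have j: "j = n" using assms by simp
    have "of_nat k *\<^sub>C (u n k n * b) + ((of_nat n + 1 - of_nat k) * inverse q ^ k) *\<^sub>C (q ^ k *\<^sub>C (u n k n * b))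
        = (of_nat n + 1) *\<^sub>C (u n k n * b)"
      by (simp add: scaleC_scaleC flip: scaleC_add_left) (simp add: field_simps)
    then have "(of_nat n + 1) *\<^sub>C (u n k n * b) =
        ((of_nat n + 1 - of_nat k) * inverse q ^ k) *\<^sub>C u (Suc n) k (Suc n)"
      unfolding u_last_column u_Suc_b[OF order_refl] by (simp add: scaleC_add_right algebra_simps)
    then have "(of_nat n + 1) *\<^sub>C (u n k n * b) \<in> W"
      using u_in_W(1)[of "Suc n" "Suc n" k] by (auto intro!: W_intros)
    then show ?thesis
      using n1 j W_scaleD by blast
  qed
  have "u n k j * d = u (Suc n) (Suc k) (Suc j) - q ^ Suc k *\<^sub>C (u n (Suc k) j * b)"
    using u_Suc_b[OF assms, of "Suc k"] by simp
  then show "u n k j * d \<in> W"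
    using b u_in_W(1)[of "Suc j" "Suc n" "Suc k"] assms by (auto intro!: W_intros)
  show "u n k j * a \<in> W" "u n k j * b \<in> W" "u n k j * c \<in> W"
    by (rule a[OF assms] b c)+
qed

lemma unitary_power_commute:
  assumes "x * D = s *\<^sub>C (D * x)" "s \<noteq> 0"
  shows "\<exists>\<kappa>. unitary_power D z * x = \<kappa> *\<^sub>C (x * unitary_power D z)"
proof -
  have "D * x = inverse s *\<^sub>C (x * D)"
    using assms by (simp add: scaleC_scaleC complex_vector.scale_one)
  then show ?thesis
    using power_scaleC_commute[of D x _ "nat z" 1] power_scaleC_commute[OF unitary_commute(1)[OF assms(1)], of "nat (- z)" 1]
    by (auto simp: unitary_power_def)
qed

text \<open>Powers of \<open>D\<close> commute with \<open>g\<close> up to a scalar, and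
  \<open>W\<close> is stable under right multiplication by them, so it is enough to treat the
  coefficients without \<open>D\<close>.\<close>

lemma W_mult_if:
  assumes "x \<in> W" "g * D = s *\<^sub>C (D * g)" "s \<noteq> 0" "\<And>n k j. j \<le> n \<Longrightarrow> u n k j * g \<in> W"
  shows "x * g \<in> W"
proof (rule W_induct)
  fix n z k j assume j: "j \<le> (n::nat)"
  obtain \<kappa> where \<kappa>: "unitary_power D z * g = \<kappa> *\<^sub>C (g * unitary_power D z)"
    using unitary_power_commute[OF assms(2,3)] by blast
  have "coeff_D n z k j * g = \<kappa> *\<^sub>C (u n k j * g * unitary_power D z)"
    by (simp add: coeff_D_def mult.assoc \<kappa> mult_scaleC_right)
  then show "coeff_D n z k j * g \<in> W"
    using assms(4)[OF j] by (auto intro!: W_intros W_mult_unitary_power)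
qed fact

text \<open>The adjoints reduce to the entries already treated, since \<open>star a\<close> is
  \<open>star D * d\<close> and \<open>star b\<close> is a multiple of
  \<open>star D * c\<close>.\<close>

lemma W_mult_gens:
  assumes "x \<in> W"
  shows "x * a \<in> W" "x * b \<in> W" "x * star a \<in> W" "x * star b \<in> W"
proof -
  show "x * a \<in> W"
    by (rule W_mult_if[OF assms, of _ 1]) (simp_all add: gen_rels complex_vector.scale_one u_mult_in_W)
  show "x * b \<in> W"
    by (rule W_mult_if[OF assms, of _ "q\<^sup>2"]) (simp_all add: gen_rels u_mult_in_W)
  have c: "x * c \<in> W" if "x \<in> W" for x
    by (rule W_mult_if[OF that, of _ "inverse (q\<^sup>2)"]) (simp_all add: cd_rels u_mult_in_W)
  have d: "x * d \<in> W" if "x \<in> W" for x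
    by (rule W_mult_if[OF that, of _ 1]) (simp_all add: cd_rels complex_vector.scale_one u_mult_in_W)
  have "x * star D * d \<in> W"
    by (intro d W_mult_D assms)
  then show "x * star a \<in> W"
    by (simp add: star_a_eq mult.assoc)
  have "(- q) *\<^sub>C (x * star D * c) \<in> W"
    by (intro c W_mult_D assms W_intros)
  then show "x * star b \<in> W"
    by (simp add: star_b_eq mult.assoc mult_scaleC_right)
qed

lemma A_subset_W: "A \<subseteq> W"
proof -
  let ?l = "\<lambda>(g, s). if s then star (uq2_gens a b D g) else uq2_gens a b D g"
  have letter: "x * ?l l \<in> W" if "x \<in> W" for x l
  proof -
    obtain g s where "l = (g, s)"
      by fastforce
    then show ?thesis
      using W_mult_gens[OF that] W_mult_D that by (cases g) auto
  qed
  have words: "x * prod_list (map ?l v) \<in> W" if "x \<in> W" for x v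
    using that by (induction v arbitrary: x) (auto simp: letter simp flip: mult.assoc)
  have "1 \<in> W"
    using u_in_W(1)[of 0 0 0] by (simp add: u_0)
  then have "prod_list (map ?l v) \<in> W" for v
    using words[of 1 v] by simp
  then have "word_eval (uq2_gens a b D) w \<in> W" for w
    by (cases w) simp
  then have "free_eval (uq2_gens a b D) f \<in> W" for f
    unfolding free_eval_def W_def by (intro complex_vector.span_sum complex_vector.span_scale)
  then show ?thesis
    by (auto simp: OUq2_def)
qed

end

subsection \<open>Indexing by half-integers\<close>

definition half_index :: "nat \<Rightarrow> nat \<Rightarrow> real" where
  "half_index n k = - (real n / 2) + real k"

lemma half_index_inject [simp]: "half_index n k = half_index n l \<longleftrightarrow> k = l"
  by (simp add: half_index_def)

lemma I_set_half: "I_set (real n / 2) = half_index n ` {..n}"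
  by (auto simp: I_set_def half_index_def image_iff)

lemma nat_of_real [simp]: "nat_of (real n) = n"
  by (simp add: nat_of_def)

lemma half_index_simps:
  "2 * (real n / 2) = real n" "real n / 2 + half_index n k = real k"
  "k \<le> n \<Longrightarrow> real n / 2 - half_index n k = real (n - k)"
  by (simp_all add: half_index_def of_nat_diff)

lemma binom_real [simp]: "binom (real n) (real k) = real (n choose k)"
  by (simp add: binom_def)

section \<open>Passage to the normalised coefficients with half-integer indices\<close>

context uq2_coproduct
begin

definition weight :: "nat \<Rightarrow> nat \<Rightarrow> complex" where
  "weight n k = complex_of_real (sqrt (real (n choose k)))"

lemma weight_nonzero: "k \<le> n \<Longrightarrow> weight n k \<noteq> 0"
  by (simp add: weight_def)

lemma weight_power2: "weight n k * weight n k = of_nat (n choose k)"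
  by (simp add: weight_def flip: of_real_mult)

lemma uq2_basis_half_index:
  "k \<le> n \<Longrightarrow> uq2_basis a b (real n / 2) (half_index n k) = weight n k *\<^sub>C e n k"
  by (simp add: uq2_basis_def half_index_simps weight_def e_def del: of_nat_diff)

text \<open>The definite description is resolved by the explicit candidate \<open>t0\<close>:
  \<open>Delta_e\<close> shows that it qualifies, \<open>tens_e_eqD\<close> forces it on the index
  set, and the convention 0 forces it elsewhere. Normalising the basis conjugates \<open>u\<close>
  by the diagonal matrix of weights.\<close>

lemma uq2_coeff_half_index:
  assumes "k \<le> n" "j \<le> n"
  shows "uq2_coeff a b D tens \<Delta> (real n / 2) (half_index n k) (half_index n j) =
    (weight n j / weight n k) *\<^sub>C u n k j"
proof -
  define I where "I = I_set (real n / 2)"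
  have I: "I = half_index n ` {..n}" and inj: "inj_on (half_index n) {..n}"
    by (simp_all add: I_def I_set_half inj_on_def)
  define P where "P t \<longleftrightarrow> (\<forall>i\<in>I. \<forall>j\<in>I. t i j \<in> A) \<and>
     (\<forall>j\<in>I. \<Delta> (uq2_basis a b (real n / 2) j) = (\<Sum>i\<in>I. tens (uq2_basis a b (real n / 2) i) (t i j))) \<and>
     (\<forall>i j. i \<notin> I \<or> j \<notin> I \<longrightarrow> t i j = 0)" for t
  define t0 where "t0 i j = (if i \<in> I \<and> j \<in> I then
      (weight n (nat_of (real n / 2 + j)) / weight n (nat_of (real n / 2 + i))) *\<^sub>C
      u n (nat_of (real n / 2 + i)) (nat_of (real n / 2 + j)) else 0)" for i j
  have t0: "t0 (half_index n k) (half_index n j) = (weight n j / weight n k) *\<^sub>C u n k j"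
    if "k \<le> n" "j \<le> n" for k j
    using that by (simp add: t0_def I half_index_simps)
  have sum_eq: "(\<Sum>i\<in>I. tens (uq2_basis a b (real n / 2) i) (t i (half_index n j)))
      = (\<Sum>k\<le>n. tens (e n k) (weight n k *\<^sub>C t (half_index n k) (half_index n j)))" for t j
    unfolding I by (simp add: sum.reindex[OF inj] uq2_basis_half_index tens_simps)
  have Delta: "\<Delta> (uq2_basis a b (real n / 2) (half_index n j)) = (\<Sum>k\<le>n. tens (e n k) (weight n j *\<^sub>C u n k j))"
    if "j \<le> n" for j
    by (simp add: that uq2_basis_half_index Delta_simps Delta_e tens_simps complex_vector.scale_sum_right)
  have "P t0"
    unfolding P_def
  proof (intro conjI ballI)
    fix i assume "i \<in> I"
    then obtain j where j: "i = half_index n j" "j \<le> n"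
      by (auto simp: I)
    show "\<Delta> (uq2_basis a b (real n / 2) i) = (\<Sum>l\<in>I. tens (uq2_basis a b (real n / 2) l) (t0 l i))"
      unfolding j sum_eq Delta[OF j(2)]
      by (intro sum.cong) (simp_all add: t0 j scaleC_scaleC weight_nonzero)
  qed (auto simp: t0_def intro: A_scaleC u_in_A)
  moreover have "t = t0" if "P t" for t
  proof (intro ext)
    fix x y
    show "t x y = t0 x y"
    proof (cases "x \<in> I \<and> y \<in> I")
      case True
      then obtain k j where kj: "x = half_index n k" "y = half_index n j" "k \<le> n" "j \<le> n"
        by (auto simp: I)
      have "\<Delta> (uq2_basis a b (real n / 2) y) = (\<Sum>i\<in>I. tens (uq2_basis a b (real n / 2) i) (t i y))"
        using \<open>P t\<close> True by (simp add: P_def)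
      then have "(\<Sum>k\<le>n. tens (e n k) (weight n k *\<^sub>C t (half_index n k) (half_index n j)))
          = (\<Sum>k\<le>n. tens (e n k) (weight n j *\<^sub>C u n k j))"
        unfolding kj sum_eq Delta[OF kj(4)] by simp
      then have "weight n k *\<^sub>C t x y = weight n j *\<^sub>C u n k j"
        using kj by (auto dest: tens_e_eqD[of n _ _ k])
      then have "t x y = inverse (weight n k) *\<^sub>C weight n j *\<^sub>C u n k j"
        by (metis scaleC_scaleC complex_vector.scale_one left_inverse weight_nonzero kj(3))
      then show ?thesis
        by (simp add: kj t0 scaleC_scaleC divide_inverse mult.commute)
    next
      case False
      then show ?thesis
        using \<open>P t\<close> by (auto simp: P_def t0_def)
    qed
  qed
  ultimately have "(THE t. P t) = t0"
    by (rule the_equality)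
  then show ?thesis
    unfolding uq2_coeff_def P_def I_def by (simp add: t0 assms)
qed

lemma uq2_coeff_formula:
  assumes "k \<le> n" "j \<le> n"
  defines "l \<equiv> real n / 2" and "i \<equiv> half_index n k" and "i' \<equiv> half_index n j"
  shows "uq2_coeff a b D tens \<Delta> l i i' =
    (\<Sum>(m, r)\<in>{(m::nat, r::nat). real m + real r = l - i \<and> real m \<le> l - i' \<and> real r \<le> l + i'}.
      (q ^ (r * nat_of (l - i' - real m)) *
       complex_of_real (sqrt (binom (2 * l) (l + i')) / sqrt (binom (2 * l) (l + i)) *
         binom (l - i') (real m) * binom (l + i') (real r))) *\<^sub>C
      (a ^ m * c ^ nat_of (l - i' - real m) * b ^ r * d ^ nat_of (l + i' - real r)))"
    (is "_ = sum ?f ?S")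
proof -
  let ?P = "{p. p \<le> k \<and> p \<le> n - j \<and> k \<le> p + j}"
  let ?co = "\<lambda>p. (q ^ ((j - (k - p)) * p) * of_nat ((n - j choose p) * (j choose (k - p)))) *\<^sub>C
     (a ^ (n - j - p) * c ^ p * b ^ (j - (k - p)) * d ^ (k - p))"
  have simps: "2 * l = real n" "l + i = real k" "l - i = real (n - k)" "l + i' = real j" "l - i' = real (n - j)"
    unfolding l_def i_def i'_def by (rule half_index_simps assms(1,2))+
  have "uq2_coeff a b D tens \<Delta> l i i' = (\<Sum>p\<le>k. (weight n j / weight n k) *\<^sub>C ?co p)"
    unfolding l_def i_def i'_def uq2_coeff_half_index[OF assms(1,2)] u_def complex_vector.scale_sum_right ..
  also have "\<dots> = (\<Sum>p\<in>?P. (weight n j / weight n k) *\<^sub>C ?co p)"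
    by (rule sum.mono_neutral_right) (auto simp: not_le binomial_eq_0)
  also have "\<dots> = sum ?f ?S"
  \<comment> \<open>The stated formula runs over the exponents of \<open>a\<close> and
    \<open>b\<close>, that of \<open>u\<close> over the exponent \<open>p\<close> of
    \<open>c\<close>; the binomial coefficients agree by symmetry.\<close>
  proof (rule sum.reindex_bij_witness[of _ "\<lambda>(m, r). n - j - m" "\<lambda>p. (n - j - p, j - (k - p))"])
    fix p assume p: "p \<in> ?P"
    have *: "real (n - j) - real (n - j - p) = real p" "real j - real (j - (k - p)) = real (k - p)"
      using p by auto
    have sym: "(n - j choose (n - j - p)) = (n - j choose p)" "(j choose (j - (k - p))) = (j choose (k - p))"
      using p binomial_symmetric[of p "n - j"] binomial_symmetric[of "k - p" j] by auto
    show "?f (n - j - p, j - (k - p)) = (weight n j / weight n k) *\<^sub>C ?co p"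
      unfolding simps * prod.case nat_of_real binom_real sym scaleC_scaleC
      by (simp add: weight_def mult_ac)
    show "(n - j - p, j - (k - p)) \<in> ?S"
      unfolding simps using p assms(1,2) by (auto simp flip: of_nat_add)
  next
    fix x assume x: "x \<in> ?S"
    obtain m r where mr: "x = (m, r)" by fastforce
    then have mr': "m + r = n - k" "m \<le> n - j" "r \<le> j"
      using x unfolding simps by (simp_all flip: of_nat_add)
    show "(case x of (m, r) \<Rightarrow> n - j - m) \<in> ?P"
      using mr mr' assms(1,2) by auto
    show "(n - j - (case x of (m, r) \<Rightarrow> n - j - m), j - (k - (case x of (m, r) \<Rightarrow> n - j - m))) = x"
      using mr mr' assms(1,2) by auto
  qed auto
  finally show ?thesis .
qed

lemma uq2_coeff_times_unitary_power:
  assumes "k \<le> n" "j \<le> n"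
  shows "uq2_coeff a b D tens \<Delta> (real n / 2) (half_index n k) (half_index n j) * unitary_power D z =
    (weight n j / weight n k) *\<^sub>C coeff_D n z k j"
  by (simp add: uq2_coeff_half_index[OF assms] coeff_D_def mult_scaleC_left)

lemma coeff_D_in_A: "coeff_D n z k j \<in> A"
  unfolding coeff_D_def by (intro A_mult u_in_A A_unitary_power)

end

context uq2_haar
begin

text \<open>The squared weights contribute the quotient of \<open>n choose j\<close> by
  \<open>n choose k\<close>, which cancels the binomial coefficients in
  \<open>coeff_D_orthogonal\<close> and leaves 1/(n+1).\<close>

lemma uq2_coeff_orthogonal:
  assumes "k \<le> n" "j \<le> n" "k' \<le> n'" "j' \<le> n'"
  shows "state_inner h ((weight n j / weight n k) *\<^sub>C coeff_D n z k j)
      ((weight n' j' / weight n' k') *\<^sub>C coeff_D n' z' k' j') =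
    (if n = n' \<and> k = k' \<and> j = j' \<and> z = z' then 1 / (of_nat n + 1) else 0)"
proof -
  have "cnj (weight n j / weight n k) = weight n j / weight n k"
    by (simp add: weight_def)
  then have *: "state_inner h ((weight n j / weight n k) *\<^sub>C coeff_D n z k j)
      ((weight n' j' / weight n' k') *\<^sub>C coeff_D n' z' k' j')
    = (weight n j / weight n k) * (weight n' j' / weight n' k') * h (star (coeff_D n z k j) * coeff_D n' z' k' j')"
    by (simp add: state_inner_def star_scaleC mult_scaleC_left mult_scaleC_right h_simps mult_ac)
  have "(weight n j / weight n k) * (weight n j / weight n k) * (of_nat (n choose k) / (of_nat (n choose j) * (of_nat n + 1)))
      = 1 / (of_nat n + 1)"
    using assms(1,2) by (simp add: weight_power2)
  then show ?thesis
    unfolding * coeff_D_orthogonal[OF assms] by (auto simp: mult_ac)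
qed

lemma orthonormal_basis_uq2_coeff:
  fixes \<Lambda> :: "'a \<Rightarrow> 'h::complex_hilbert_space"
  assumes "hilbert_completion A (state_inner h) \<Lambda>"
  defines "v \<equiv> \<lambda>n z k j. \<Lambda> (complex_of_real (sqrt (real n + 1)) *\<^sub>C (weight n j / weight n k) *\<^sub>C coeff_D n z k j)"
  shows "orthonormal_basis {v n z k j | n z k j. k \<le> n \<and> j \<le> n}"
proof -
  let ?B = "{v n z k j | n z k j. k \<le> n \<and> j \<le> n}"
  have \<Lambda>: "\<And>x y. x \<in> A \<Longrightarrow> y \<in> A \<Longrightarrow> \<Lambda> (x + y) = \<Lambda> x + \<Lambda> y"
    "\<And>s x. x \<in> A \<Longrightarrow> \<Lambda> (s *\<^sub>C x) = s *\<^sub>C \<Lambda> x"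
    "\<And>x y. x \<in> A \<Longrightarrow> y \<in> A \<Longrightarrow> cinner (\<Lambda> x) (\<Lambda> y) = state_inner h x y"
    "closure (\<Lambda> ` A) = UNIV"
    using assms(1) unfolding hilbert_completion_def by blast+
  have inner: "cinner (v n z k j) (v n' z' k' j') =
      (if n = n' \<and> k = k' \<and> j = j' \<and> z = z' then 1 else 0)"
    if "k \<le> n" "j \<le> n" "k' \<le> n'" "j' \<le> n'" for n z k j n' z' k' j'
  proof -
    have "cinner (v n z k j) (v n' z' k' j') =
        state_inner h (complex_of_real (sqrt (real n + 1)) *\<^sub>C (weight n j / weight n k) *\<^sub>C coeff_D n z k j)
          (complex_of_real (sqrt (real n' + 1)) *\<^sub>C (weight n' j' / weight n' k') *\<^sub>C coeff_D n' z' k' j')"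
      unfolding v_def by (intro \<Lambda>(3) A_scaleC coeff_D_in_A)
    also have "\<dots> = complex_of_real (sqrt (real n + 1) * sqrt (real n' + 1)) *
        state_inner h ((weight n j / weight n k) *\<^sub>C coeff_D n z k j)
          ((weight n' j' / weight n' k') *\<^sub>C coeff_D n' z' k' j')"
      by (simp add: state_inner_def star_scaleC mult_scaleC_left mult_scaleC_right h_simps mult_ac)
    also have "\<dots> = (if n = n' \<and> k = k' \<and> j = j' \<and> z = z' then 1 else 0)"
    proof -
      have "complex_of_real (sqrt (real n + 1)) * complex_of_real (sqrt (real n + 1)) = of_nat n + 1"
        by (simp flip: of_real_mult)
      moreover have "of_nat n + 1 \<noteq> (0 :: complex)"
        by (simp flip: of_nat_Suc add: add.commute)
      ultimately show ?thesis
        unfolding uq2_coeff_orthogonal[OF that] by auto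
    qed
    finally show ?thesis .
  qed
  have "\<forall>x\<in>?B. \<forall>y\<in>?B. cinner x y = (if x = y then 1 else 0)"
  proof (intro ballI)
    fix x y assume "x \<in> ?B" "y \<in> ?B"
    then obtain n z k j n' z' k' j' where
      x: "x = v n z k j" "k \<le> n" "j \<le> n" and y: "y = v n' z' k' j'" "k' \<le> n'" "j' \<le> n'"
      by blast
    \<comment> \<open>The basis is a set of vectors, not a family: a vanishing inner product for
      different indices together with norm 1 shows that the vectors differ.\<close>
    have xx: "cinner x x = 1"
      using inner[OF x(2,3) x(2,3)] by (simp add: x)
    show "cinner x y = (if x = y then 1 else 0)"
    proof (cases "n = n' \<and> k = k' \<and> j = j' \<and> z = z'")
      case True
      then show ?thesis using xx x y by simp
    next
      case False
      then have "cinner x y = 0"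
        using inner[OF x(2,3) y(2,3)] by (auto simp: x y)
      then show ?thesis using xx by auto
    qed
  qed
  moreover have "\<Lambda> ` A \<subseteq> complex_vector.span ?B"
  proof -
    \<comment> \<open>Membership in \<open>A\<close> is part of the set because \<Lambda> is linear
      only there.\<close>
    let ?S = "{x \<in> A. \<Lambda> x \<in> complex_vector.span ?B}"
    have "\<Lambda> 0 = 0"
      using \<Lambda>(2)[OF A_zero, of 0] by simp
    then have "complex_vector.subspace ?S"
      by (auto simp: complex_vector.subspace_def \<Lambda> A_zero A_add A_scaleC complex_vector.span_zero
          intro: complex_vector.span_add complex_vector.span_scale)
    moreover have "coeff_D n z k j \<in> ?S" if "k \<le> n" "j \<le> n" for n z k j
    proof -
      let ?s = "complex_of_real (sqrt (real n + 1)) * (weight n j / weight n k)"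
      have "?s \<noteq> 0"
        using that by (simp add: weight_nonzero)
      moreover have "v n z k j = ?s *\<^sub>C \<Lambda> (coeff_D n z k j)"
        unfolding v_def scaleC_scaleC by (rule \<Lambda>(2)) (rule coeff_D_in_A)
      ultimately have "\<Lambda> (coeff_D n z k j) = inverse ?s *\<^sub>C v n z k j"
        by (simp only: scaleC_scaleC left_inverse complex_vector.scale_one not_False_eq_True)
      moreover have "v n z k j \<in> complex_vector.span ?B"
        using that by (intro complex_vector.span_base) blast
      ultimately show ?thesis
        by (simp add: coeff_D_in_A complex_vector.span_scale)
    qed
    ultimately have "W \<subseteq> ?S"
      unfolding W_def by (intro complex_vector.span_minimal) auto
    then show ?thesis
      using A_subset_W by auto
  qed
  ultimately show ?thesis
    unfolding orthonormal_basis_def using closure_mono[of "\<Lambda> ` A"] \<Lambda>(4) by blast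
qed

end

theorem theorem6p6:
  fixes q :: complex
    and a b D :: "'a::unital_cstar_algebra"
    and tens :: "'a \<Rightarrow> 'a \<Rightarrow> 't::unital_cstar_algebra"
    and \<Delta> :: "'a \<Rightarrow> 't"
    and h :: "'a \<Rightarrow> complex"
  assumes "cmod q = 1"
    and "\<forall>n::nat. 0 < n \<longrightarrow> q ^ n \<noteq> 1"
    and "is_CUq2 q a b D"
    and "minimal_tensor_product tens"
    and "uq2_comultiplication q a b D tens \<Delta>"
    and "haar_state tens \<Delta> h"
  defines "t \<equiv> uq2_coeff a b D tens \<Delta>"
    and "c \<equiv> - (cnj q *\<^sub>C (D * star b))"
    and "d \<equiv> D * star a"
  shows "(\<forall>l\<in>half_nats. \<forall>i\<in>I_set l. \<forall>j\<in>I_set l.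
            t l i j =
              (\<Sum>(m, n)\<in>{(m::nat, n::nat). real m + real n = l - i \<and> real m \<le> l - j \<and> real n \<le> l + j}.
                 (q ^ (n * nat_of (l - j - real m)) *
                  complex_of_real (sqrt (binom (2 * l) (l + j)) / sqrt (binom (2 * l) (l + i)) *
                    binom (l - j) (real m) * binom (l + j) (real n))) *\<^sub>C
                 (a ^ m * c ^ nat_of (l - j - real m) * b ^ n * d ^ nat_of (l + j - real n))))
       \<and> (\<forall>l\<in>half_nats. \<forall>l'\<in>half_nats. \<forall>i\<in>I_set l. \<forall>j\<in>I_set l. \<forall>i'\<in>I_set l'. \<forall>j'\<in>I_set l'.
            \<forall>m m' :: int.
            state_inner h (t l i j * unitary_power D m) (t l' i' j' * unitary_power D m') =
              (if l = l' \<and> i = i' \<and> j = j' \<and> m = m' then 1 / complex_of_real (2 * l + 1) else 0))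
       \<and> (\<forall>\<Lambda> :: 'a \<Rightarrow> 'h::complex_hilbert_space.
            hilbert_completion (OUq2 a b D) (state_inner h) \<Lambda> \<longrightarrow>
            orthonormal_basis
              {\<Lambda> (complex_of_real (sqrt (2 * l + 1)) *\<^sub>C (t l i j * unitary_power D m)) | l i j m.
                 l \<in> half_nats \<and> i \<in> I_set l \<and> j \<in> I_set l})"
proof -
  interpret H: uq2_haar q a b D tens \<Delta> h
  proof
    show "free_eval (uq2_gens a b D) r = 0" if "r \<in> uq2_relations q" for r
      using assms(3) that by (simp add: is_CUq2_def universal_cstar_algebra_def)
  qed fact+
  have c: "c = H.c" and d: "d = H.d"
    by (simp_all add: c_def d_def H.c_def H.d_def)
  have index: thesis
    if l: "l \<in> half_nats" "i \<in> I_set l" "j \<in> I_set l"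
      and cont: "\<And>n k k'. l = real n / 2 \<Longrightarrow> i = half_index n k \<Longrightarrow> j = half_index n k' \<Longrightarrow> k \<le> n \<Longrightarrow> k' \<le> n \<Longrightarrow> thesis"
    for l i j thesis
  proof -
    obtain n where n: "l = real n / 2"
      using l(1) by (auto simp: half_nats_def)
    then obtain k k' where "i = half_index n k" "j = half_index n k'" "k \<le> n" "k' \<le> n"
      using l(2,3) unfolding n I_set_half by auto
    then show thesis
      using cont n by blast
  qed
  have half: "complex_of_real (2 * (real n / 2) + 1) = of_nat n + 1" "2 * (real n / 2) + 1 = real n + 1" for n
    by simp_all
  note coeff = H.uq2_coeff_times_unitary_power
  show ?thesis
  proof (intro conjI allI ballI impI)
    fix l i j assume "l \<in> half_nats" "i \<in> I_set l" "j \<in> I_set l"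
    then show "t l i j =
              (\<Sum>(m, n)\<in>{(m::nat, n::nat). real m + real n = l - i \<and> real m \<le> l - j \<and> real n \<le> l + j}.
                 (q ^ (n * nat_of (l - j - real m)) *
                  complex_of_real (sqrt (binom (2 * l) (l + j)) / sqrt (binom (2 * l) (l + i)) *
                    binom (l - j) (real m) * binom (l + j) (real n))) *\<^sub>C
                 (a ^ m * c ^ nat_of (l - j - real m) * b ^ n * d ^ nat_of (l + j - real n)))"
      by (rule index) (simp only: t_def c d H.uq2_coeff_formula)
  next
    fix l l' i j i' j' and m m' :: int
    assume l: "l \<in> half_nats" "i \<in> I_set l" "j \<in> I_set l" and l': "l' \<in> half_nats" "i' \<in> I_set l'" "j' \<in> I_set l'"
    obtain n k r where n: "l = real n / 2" "i = half_index n k" "j = half_index n r" "k \<le> n" "r \<le> n"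
      by (rule index[OF l])
    obtain n' k' r' where n': "l' = real n' / 2" "i' = half_index n' k'" "j' = half_index n' r'" "k' \<le> n'" "r' \<le> n'"
      by (rule index[OF l'])
    show "state_inner h (t l i j * unitary_power D m) (t l' i' j' * unitary_power D m') =
              (if l = l' \<and> i = i' \<and> j = j' \<and> m = m' then 1 / complex_of_real (2 * l + 1) else 0)"
      unfolding t_def n(1-3) n'(1-3) coeff[OF n(4,5)] coeff[OF n'(4,5)] half
        H.uq2_coeff_orthogonal[OF n(4,5) n'(4,5)]
      by auto
  next
    fix \<Lambda> :: "'a \<Rightarrow> 'h"
    assume \<Lambda>: "hilbert_completion (OUq2 a b D) (state_inner h) \<Lambda>"
    have "{\<Lambda> (complex_of_real (sqrt (2 * l + 1)) *\<^sub>C (t l i j * unitary_power D m)) | l i j m.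
                 l \<in> half_nats \<and> i \<in> I_set l \<and> j \<in> I_set l}
      = {\<Lambda> (complex_of_real (sqrt (real n + 1)) *\<^sub>C (H.weight n r / H.weight n k) *\<^sub>C H.coeff_D n z k r) | n z k r.
          k \<le> n \<and> r \<le> n}" (is "?L = ?R")
    proof (intro equalityI subsetI)
      fix x assume "x \<in> ?L"
      then obtain l i j m where x: "x = \<Lambda> (complex_of_real (sqrt (2 * l + 1)) *\<^sub>C (t l i j * unitary_power D m))"
        and l: "l \<in> half_nats" "i \<in> I_set l" "j \<in> I_set l"
        by blast
      obtain n k r where n: "l = real n / 2" "i = half_index n k" "j = half_index n r" "k \<le> n" "r \<le> n"
        by (rule index[OF l])
      show "x \<in> ?R"
        unfolding x t_def n(1-3) coeff[OF n(4,5)] half using n(4,5) by blast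
    next
      fix x assume "x \<in> ?R"
      then obtain n z k r where x: "x = \<Lambda> (complex_of_real (sqrt (real n + 1)) *\<^sub>C
          (H.weight n r / H.weight n k) *\<^sub>C H.coeff_D n z k r)" and kr: "k \<le> n" "r \<le> n"
        by blast
      have "x = \<Lambda> (complex_of_real (sqrt (2 * (real n / 2) + 1)) *\<^sub>C
          (t (real n / 2) (half_index n k) (half_index n r) * unitary_power D z))"
        unfolding x t_def coeff[OF kr] half ..
      moreover have "real n / 2 \<in> half_nats" "half_index n k \<in> I_set (real n / 2)" "half_index n r \<in> I_set (real n / 2)"
        using kr by (auto simp: half_nats_def I_set_half)
      ultimately show "x \<in> ?L"
        by blast
    qed
    then show "orthonormal_basis {\<Lambda> (complex_of_real (sqrt (2 * l + 1)) *\<^sub>C (t l i j * unitary_power D m)) | l i j m.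
                 l \<in> half_nats \<and> i \<in> I_set l \<and> j \<in> I_set l}"
      using H.orthonormal_basis_uq2_coeff[OF \<Lambda>] by simp
  qed
qed

end
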